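(* If $[\mathcal{I},\|\cdot\|_{\mathcal{I}}]$ is a completely symmetric injective normed operator ideal, then the weighted holomorphic ideal $[\mathcal{I}^{\mathcal{H}_v^\infty\text{-}\mathrm{dual}},\|\cdot\|_{\mathcal{I}^{\mathcal{H}_v^\infty\text{-}\mathrm{dual}}}]$ is injective.
   Context: All Banach spaces are complex. $U$ denotes an open subset of a complex Banach space $E$ and $v$ a weight on $U$, i.e. a continuous function $v\colon U\to(0,\infty)$. $\mathcal{H}_v^\infty(U,F)$ is the Banach space of all holomorphic $f\colon U\to F$ with $\|f\|_v:=\sup_{x\in U}v(x)\|f(x)\|<\infty$; $\mathcal{H}_v^\infty(U):=\mathcal{H}_v^\infty(U,\mathbb{C})$. $\mathcal{L}(E,F)$ is the space of bounded linear operators; $T^*$ is the adjoint of $T$. Normed operator ideals are in the sense of Pietsch. A normed operator ideal $[\mathcal{I},\|\cdot\|_{\mathcal{I}}]$ is injective if for each Banach space $G$ and each isometric linear embedding $\iota\colon F\to G$, an operator $T\in\mathcal{L}(E,F)$ belongs to $\mathcal{I}(E,F)$, with $\|T\|_{\mathcal{I}}=\|\iota\circ T\|_{\mathcal{I}}$, whenever $\iota\circ T\in\mathcal{I}(E,G)$. The dual ideal is $\mathcal{I}^{\mathrm{dual}}(E,F)=\{T\in\mathcal{L}(E,F)\colon T^*\in\mathcal{I}(F^*,E^* )\}$ with $\|T\|_{\mathcal{I}^{\mathrm{dual}}}=\|T^*\|_{\mathcal{I}}$; $\mathcal{I}$ is completely symmetric if $[\mathcal{I},\|\cdot\|_{\mathcal{I}}]=[\mathcal{I}^{\mathrm{dual}},\|\cdot\|_{\mathcal{I}^{\mathrm{dual}}}]$.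 For $f\in\mathcal{H}_v^\infty(U,F)$, $f^t\in\mathcal{L}(F^*,\mathcal{H}_v^\infty(U))$ is $f^t(y^* )=y^*\circ f$. $\mathcal{I}^{\mathcal{H}_v^\infty\text{-}\mathrm{dual}}(U,F)=\{f\in\mathcal{H}_v^\infty(U,F)\colon f^t\in\mathcal{I}(F^*,\mathcal{H}_v^\infty(U))\}$, with $\|f\|_{\mathcal{I}^{\mathcal{H}_v^\infty\text{-}\mathrm{dual}}}=\|f^t\|_{\mathcal{I}}$. A normed weighted holomorphic ideal is an assignment $[\mathcal{A},\|\cdot\|_{\mathcal{A}}]$ of normed spaces $\mathcal{A}(U,F)\subseteq\mathcal{H}_v^\infty(U,F)$ (for every $U$, $v$ and complex Banach space $F$) with $\|\cdot\|_v\leq\|\cdot\|_{\mathcal{A}}$, containing the maps $h\cdot y\colon x\mapsto h(x)y$ ($h\in\mathcal{H}_v^\infty(U)$, $y\in F$) with $\|h\cdot y\|_{\mathcal{A}}=\|h\|_v\|y\|$, and such that $T\circ f\circ h\in\mathcal{A}(V,G)$ with $\|T\circ f\circ h\|_{\mathcal{A}}\leq\|T\|\|f\|_{\mathcal{A}}c_v(h)$ whenever $V\subseteq U$ is open (with restricted weight), $h\colon V\to U$ is holomorphic with $c_v(h):=\sup_{x\in V}v(x)/v(h(x))<\infty$, $f\in\mathcal{A}(U,F)$ and $T\in\mathcal{L}(F,G)$ with $G$ a complex Banach space. It is injective if for any $f\in\mathcal{H}_v^\infty(U,F)$, any complex Banach space $G$ and any into linear isometry $\iota\colon F\to G$, $\iota\circ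 f\in\mathcal{A}(U,G)$ implies $f\in\mathcal{A}(U,F)$ with $\|f\|_{\mathcal{A}}=\|\iota\circ f\|_{\mathcal{A}}$. *)

theory Defs
  imports "HOL-Analysis.Analysis" "HOL-Library.FuncSet" "HOL-Library.Equipollence"
begin

text \<open>
  The statement quantifies over all Banach spaces, and assigns to a pair of spaces a set of
  operators. Spaces are therefore values, not types: a space over the type \<open>'a\<close> consists of a
  carrier, operations and a norm. Mappings between spaces are extensional functions
  (\<open>undefined\<close> off their domain), so that equality of mappings is equality of functions.
\<close>

record 'a cspace =
  carr :: "'a set"
  vadd :: "'a \<Rightarrow> 'a \<Rightarrow> 'a"
  vzero :: 'a
  vscale :: "complex \<Rightarrow> 'a \<Rightarrow> 'a"
  vnorm :: "'a \<Rightarrow> real"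

definition vminus :: "'a cspace \<Rightarrow> 'a \<Rightarrow> 'a \<Rightarrow> 'a" where
  "vminus X x y = vadd X x (vscale X (- 1) y)"

text \<open>The value off the carrier is fixed because the locale \<open>Metric_space\<close> requires
  nonnegativity and symmetry of the distance on the whole type.\<close>

definition vdist :: "'a cspace \<Rightarrow> 'a \<Rightarrow> 'a \<Rightarrow> real" where
  "vdist X x y = (if x \<in> carr X \<and> y \<in> carr X then vnorm X (vminus X x y) else 0)"

abbreviation norm_topology :: "'a cspace \<Rightarrow> 'a topology" where
  "norm_topology X \<equiv> Metric_space.mtopology (carr X) (vdist X)"

locale complex_normed_space =
  fixes X :: "'a cspace"
  assumes add_closed: "\<And>x y. x \<in> carr X \<Longrightarrow> y \<in> carr X \<Longrightarrow> vadd X x y \<in> carr X"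
    and zero_closed: "vzero X \<in> carr X"
    and scale_closed: "\<And>a x. x \<in> carr X \<Longrightarrow> vscale X a x \<in> carr X"
    and add_assoc: "\<And>x y z. x \<in> carr X \<Longrightarrow> y \<in> carr X \<Longrightarrow> z \<in> carr X \<Longrightarrow>
          vadd X (vadd X x y) z = vadd X x (vadd X y z)"
    and add_commute: "\<And>x y. x \<in> carr X \<Longrightarrow> y \<in> carr X \<Longrightarrow> vadd X x y = vadd X y x"
    and add_zero: "\<And>x. x \<in> carr X \<Longrightarrow> vadd X (vzero X) x = x"
    and minus_self: "\<And>x. x \<in> carr X \<Longrightarrow> vminus X x x = vzero X"
    and scale_add_right: "\<And>a x y. x \<in> carr X \<Longrightarrow> y \<in> carr X \<Longrightarrow>
          vscale X a (vadd X x y) = vadd X (vscale X a x) (vscale X a y)"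
    and scale_add_left: "\<And>a b x. x \<in> carr X \<Longrightarrow>
          vscale X (a + b) x = vadd X (vscale X a x) (vscale X b x)"
    and scale_scale: "\<And>a b x. x \<in> carr X \<Longrightarrow> vscale X a (vscale X b x) = vscale X (a * b) x"
    and scale_one: "\<And>x. x \<in> carr X \<Longrightarrow> vscale X 1 x = x"
    and norm_nonneg: "\<And>x. x \<in> carr X \<Longrightarrow> 0 \<le> vnorm X x"
    and norm_eq_zero: "\<And>x. x \<in> carr X \<Longrightarrow> vnorm X x = 0 \<longleftrightarrow> x = vzero X"
    and norm_triangle: "\<And>x y. x \<in> carr X \<Longrightarrow> y \<in> carr X \<Longrightarrow>
          vnorm X (vadd X x y) \<le> vnorm X x + vnorm X y"
    and norm_scale: "\<And>a x. x \<in> carr X \<Longrightarrow> vnorm X (vscale X a x) = cmod a * vnorm X x"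

locale complex_banach_space = complex_normed_space +
  assumes complete: "Metric_space.mcomplete (carr X) (vdist X)"

definition complex_line :: "complex cspace" where
  "complex_line = \<lparr>carr = UNIV, vadd = (+), vzero = 0, vscale = (*), vnorm = cmod\<rparr>"

definition fun_space ::
    "'a set \<Rightarrow> 'b cspace \<Rightarrow> ('a \<Rightarrow> 'b) set \<Rightarrow> (('a \<Rightarrow> 'b) \<Rightarrow> real) \<Rightarrow> ('a \<Rightarrow> 'b) cspace" where
  "fun_space S F A N =
    \<lparr>carr = A,
     vadd = (\<lambda>f g. \<lambda>x\<in>S. vadd F (f x) (g x)),
     vzero = (\<lambda>x\<in>S. vzero F),
     vscale = (\<lambda>c f. \<lambda>x\<in>S. vscale F c (f x)),
     vnorm = N\<rparr>"

text \<open>Supremum of a set of nonnegative reals, with the value 0 for the empty set; it is needed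
  because the open set \<open>U\<close> may be empty.\<close>

definition sup_nonneg :: "real set \<Rightarrow> real" where
  "sup_nonneg S = Sup (insert 0 S)"

definition bounded_operators :: "'a cspace \<Rightarrow> 'b cspace \<Rightarrow> ('a \<Rightarrow> 'b) set" where
  "bounded_operators E F = {T \<in> carr E \<rightarrow>\<^sub>E carr F.
     (\<forall>x\<in>carr E. \<forall>y\<in>carr E. T (vadd E x y) = vadd F (T x) (T y)) \<and>
     (\<forall>c. \<forall>x\<in>carr E. T (vscale E c x) = vscale F c (T x)) \<and>
     (\<exists>C. \<forall>x\<in>carr E. vnorm F (T x) \<le> C * vnorm E x)}"

definition operator_norm :: "'a cspace \<Rightarrow> 'b cspace \<Rightarrow> ('a \<Rightarrow> 'b) \<Rightarrow> real" where
  "operator_norm E F T = sup_nonneg {vnorm F (T x) | x. x \<in> carr E \<and> vnorm E x \<le> 1}"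

definition dual_space :: "'a cspace \<Rightarrow> ('a \<Rightarrow> complex) cspace" where
  "dual_space E = fun_space (carr E) complex_line
     (bounded_operators E complex_line) (operator_norm E complex_line)"

definition adjoint_operator ::
    "'a cspace \<Rightarrow> 'b cspace \<Rightarrow> ('a \<Rightarrow> 'b) \<Rightarrow> ('b \<Rightarrow> complex) \<Rightarrow> ('a \<Rightarrow> complex)" where
  "adjoint_operator E F T = (\<lambda>\<phi>\<in>carr (dual_space F). compose (carr E) \<phi> T)"

definition isometric_embedding :: "('a \<Rightarrow> 'b) \<Rightarrow> 'a cspace \<Rightarrow> 'b cspace \<Rightarrow> bool" where
  "isometric_embedding j E F \<longleftrightarrow>
     j \<in> bounded_operators E F \<and> (\<forall>x\<in>carr E. vnorm F (j x) = vnorm E x)"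

definition isometric_isomorphism :: "('a \<Rightarrow> 'b) \<Rightarrow> 'a cspace \<Rightarrow> 'b cspace \<Rightarrow> bool" where
  "isometric_isomorphism j E F \<longleftrightarrow> isometric_embedding j E F \<and> j ` carr E = carr F"

text \<open>
  An operator ideal is defined on the Banach spaces over one type \<open>'w\<close>. The axioms are those of
  Pietsch: the identity of the scalar field belongs to the ideal and has norm 1, the components
  are normed linear spaces, and the ideal inequality holds. (That rank-one operators
  satisfy \<open>\<parallel>x\<^sup>* \<otimes> y\<parallel> = \<parallel>x\<^sup>*\<parallel> \<parallel>y\<parallel>\<close>, and that the ideal norm dominates the operator norm, are
  consequences.) The scalar field occurs over \<open>'w\<close> as any space isometrically isomorphic to it.
\<close>

type_synonym 'w operator_class = "'w cspace \<Rightarrow> 'w cspace \<Rightarrow> ('w \<Rightarrow> 'w) set"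
type_synonym 'w operator_class_norm = "'w cspace \<Rightarrow> 'w cspace \<Rightarrow> ('w \<Rightarrow> 'w) \<Rightarrow> real"

definition normed_operator_ideal :: "'w operator_class \<Rightarrow> 'w operator_class_norm \<Rightarrow> bool" where
  "normed_operator_ideal I \<alpha> \<longleftrightarrow>
    (\<forall>K j. complex_banach_space K \<and> isometric_isomorphism j K complex_line \<longrightarrow>
       (\<lambda>x\<in>carr K. x) \<in> I K K \<and> \<alpha> K K (\<lambda>x\<in>carr K. x) = 1) \<and>
    (\<forall>E F. complex_banach_space E \<and> complex_banach_space F \<longrightarrow>
       I E F \<subseteq> bounded_operators E F \<and>
       complex_normed_space (fun_space (carr E) F (I E F) (\<alpha> E F))) \<and>
    (\<forall>D E F G R T S.
       complex_banach_space D \<and> complex_banach_space E \<and>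
       complex_banach_space F \<and> complex_banach_space G \<and>
       R \<in> bounded_operators D E \<and> T \<in> I E F \<and> S \<in> bounded_operators F G \<longrightarrow>
       compose (carr D) S (compose (carr D) T R) \<in> I D G \<and>
       \<alpha> D G (compose (carr D) S (compose (carr D) T R))
         \<le> operator_norm F G S * \<alpha> E F T * operator_norm D E R)"

definition injective_operator_ideal ::
    "'w operator_class \<Rightarrow> 'w operator_class_norm \<Rightarrow> bool" where
  "injective_operator_ideal I \<alpha> \<longleftrightarrow>
    (\<forall>E F G j T.
       complex_banach_space E \<and> complex_banach_space F \<and> complex_banach_space G \<and>
       isometric_embedding j F G \<and> T \<in> bounded_operators E F \<and>
       compose (carr E) j T \<in> I E G \<longrightarrow>
       T \<in> I E F \<and> \<alpha> E F T = \<alpha> E G (compose (carr E) j T))"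

text \<open>
  Dual spaces and function spaces over \<open>'w\<close> live over other types, such as \<open>'w \<Rightarrow> complex\<close>, and
  an infinite type need not contain copies of the duals of all spaces over it. An ideal over \<open>'w\<close> is therefore evaluated on an operator
  \<open>S\<close> between spaces over other types by identifying these spaces with isometrically isomorphic
  ones over \<open>'w\<close>. By the ideal inequality neither membership nor norm depends on the choice of
  the copies.
\<close>

definition operator_copy ::
    "'a cspace \<Rightarrow> 'b cspace \<Rightarrow> ('a \<Rightarrow> 'b) \<Rightarrow> 'w cspace \<Rightarrow> 'w cspace \<Rightarrow> ('w \<Rightarrow> 'w) \<Rightarrow> bool" where
  "operator_copy X Y S X' Y' S' \<longleftrightarrow>
     complex_banach_space X' \<and> complex_banach_space Y' \<and> S' \<in> bounded_operators X' Y' \<and>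
     (\<exists>\<phi> \<psi>. isometric_isomorphism \<phi> X X' \<and> isometric_isomorphism \<psi> Y Y' \<and>
        (\<forall>x\<in>carr X. S' (\<phi> x) = \<psi> (S x)))"

definition ideal_on ::
    "'w operator_class \<Rightarrow> 'a cspace \<Rightarrow> 'b cspace \<Rightarrow> ('a \<Rightarrow> 'b) set" where
  "ideal_on I X Y =
     {S \<in> bounded_operators X Y. \<exists>X' Y' S'. operator_copy X Y S X' Y' S' \<and> S' \<in> I X' Y'}"

definition ideal_norm_on ::
    "'w operator_class_norm \<Rightarrow> 'a cspace \<Rightarrow> 'b cspace \<Rightarrow> ('a \<Rightarrow> 'b) \<Rightarrow> real" where
  "ideal_norm_on \<alpha> X Y S =
     (SOME r. \<exists>X' Y' S'. operator_copy X Y S X' Y' S' \<and> r = \<alpha> X' Y' S')"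

definition dual_ideal :: "'w operator_class \<Rightarrow> 'w operator_class" where
  "dual_ideal I E F =
     {T \<in> bounded_operators E F. adjoint_operator E F T \<in> ideal_on I (dual_space F) (dual_space E)}"

definition dual_ideal_norm :: "'w operator_class_norm \<Rightarrow> 'w operator_class_norm" where
  "dual_ideal_norm \<alpha> E F T =
     ideal_norm_on \<alpha> (dual_space F) (dual_space E) (adjoint_operator E F T)"

definition has_dual_copy :: "'w cspace \<Rightarrow> bool" where
  "has_dual_copy E \<longleftrightarrow>
     (\<exists>(X' :: 'w cspace) \<phi>. complex_banach_space X' \<and> isometric_isomorphism \<phi> (dual_space E) X')"

text \<open>
  The ideal and its dual are compared on those pairs of spaces over \<open>'w\<close> whose duals have copies
  over \<open>'w\<close>; on the remaining pairs the dual ideal is not determined by an ideal over \<open>'w\<close>.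
\<close>

definition completely_symmetric :: "'w operator_class \<Rightarrow> 'w operator_class_norm \<Rightarrow> bool" where
  "completely_symmetric I \<alpha> \<longleftrightarrow>
    (\<forall>E F. complex_banach_space E \<and> complex_banach_space F \<and>
       has_dual_copy E \<and> has_dual_copy F \<longrightarrow>
       I E F = dual_ideal I E F \<and> (\<forall>T\<in>I E F. \<alpha> E F T = dual_ideal_norm \<alpha> E F T))"

text \<open>Between complex Banach spaces, holomorphy (local representability by power series of
  continuous homogeneous polynomials) on an open set is the same as complex Frechet
  differentiability at every point; the latter serves as the definition.\<close>

definition holomorphic_maps ::
    "'a cspace \<Rightarrow> 'a set \<Rightarrow> 'b cspace \<Rightarrow> ('a \<Rightarrow> 'b) set" where
  "holomorphic_maps E U F = {f \<in> U \<rightarrow>\<^sub>E carr F.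
     \<forall>a\<in>U. \<exists>D\<in>bounded_operators E F. \<forall>\<epsilon>>0. \<exists>\<delta>>0. \<forall>x\<in>U. vnorm E (vminus E x a) < \<delta> \<longrightarrow>
       vnorm F (vminus F (vminus F (f x) (f a)) (D (vminus E x a)))
         \<le> \<epsilon> * vnorm E (vminus E x a)}"

definition weighted_open_set :: "'a cspace \<Rightarrow> 'a set \<Rightarrow> ('a \<Rightarrow> real) \<Rightarrow> bool" where
  "weighted_open_set E U v \<longleftrightarrow>
     complex_banach_space E \<and> openin (norm_topology E) U \<and> v \<in> U \<rightarrow>\<^sub>E {0<..} \<and>
     continuous_map (subtopology (norm_topology E) U) euclideanreal v"

definition weighted_norm :: "'a set \<Rightarrow> ('a \<Rightarrow> real) \<Rightarrow> 'b cspace \<Rightarrow> ('a \<Rightarrow> 'b) \<Rightarrow> real" where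
  "weighted_norm U v F f = sup_nonneg ((\<lambda>x. v x * vnorm F (f x)) ` U)"

definition weighted_holomorphic ::
    "'a cspace \<Rightarrow> 'a set \<Rightarrow> ('a \<Rightarrow> real) \<Rightarrow> 'b cspace \<Rightarrow> ('a \<Rightarrow> 'b) set" where
  "weighted_holomorphic E U v F =
     {f \<in> holomorphic_maps E U F. bdd_above ((\<lambda>x. v x * vnorm F (f x)) ` U)}"

definition weighted_holomorphic_space ::
    "'a cspace \<Rightarrow> 'a set \<Rightarrow> ('a \<Rightarrow> real) \<Rightarrow> 'b cspace \<Rightarrow> ('a \<Rightarrow> 'b) cspace" where
  "weighted_holomorphic_space E U v F =
     fun_space U F (weighted_holomorphic E U v F) (weighted_norm U v F)"

definition transpose_map ::
    "'a set \<Rightarrow> 'b cspace \<Rightarrow> ('a \<Rightarrow> 'b) \<Rightarrow> ('b \<Rightarrow> complex) \<Rightarrow> ('a \<Rightarrow> complex)" where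
  "transpose_map U F f = (\<lambda>\<phi>\<in>carr (dual_space F). compose U \<phi> f)"

definition composition_constant :: "'a set \<Rightarrow> ('a \<Rightarrow> real) \<Rightarrow> ('a \<Rightarrow> 'a) \<Rightarrow> real" where
  "composition_constant V v h = sup_nonneg ((\<lambda>x. v x / v (h x)) ` V)"

text \<open>
  A weighted holomorphic ideal is defined on all \<open>E, U, v, F\<close> over one type \<open>'s\<close>. When it is
  built from an operator ideal over \<open>'w\<close>, the type \<open>'w\<close> has to be large enough to contain copies of
  the duals, of the spaces of weighted holomorphic functions and of their duals; these all live
  over \<open>'s \<Rightarrow> complex\<close> or, up to isometric isomorphism, over \<open>('s \<Rightarrow> complex) \<Rightarrow> complex\<close>.
\<close>

type_synonym 's holomorphic_class =
  "'s cspace \<Rightarrow> 's set \<Rightarrow> ('s \<Rightarrow> real) \<Rightarrow> 's cspace \<Rightarrow> ('s \<Rightarrow> 's) set"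
type_synonym 's holomorphic_class_norm =
  "'s cspace \<Rightarrow> 's set \<Rightarrow> ('s \<Rightarrow> real) \<Rightarrow> 's cspace \<Rightarrow> ('s \<Rightarrow> 's) \<Rightarrow> real"

definition normed_weighted_holomorphic_ideal ::
    "'s holomorphic_class \<Rightarrow> 's holomorphic_class_norm \<Rightarrow> bool" where
  "normed_weighted_holomorphic_ideal A N \<longleftrightarrow>
    (\<forall>E U v F. weighted_open_set E U v \<and> complex_banach_space F \<longrightarrow>
       A E U v F \<subseteq> weighted_holomorphic E U v F \<and>
       complex_normed_space (fun_space U F (A E U v F) (N E U v F)) \<and>
       (\<forall>f\<in>A E U v F. weighted_norm U v F f \<le> N E U v F f) \<and>
       (\<forall>h\<in>weighted_holomorphic E U v complex_line. \<forall>y\<in>carr F.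
          (\<lambda>x\<in>U. vscale F (h x) y) \<in> A E U v F \<and>
          N E U v F (\<lambda>x\<in>U. vscale F (h x) y) = weighted_norm U v complex_line h * vnorm F y)) \<and>
    (\<forall>E U v F G V h f T.
       weighted_open_set E U v \<and> complex_banach_space F \<and> complex_banach_space G \<and>
       openin (norm_topology E) V \<and> V \<subseteq> U \<and>
       h \<in> holomorphic_maps E V E \<and> h ` V \<subseteq> U \<and> bdd_above ((\<lambda>x. v x / v (h x)) ` V) \<and>
       f \<in> A E U v F \<and> T \<in> bounded_operators F G \<longrightarrow>
       (\<lambda>x\<in>V. T (f (h x))) \<in> A E V (restrict v V) G \<and>
       N E V (restrict v V) G (\<lambda>x\<in>V. T (f (h x)))
         \<le> operator_norm F G T * N E U v F f * composition_constant V v h)"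

definition injective_weighted_holomorphic_ideal ::
    "'s holomorphic_class \<Rightarrow> 's holomorphic_class_norm \<Rightarrow> bool" where
  "injective_weighted_holomorphic_ideal A N \<longleftrightarrow>
    normed_weighted_holomorphic_ideal A N \<and>
    (\<forall>E U v F G j f.
       weighted_open_set E U v \<and> complex_banach_space F \<and> complex_banach_space G \<and>
       f \<in> weighted_holomorphic E U v F \<and> isometric_embedding j F G \<and>
       compose U j f \<in> A E U v G \<longrightarrow>
       f \<in> A E U v F \<and> N E U v F f = N E U v G (compose U j f))"

definition weighted_dual_ideal :: "'w operator_class \<Rightarrow> 's holomorphic_class" where
  "weighted_dual_ideal I E U v F =
     {f \<in> weighted_holomorphic E U v F.
        transpose_map U F f
          \<in> ideal_on I (dual_space F) (weighted_holomorphic_space E U v complex_line)}"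

definition weighted_dual_ideal_norm ::
    "'w operator_class_norm \<Rightarrow> 's holomorphic_class_norm" where
  "weighted_dual_ideal_norm \<alpha> E U v F f =
     ideal_norm_on \<alpha> (dual_space F) (weighted_holomorphic_space E U v complex_line)
       (transpose_map U F f)"

end

theory Submission
  imports Defs "HOL-Complex_Analysis.Cauchy_Integral_Formula"
begin

text \<open>
  Write \<open>f\<^sup>t\<close> for the transpose of \<open>f\<close> and let \<open>j\<close> be an isometric embedding of \<open>F\<close> into \<open>G\<close>. Then
  \<open>(j \<circ> f)\<^sup>t = f\<^sup>t \<circ> j\<^sup>*\<close>, and by the Hahn--Banach theorem \<open>j\<^sup>*\<close> is a metric surjection of \<open>G\<^sup>*\<close> onto
  \<open>F\<^sup>*\<close>. Injectivity of the holomorphic ideal therefore means that metric surjections can be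
  cancelled on the right of members of the operator ideal. This follows from the hypotheses by
  duality (\<open>ideal_on_surjective\<close>): the adjoint of \<open>S \<circ> Q\<close> is \<open>Q\<^sup>* \<circ> S\<^sup>*\<close>, where \<open>Q\<^sup>*\<close> is an isometric
  embedding because \<open>Q\<close> is a metric surjection; injectivity cancels \<open>Q\<^sup>*\<close>, and complete symmetry
  leads from \<open>S \<circ> Q\<close> to its adjoint and from \<open>S\<^sup>*\<close> back to \<open>S\<close>, each time with equal norms.

  That the assignment is a normed weighted holomorphic ideal at all follows from the identities
  \<open>(f + g)\<^sup>t = f\<^sup>t + g\<^sup>t\<close> and \<open>(T \<circ> f \<circ> h)\<^sup>t = C\<^sub>h \<circ> f\<^sup>t \<circ> T\<^sup>*\<close>, where \<open>C\<^sub>h\<close> is the composition operator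
  \<open>g \<mapsto> g \<circ> h\<close>, of norm at most the composition constant of \<open>h\<close>. The inequality between the weighted
  norm and the ideal norm comes from compressing \<open>f\<^sup>t\<close> to a multiple of the scalar identity with the
  help of a point evaluation and a norming functional.

  Two points need work beyond these identities. The ideal is given only on spaces over one type
  and reaches other spaces through isometric copies, so its axioms are first transferred to all
  spaces that have a copy. Copies are Banach spaces, so the dual spaces and the spaces of weighted
  holomorphic functions have to be complete. For the latter the point is that a locally uniform
  limit of holomorphic functions is holomorphic, which the Cauchy estimates along complex lines
  give on arbitrary normed spaces (\<open>holomorphic_locally_uniform_limit\<close>).
\<close>

section \<open>Normed spaces and bounded operators on carrier sets\<close>

lemma fun_space_simps [simp]:
  "carr (fun_space S F A N) = A"
  "vadd (fun_space S F A N) f g = (\<lambda>x\<in>S. vadd F (f x) (g x))"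
  "vzero (fun_space S F A N) = (\<lambda>x\<in>S. vzero F)"
  "vscale (fun_space S F A N) c f = (\<lambda>x\<in>S. vscale F c (f x))"
  "vnorm (fun_space S F A N) = N"
  by (simp_all add: fun_space_def)

lemma complex_line_simps [simp]:
  "carr complex_line = UNIV"
  "vadd complex_line = (+)"
  "vzero complex_line = 0"
  "vscale complex_line = (*)"
  "vnorm complex_line = cmod"
  "vminus complex_line a b = a - b"
  by (simp_all add: complex_line_def vminus_def)

context complex_normed_space
begin

lemma minus_closed: "x \<in> carr X \<Longrightarrow> y \<in> carr X \<Longrightarrow> vminus X x y \<in> carr X"
  by (simp add: vminus_def add_closed scale_closed)

lemmas closed = add_closed zero_closed scale_closed minus_closed

lemma add_left_commute:
  assumes "x \<in> carr X" "y \<in> carr X" "z \<in> carr X"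
  shows "vadd X x (vadd X y z) = vadd X y (vadd X x z)"
  using assms by (metis add_assoc add_commute)

lemmas add_ac = add_assoc add_commute add_left_commute

lemma scale_zero_left: "x \<in> carr X \<Longrightarrow> vscale X 0 x = vzero X"
  using scale_add_left[of x 1 "- 1"] minus_self[of x] by (simp add: vminus_def scale_one)

lemma scale_zero_right: "vscale X a (vzero X) = vzero X"
  using scale_scale[of "vzero X" a 0] scale_zero_left zero_closed by simp

lemma add_zero_right: "x \<in> carr X \<Longrightarrow> vadd X x (vzero X) = x"
  using add_zero add_commute zero_closed by simp

lemma norm_zero: "vnorm X (vzero X) = 0"
  using norm_eq_zero zero_closed by simp

lemma minus_zero: "x \<in> carr X \<Longrightarrow> vminus X x (vzero X) = x"
  by (simp add: vminus_def scale_zero_right add_zero_right)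

lemma add_minus_cancel:
  assumes "x \<in> carr X" "y \<in> carr X"
  shows "vadd X x (vminus X y x) = y" "vminus X (vadd X x y) x = y"
proof -
  have "vadd X x (vscale X (- 1) x) = vzero X"
    using minus_self[OF assms(1)] by (simp add: vminus_def)
  moreover have "vadd X x (vminus X y x) = vadd X y (vadd X x (vscale X (- 1) x))"
    using assms by (simp add: vminus_def add_ac closed)
  moreover have "vminus X (vadd X x y) x = vadd X y (vadd X x (vscale X (- 1) x))"
    using assms by (simp add: vminus_def add_ac closed)
  ultimately show "vadd X x (vminus X y x) = y" "vminus X (vadd X x y) x = y"
    using assms by (simp_all add: add_zero_right)
qed

lemma minus_eq_zero:
  assumes "x \<in> carr X" "y \<in> carr X" "vminus X x y = vzero X"
  shows "x = y"
  using add_minus_cancel(1)[of y x] assms add_zero_right by simp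

lemma minus_commute: "x \<in> carr X \<Longrightarrow> y \<in> carr X \<Longrightarrow> vminus X y x = vscale X (- 1) (vminus X x y)"
  by (simp add: vminus_def scale_add_right scale_scale scale_one closed add_commute)

lemma norm_minus_commute: "x \<in> carr X \<Longrightarrow> y \<in> carr X \<Longrightarrow> vnorm X (vminus X y x) = vnorm X (vminus X x y)"
  by (simp add: minus_commute[of x y] norm_scale closed)

lemma minus_add_minus:
  assumes "x \<in> carr X" "y \<in> carr X" "z \<in> carr X"
  shows "vadd X (vminus X x y) (vminus X y z) = vminus X x z"
proof -
  have "vadd X (vminus X x y) (vminus X y z)
      = vadd X (vadd X (vminus X y y) x) (vscale X (- 1) z)"
    using assms by (simp add: vminus_def add_ac closed)
  then show ?thesis
    using assms by (simp add: minus_self add_zero) (simp add: vminus_def)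
qed

lemma add_minus_add:
  assumes "x \<in> carr X" "y \<in> carr X" "z \<in> carr X" "w \<in> carr X"
  shows "vminus X (vadd X x y) (vadd X z w) = vadd X (vminus X x z) (vminus X y w)"
  using assms by (simp add: vminus_def scale_add_right add_ac closed)

lemma norm_minus_triangle:
  assumes "x \<in> carr X" "y \<in> carr X" "z \<in> carr X"
  shows "vnorm X (vminus X x z) \<le> vnorm X (vminus X x y) + vnorm X (vminus X y z)"
  using minus_add_minus[OF assms] norm_triangle[of "vminus X x y" "vminus X y z"] assms
  by (simp add: closed)

lemma norm_le_minus_add:
  assumes "x \<in> carr X" "y \<in> carr X"
  shows "vnorm X x \<le> vnorm X (vminus X x y) + vnorm X y"
  using norm_minus_triangle[of x y "vzero X"] assms by (simp add: minus_zero zero_closed)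

sublocale metric: Metric_space "carr X" "vdist X"
proof
  fix x y z
  show "0 \<le> vdist X x y"
    by (simp add: vdist_def norm_nonneg closed)
  show "vdist X x y = vdist X y x"
    by (simp add: vdist_def norm_minus_commute)
  assume "x \<in> carr X" "y \<in> carr X"
  then show "(vdist X x y = 0) = (x = y)"
    using minus_eq_zero by (auto simp add: vdist_def norm_eq_zero closed minus_self)
  assume "z \<in> carr X"
  then show "vdist X x z \<le> vdist X x y + vdist X y z"
    using \<open>x \<in> carr X\<close> \<open>y \<in> carr X\<close> by (simp add: vdist_def norm_minus_triangle)
qed

end

lemma complex_banach_space_iff_Cauchy_converges:
  "complex_banach_space X \<longleftrightarrow> complex_normed_space X \<and>
    (\<forall>s::nat \<Rightarrow> 'a. range s \<subseteq> carr X \<and>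
       (\<forall>e>0. \<exists>N. \<forall>m\<ge>N. \<forall>n\<ge>N. vnorm X (vminus X (s m) (s n)) < e) \<longrightarrow>
       (\<exists>l\<in>carr X. \<forall>e>0. \<exists>N. \<forall>n\<ge>N. vnorm X (vminus X (s n) l) < e))"
proof (cases "complex_normed_space X")
  case True
  then interpret complex_normed_space X .
  have cauchy: "metric.MCauchy s \<longleftrightarrow> range s \<subseteq> carr X \<and>
       (\<forall>e>0. \<exists>N. \<forall>m\<ge>N. \<forall>n\<ge>N. vnorm X (vminus X (s m) (s n)) < e)" for s :: "nat \<Rightarrow> 'a"
    unfolding metric.MCauchy_def vdist_def by (auto simp: image_subset_iff)
  have limit: "limitin metric.mtopology s l sequentially \<longleftrightarrow>
      l \<in> carr X \<and> (\<forall>e>0. \<exists>N. \<forall>n\<ge>N. vnorm X (vminus X (s n) l) < e)"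
    if "range s \<subseteq> carr X" for s :: "nat \<Rightarrow> 'a" and l
    using that unfolding metric.limitin_metric eventually_sequentially vdist_def
    by (auto simp: image_subset_iff)
  have step: "(metric.MCauchy s \<longrightarrow> (\<exists>l. limitin metric.mtopology s l sequentially)) \<longleftrightarrow>
      (range s \<subseteq> carr X \<and>
       (\<forall>e>0. \<exists>N. \<forall>m\<ge>N. \<forall>n\<ge>N. vnorm X (vminus X (s m) (s n)) < e) \<longrightarrow>
       (\<exists>l\<in>carr X. \<forall>e>0. \<exists>N. \<forall>n\<ge>N. vnorm X (vminus X (s n) l) < e))" for s :: "nat \<Rightarrow> 'a"
  proof (cases "range s \<subseteq> carr X")
    case True
    show ?thesis
      unfolding cauchy limit[OF True] Bex_def by (rule refl)
  next
    case False
    then show ?thesis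
      by (simp add: cauchy)
  qed
  show ?thesis
    unfolding complex_banach_space_def complex_banach_space_axioms_def metric.mcomplete_def
    using True by (simp only: step simp_thms)
qed (simp add: complex_banach_space_def)

lemma complex_banach_space_complex_line: "complex_banach_space complex_line"
proof -
  have *: "complex_normed_space complex_line"
    by unfold_locales (auto simp: algebra_simps norm_mult intro: norm_triangle_ineq)
  show ?thesis
    unfolding complex_banach_space_iff_Cauchy_converges
  proof (intro conjI allI impI *)
    fix s :: "nat \<Rightarrow> complex"
    assume "range s \<subseteq> carr complex_line \<and>
       (\<forall>e>0. \<exists>N. \<forall>m\<ge>N. \<forall>n\<ge>N. vnorm complex_line (vminus complex_line (s m) (s n)) < e)"
    then have "Cauchy s"
      by (simp add: Cauchy_def dist_norm)
    then obtain l where "s \<longlonglongrightarrow> l"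
      using Cauchy_convergent_iff convergent_def by blast
    then show "\<exists>l\<in>carr complex_line. \<forall>e>0. \<exists>N. \<forall>n\<ge>N. vnorm complex_line (vminus complex_line (s n) l) < e"
      by (auto simp: LIMSEQ_iff intro: exI[of _ l])
  qed
qed

lemma complex_normed_space_complex_line: "complex_normed_space complex_line"
  using complex_banach_space_complex_line by (simp add: complex_banach_space_def)

lemma banach_is_normed: "complex_banach_space X \<Longrightarrow> complex_normed_space X"
  by (simp add: complex_banach_space_def)

lemma bounded_operatorsI:
  assumes "T \<in> carr E \<rightarrow>\<^sub>E carr F"
    and "\<And>x y. x \<in> carr E \<Longrightarrow> y \<in> carr E \<Longrightarrow> T (vadd E x y) = vadd F (T x) (T y)"
    and "\<And>c x. x \<in> carr E \<Longrightarrow> T (vscale E c x) = vscale F c (T x)"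
    and "\<And>x. x \<in> carr E \<Longrightarrow> vnorm F (T x) \<le> C * vnorm E x"
  shows "T \<in> bounded_operators E F"
proof -
  have "\<exists>C. \<forall>x\<in>carr E. vnorm F (T x) \<le> C * vnorm E x"
    using assms(4) by (intro exI[of _ C]) simp
  then show ?thesis
    unfolding bounded_operators_def using assms(1-3) by simp
qed

lemma bounded_operators_carr:
  "T \<in> bounded_operators E F \<Longrightarrow> x \<in> carr E \<Longrightarrow> T x \<in> carr F"
  unfolding bounded_operators_def by auto

lemma bounded_operators_extensional:
  "T \<in> bounded_operators E F \<Longrightarrow> T \<in> extensional (carr E)"
  by (simp add: bounded_operators_def PiE_def)

lemma bounded_operators_add:
  "T \<in> bounded_operators E F \<Longrightarrow> x \<in> carr E \<Longrightarrow> y \<in> carr E \<Longrightarrow> T (vadd E x y) = vadd F (T x) (T y)"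
  by (simp add: bounded_operators_def)

lemma bounded_operators_scale:
  "T \<in> bounded_operators E F \<Longrightarrow> x \<in> carr E \<Longrightarrow> T (vscale E c x) = vscale F c (T x)"
  by (simp add: bounded_operators_def)

lemma bounded_operators_minus:
  assumes "complex_normed_space E" "T \<in> bounded_operators E F" "x \<in> carr E" "y \<in> carr E"
  shows "T (vminus E x y) = vminus F (T x) (T y)"
  using assms complex_normed_space.scale_closed[OF assms(1)]
  by (simp add: vminus_def bounded_operators_add bounded_operators_scale)

lemma bounded_operators_zero:
  assumes "complex_normed_space E" "complex_normed_space F" "T \<in> bounded_operators E F"
  shows "T (vzero E) = vzero F"
  using bounded_operators_scale[OF assms(3), of "vzero E" 0] bounded_operators_carr[OF assms(3)]
    complex_normed_space.scale_zero_left complex_normed_space.zero_closed assms by metis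

lemma bounded_operators_bound:
  assumes "complex_normed_space E" "T \<in> bounded_operators E F"
  obtains C where "C \<ge> 0" "\<And>x. x \<in> carr E \<Longrightarrow> vnorm F (T x) \<le> C * vnorm E x"
proof -
  obtain C where C: "\<forall>x\<in>carr E. vnorm F (T x) \<le> C * vnorm E x"
    using assms(2) unfolding bounded_operators_def by blast
  show thesis
  proof (rule that[of "max C 0"])
    fix x assume x: "x \<in> carr E"
    then have "C * vnorm E x \<le> max C 0 * vnorm E x"
      using complex_normed_space.norm_nonneg[OF assms(1)] by (intro mult_right_mono) auto
    then show "vnorm F (T x) \<le> max C 0 * vnorm E x"
      using C x by force
  qed simp
qed

lemma sup_nonneg_least:
  assumes "C \<ge> 0" "\<And>s. s \<in> S \<Longrightarrow> s \<le> C"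
  shows "sup_nonneg S \<le> C"
  unfolding sup_nonneg_def using assms by (intro cSup_least) auto

lemma sup_nonneg_upper:
  assumes "bdd_above S" "s \<in> S"
  shows "s \<le> sup_nonneg S"
  unfolding sup_nonneg_def using assms by (intro cSup_upper) auto

lemma sup_nonneg_nonneg:
  assumes "bdd_above S"
  shows "0 \<le> sup_nonneg S"
  unfolding sup_nonneg_def using assms by (intro cSup_upper) auto

lemma operator_norm_least:
  assumes "C \<ge> 0" "\<And>x. x \<in> carr E \<Longrightarrow> vnorm F (T x) \<le> C * vnorm E x"
  shows "operator_norm E F T \<le> C"
  unfolding operator_norm_def
proof (rule sup_nonneg_least[OF assms(1)])
  fix s assume "s \<in> {vnorm F (T x) |x. x \<in> carr E \<and> vnorm E x \<le> 1}"
  then obtain x where x: "x \<in> carr E" "vnorm E x \<le> 1" "s = vnorm F (T x)"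
    by auto
  have "s \<le> C * vnorm E x"
    using assms x by simp
  also have "\<dots> \<le> C"
    using assms(1) x by (simp add: mult_left_le)
  finally show "s \<le> C" .
qed

context
  fixes E :: "'a cspace" and F :: "'b cspace" and T
  assumes E: "complex_normed_space E" and F: "complex_normed_space F"
    and T: "T \<in> bounded_operators E F"
begin

lemma operator_norm_bdd: "bdd_above {vnorm F (T x) |x. x \<in> carr E \<and> vnorm E x \<le> 1}"
proof -
  obtain C where C: "C \<ge> 0" "\<And>x. x \<in> carr E \<Longrightarrow> vnorm F (T x) \<le> C * vnorm E x"
    using bounded_operators_bound[OF E T] by blast
  show ?thesis
  proof (rule bdd_aboveI)
    fix s assume "s \<in> {vnorm F (T x) |x. x \<in> carr E \<and> vnorm E x \<le> 1}"
    then obtain x where x: "x \<in> carr E" "vnorm E x \<le> 1" "s = vnorm F (T x)"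
      by auto
    show "s \<le> C"
      using C(1) C(2)[OF x(1)] x by (simp add: mult_left_le order_trans)
  qed
qed

lemma operator_norm_nonneg: "0 \<le> operator_norm E F T"
  unfolding operator_norm_def by (rule sup_nonneg_nonneg[OF operator_norm_bdd])

lemma operator_norm_bound:
  assumes x: "x \<in> carr E"
  shows "vnorm F (T x) \<le> operator_norm E F T * vnorm E x"
proof (cases "vnorm E x = 0")
  case True
  interpret E: complex_normed_space E by (rule E)
  interpret F: complex_normed_space F by (rule F)
  have "x = vzero E"
    using True x E.norm_eq_zero by simp
  then show ?thesis
    using bounded_operators_zero[OF E F T] E.norm_zero F.norm_zero by simp
next
  case False
  interpret E: complex_normed_space E by (rule E)
  interpret F: complex_normed_space F by (rule F)
  have pos: "vnorm E x > 0"
    using False E.norm_nonneg[OF x] by simp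
  define c where "c = complex_of_real (1 / vnorm E x)"
  have "vnorm F (T (vscale E c x)) = vnorm F (T x) / vnorm E x"
    using pos x by (simp add: bounded_operators_scale[OF T] F.norm_scale bounded_operators_carr[OF T]
        c_def norm_divide)
  moreover have "vnorm E (vscale E c x) \<le> 1"
    using pos x by (simp add: E.norm_scale c_def norm_divide)
  ultimately have "vnorm F (T x) / vnorm E x \<le> operator_norm E F T"
    unfolding operator_norm_def using E.scale_closed[OF x, of c]
    by (intro sup_nonneg_upper[OF operator_norm_bdd]) (metis (mono_tags, lifting) mem_Collect_eq)
  then show ?thesis
    using pos by (simp add: field_simps)
qed

end

lemma bounded_operators_compose:
  assumes "complex_normed_space D" "complex_normed_space E" "complex_normed_space F"
    and R: "R \<in> bounded_operators D E" and T: "T \<in> bounded_operators E F"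
  shows "compose (carr D) T R \<in> bounded_operators D F"
proof -
  interpret D: complex_normed_space D by (rule assms)
  obtain C where C: "C \<ge> 0" "\<And>x. x \<in> carr E \<Longrightarrow> vnorm F (T x) \<le> C * vnorm E x"
    using bounded_operators_bound[OF assms(2) T] by blast
  obtain C' where C': "C' \<ge> 0" "\<And>x. x \<in> carr D \<Longrightarrow> vnorm E (R x) \<le> C' * vnorm D x"
    using bounded_operators_bound[OF assms(1) R] by blast
  show ?thesis
  proof (rule bounded_operatorsI[where C = "C * C'"])
    fix x assume x: "x \<in> carr D"
    have "vnorm F (T (R x)) \<le> C * vnorm E (R x)"
      using C(2) x bounded_operators_carr[OF R] by simp
    also have "\<dots> \<le> C * (C' * vnorm D x)"
      using C(1) C'(2)[OF x] by (intro mult_left_mono)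
    finally show "vnorm F (compose (carr D) T R x) \<le> C * C' * vnorm D x"
      using x by (simp add: compose_def mult.assoc)
  qed (use R T in \<open>auto simp: compose_def D.closed bounded_operators_add[OF R] bounded_operators_add[OF T]
        bounded_operators_scale[OF R] bounded_operators_scale[OF T] bounded_operators_carr[OF R]
        intro!: bounded_operators_carr[OF T]\<close>)
qed

lemma bounded_operators_sum:
  assumes "complex_normed_space E" "complex_normed_space F"
    and R: "R \<in> bounded_operators E F" and T: "T \<in> bounded_operators E F"
  shows "(\<lambda>x\<in>carr E. vadd F (R x) (T x)) \<in> bounded_operators E F"
proof -
  interpret E: complex_normed_space E by (rule assms)
  interpret F: complex_normed_space F by (rule assms)
  obtain C where C: "C \<ge> 0" "\<And>x. x \<in> carr E \<Longrightarrow> vnorm F (T x) \<le> C * vnorm E x"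
    using bounded_operators_bound[OF assms(1) T] by blast
  obtain C' where C': "C' \<ge> 0" "\<And>x. x \<in> carr E \<Longrightarrow> vnorm F (R x) \<le> C' * vnorm E x"
    using bounded_operators_bound[OF assms(1) R] by blast
  note carr = bounded_operators_carr[OF R] bounded_operators_carr[OF T]
  show ?thesis
  proof (rule bounded_operatorsI[where C = "C' + C"])
    fix x assume x: "x \<in> carr E"
    have "vnorm F (vadd F (R x) (T x)) \<le> vnorm F (R x) + vnorm F (T x)"
      using x carr by (intro F.norm_triangle)
    also have "\<dots> \<le> (C' + C) * vnorm E x"
      using C(2)[OF x] C'(2)[OF x] by (simp add: distrib_right)
    finally show "vnorm F ((\<lambda>x\<in>carr E. vadd F (R x) (T x)) x) \<le> (C' + C) * vnorm E x"
      using x by simp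
  qed (auto simp: carr E.closed F.closed bounded_operators_add[OF R] bounded_operators_add[OF T]
        bounded_operators_scale[OF R] bounded_operators_scale[OF T] F.add_ac F.scale_add_right)
qed

lemma bounded_operators_multiple:
  assumes "complex_normed_space E" "complex_normed_space F" and T: "T \<in> bounded_operators E F"
  shows "(\<lambda>x\<in>carr E. vscale F c (T x)) \<in> bounded_operators E F"
proof -
  interpret E: complex_normed_space E by (rule assms)
  interpret F: complex_normed_space F by (rule assms)
  obtain C where C: "C \<ge> 0" "\<And>x. x \<in> carr E \<Longrightarrow> vnorm F (T x) \<le> C * vnorm E x"
    using bounded_operators_bound[OF assms(1) T] by blast
  note carr = bounded_operators_carr[OF T]
  show ?thesis
    by (rule bounded_operatorsI[where C = "cmod c * C"])
      (auto simp: carr E.closed F.closed bounded_operators_add[OF T] C mult_left_mono mult.assoc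
        bounded_operators_scale[OF T] F.scale_add_right F.scale_scale F.norm_scale mult.commute[of c])
qed

lemma bounded_operators_zero_map:
  assumes "complex_normed_space E" "complex_normed_space F"
  shows "(\<lambda>x\<in>carr E. vzero F) \<in> bounded_operators E F"
proof -
  interpret E: complex_normed_space E by (rule assms)
  interpret F: complex_normed_space F by (rule assms)
  show ?thesis
    by (rule bounded_operatorsI[where C = 0])
      (auto simp: E.closed F.closed F.add_zero F.scale_zero_right F.norm_zero)
qed

section \<open>Spaces of functions\<close>

text \<open>The vector space axioms hold pointwise, so only closure and the norm axioms remain.\<close>

lemma fun_space_normed:
  assumes F: "complex_normed_space F"
    and A: "A \<subseteq> S \<rightarrow>\<^sub>E carr F"
    and zero: "(\<lambda>x\<in>S. vzero F) \<in> A"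
    and add: "\<And>f g. f \<in> A \<Longrightarrow> g \<in> A \<Longrightarrow> (\<lambda>x\<in>S. vadd F (f x) (g x)) \<in> A"
    and scale: "\<And>c f. f \<in> A \<Longrightarrow> (\<lambda>x\<in>S. vscale F c (f x)) \<in> A"
    and N_nonneg: "\<And>f. f \<in> A \<Longrightarrow> N f \<ge> 0"
    and N_zero: "\<And>f. f \<in> A \<Longrightarrow> N f = 0 \<longleftrightarrow> f = (\<lambda>x\<in>S. vzero F)"
    and N_add: "\<And>f g. f \<in> A \<Longrightarrow> g \<in> A \<Longrightarrow> N (\<lambda>x\<in>S. vadd F (f x) (g x)) \<le> N f + N g"
    and N_scale: "\<And>c f. f \<in> A \<Longrightarrow> N (\<lambda>x\<in>S. vscale F c (f x)) = cmod c * N f"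
  shows "complex_normed_space (fun_space S F A N)"
proof -
  interpret F: complex_normed_space F by (rule F)
  have val: "f x \<in> carr F" if "f \<in> A" "x \<in> S" for f x
    using A that by auto
  have ext: "f = g" if "g \<in> A" "f \<in> extensional S" "\<And>x. x \<in> S \<Longrightarrow> f x = g x" for f g
    using A that by (intro extensionalityI[of f S g]) (auto simp: PiE_def)
  show ?thesis
  proof (rule complex_normed_space.intro, simp_all only: vminus_def fun_space_simps)
    fix f g h a b
    assume f: "f \<in> A"
    show "(\<lambda>x\<in>S. vadd F (f x) ((\<lambda>x\<in>S. vscale F (- 1) (f x)) x)) = (\<lambda>x\<in>S. vzero F)"
      using val[OF f] F.minus_self by (intro restrict_ext) (simp add: vminus_def)
    show "(\<lambda>x\<in>S. vadd F ((\<lambda>x\<in>S. vzero F) x) (f x)) = f"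
      using f by (intro ext) (auto simp: val F.add_zero)
    show "(\<lambda>x\<in>S. vscale F 1 (f x)) = f"
      using f by (intro ext) (auto simp: val F.scale_one)
    show "(\<lambda>x\<in>S. vscale F (a + b) (f x))
        = (\<lambda>x\<in>S. vadd F ((\<lambda>x\<in>S. vscale F a (f x)) x) ((\<lambda>x\<in>S. vscale F b (f x)) x))"
      using val[OF f] by (intro restrict_ext) (simp add: F.scale_add_left)
    show "(\<lambda>x\<in>S. vscale F a ((\<lambda>x\<in>S. vscale F b (f x)) x)) = (\<lambda>x\<in>S. vscale F (a * b) (f x))"
      using val[OF f] by (intro restrict_ext) (simp add: F.scale_scale)
    assume g: "g \<in> A"
    show "(\<lambda>x\<in>S. vadd F (f x) (g x)) = (\<lambda>x\<in>S. vadd F (g x) (f x))"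
      using val[OF f] val[OF g] by (intro restrict_ext) (simp add: F.add_commute)
    show "(\<lambda>x\<in>S. vscale F a ((\<lambda>x\<in>S. vadd F (f x) (g x)) x))
       = (\<lambda>x\<in>S. vadd F ((\<lambda>x\<in>S. vscale F a (f x)) x) ((\<lambda>x\<in>S. vscale F a (g x)) x))"
      using val[OF f] val[OF g] by (intro restrict_ext) (simp add: F.scale_add_right)
    assume h: "h \<in> A"
    show "(\<lambda>x\<in>S. vadd F ((\<lambda>x\<in>S. vadd F (f x) (g x)) x) (h x))
        = (\<lambda>x\<in>S. vadd F (f x) ((\<lambda>x\<in>S. vadd F (g x) (h x)) x))"
      using val[OF f] val[OF g] val[OF h] by (intro restrict_ext) (simp add: F.add_assoc)
  qed (rule zero add scale N_nonneg N_zero N_add N_scale; assumption)+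
qed

text \<open>Ideals of operators and of holomorphic maps are normed through an injective linear map \<open>\<Theta>\<close>: passage
  to a copy in the first case, transposition in the second.\<close>

lemma fun_space_normed_pullback:
  assumes F: "complex_normed_space F" and Z: "complex_normed_space Z"
    and A: "A \<subseteq> S \<rightarrow>\<^sub>E carr F"
    and zero: "(\<lambda>x\<in>S. vzero F) \<in> A"
    and add: "\<And>f g. f \<in> A \<Longrightarrow> g \<in> A \<Longrightarrow> (\<lambda>x\<in>S. vadd F (f x) (g x)) \<in> A"
    and scale: "\<And>c f. f \<in> A \<Longrightarrow> (\<lambda>x\<in>S. vscale F c (f x)) \<in> A"
    and \<Theta>: "\<And>f. f \<in> A \<Longrightarrow> \<Theta> f \<in> carr Z"
    and \<Theta>_add: "\<And>f g. f \<in> A \<Longrightarrow> g \<in> A \<Longrightarrow> \<Theta> (\<lambda>x\<in>S. vadd F (f x) (g x)) = vadd Z (\<Theta> f) (\<Theta> g)"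
    and \<Theta>_scale: "\<And>c f. f \<in> A \<Longrightarrow> \<Theta> (\<lambda>x\<in>S. vscale F c (f x)) = vscale Z c (\<Theta> f)"
    and \<Theta>_inj: "\<And>f. f \<in> A \<Longrightarrow> \<Theta> f = vzero Z \<Longrightarrow> f = (\<lambda>x\<in>S. vzero F)"
    and N: "\<And>f. f \<in> A \<Longrightarrow> N f = vnorm Z (\<Theta> f)"
  shows "complex_normed_space (fun_space S F A N)"
proof -
  interpret F: complex_normed_space F by (rule F)
  interpret Z: complex_normed_space Z by (rule Z)
  have "(\<lambda>x\<in>S. vscale F 0 ((\<lambda>x\<in>S. vzero F) x)) = (\<lambda>x\<in>S. vzero F)"
    by (auto simp: F.scale_zero_right)
  then have \<Theta>_zero: "\<Theta> (\<lambda>x\<in>S. vzero F) = vzero Z"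
    using \<Theta>_scale[OF zero, of 0] Z.scale_zero_left \<Theta>[OF zero] by simp
  show ?thesis
  proof (rule fun_space_normed[OF F A zero add scale])
    fix f g c
    assume f: "f \<in> A"
    show "0 \<le> N f"
      using f by (simp add: N Z.norm_nonneg \<Theta>)
    show "N f = 0 \<longleftrightarrow> f = (\<lambda>x\<in>S. vzero F)"
      using f \<Theta>_inj[OF f] \<Theta>_zero by (auto simp: N Z.norm_eq_zero \<Theta>)
    show "N (\<lambda>x\<in>S. vscale F c (f x)) = cmod c * N f"
      using f by (simp add: N scale \<Theta>_scale Z.norm_scale \<Theta>)
    assume g: "g \<in> A"
    show "N (\<lambda>x\<in>S. vadd F (f x) (g x)) \<le> N f + N g"
      using f g by (simp add: N add \<Theta>_add Z.norm_triangle \<Theta>)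
  qed
qed

text \<open>The operator norm on a dual space and the weighted supremum norm both are the least \<open>C\<close> such that
  the value at each \<open>x\<close> is at most \<open>b x * C\<close>, with \<open>b x\<close> the norm of \<open>x\<close> and \<open>1 / v x\<close> respectively.\<close>

lemma fun_space_normedI:
  assumes F: "complex_normed_space F"
    and A: "A \<subseteq> S \<rightarrow>\<^sub>E carr F"
    and zero: "(\<lambda>x\<in>S. vzero F) \<in> A"
    and add: "\<And>f g. f \<in> A \<Longrightarrow> g \<in> A \<Longrightarrow> (\<lambda>x\<in>S. vadd F (f x) (g x)) \<in> A"
    and scale: "\<And>c f. f \<in> A \<Longrightarrow> (\<lambda>x\<in>S. vscale F c (f x)) \<in> A"
    and eval: "\<And>f x. f \<in> A \<Longrightarrow> x \<in> S \<Longrightarrow> vnorm F (f x) \<le> b x * N f"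
    and N_least: "\<And>f C. f \<in> A \<Longrightarrow> C \<ge> 0 \<Longrightarrow> (\<And>x. x \<in> S \<Longrightarrow> vnorm F (f x) \<le> b x * C) \<Longrightarrow> N f \<le> C"
    and N_nonneg: "\<And>f. f \<in> A \<Longrightarrow> N f \<ge> 0"
    and b: "\<And>x. x \<in> S \<Longrightarrow> b x \<ge> 0"
  shows "complex_normed_space (fun_space S F A N)"
proof -
  interpret F: complex_normed_space F by (rule F)
  have val: "f x \<in> carr F" if "f \<in> A" "x \<in> S" for f x
    using A that by auto
  have scale_le: "N (\<lambda>x\<in>S. vscale F a (f x)) \<le> cmod a * N f" if f: "f \<in> A" for a f
  proof (rule N_least[OF scale[OF f]])
    show "vnorm F ((\<lambda>x\<in>S. vscale F a (f x)) x) \<le> b x * (cmod a * N f)" if "x \<in> S" for x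
    proof -
      have "cmod a * vnorm F (f x) \<le> cmod a * (b x * N f)"
        using eval[OF f that] by (intro mult_left_mono) auto
      then show ?thesis
        using that val[OF f that] by (simp add: F.norm_scale mult.left_commute)
    qed
  qed (simp add: N_nonneg f)
  show ?thesis
  proof (rule fun_space_normed[OF F A zero add scale N_nonneg])
    fix f g a
    assume f: "f \<in> A"
    have "f = (\<lambda>x\<in>S. vzero F)" if "N f = 0"
    proof -
      have "f x = vzero F" if "x \<in> S" for x
        using eval[OF f that] \<open>N f = 0\<close> val[OF f that] F.norm_nonneg F.norm_eq_zero
        by (metis antisym mult_zero_right)
      then show ?thesis
        using f A by (intro extensionalityI[of f S]) (auto simp: PiE_def)
    qed
    moreover have "N (\<lambda>x\<in>S. vzero F) = 0"
      using N_least[OF zero, of 0] N_nonneg[OF zero] by (simp add: F.norm_zero)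
    ultimately show "N f = 0 \<longleftrightarrow> f = (\<lambda>x\<in>S. vzero F)"
      by auto
    show "N (\<lambda>x\<in>S. vscale F a (f x)) = cmod a * N f"
    proof (cases "a = 0")
      case True
      then show ?thesis
        using scale_le[OF f, of 0] N_nonneg[OF scale[OF f, of 0]] by simp
    next
      case False
      have "(\<lambda>x\<in>S. vscale F (1 / a) ((\<lambda>x\<in>S. vscale F a (f x)) x)) = f"
        using f A False val[OF f] by (intro extensionalityI[of _ S]) (auto simp: PiE_def F.scale_scale F.scale_one)
      then have "N f \<le> cmod (1 / a) * N (\<lambda>x\<in>S. vscale F a (f x))"
        using scale_le[OF scale[OF f, of a], of "1 / a"] by simp
      then show ?thesis
        using scale_le[OF f, of a] False by (simp add: norm_divide field_simps)
    qed
    assume g: "g \<in> A"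
    show "N (\<lambda>x\<in>S. vadd F (f x) (g x)) \<le> N f + N g"
    proof (rule N_least[OF add[OF f g]])
      show "vnorm F ((\<lambda>x\<in>S. vadd F (f x) (g x)) x) \<le> b x * (N f + N g)" if "x \<in> S" for x
        using eval[OF f that] eval[OF g that] F.norm_triangle[OF val[OF f that] val[OF g that]] that
        by (simp add: distrib_left)
    qed (simp add: N_nonneg f g)
  qed
qed

text \<open>A Cauchy sequence converges pointwise, and for a norm as above the convergence is then uniform
  relative to \<open>b\<close>. What depends on the class \<open>A\<close> is only that it is closed under such limits.\<close>

lemma fun_space_complete:
  fixes S :: "'a set" and A :: "('a \<Rightarrow> complex) set"
  assumes normed: "complex_normed_space (fun_space S complex_line A N)"
    and ext: "A \<subseteq> extensional S"
    and eval: "\<And>f x. f \<in> A \<Longrightarrow> x \<in> S \<Longrightarrow> cmod (f x) \<le> b x * N f"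
    and N_least: "\<And>f C. f \<in> A \<Longrightarrow> C \<ge> 0 \<Longrightarrow> (\<And>x. x \<in> S \<Longrightarrow> cmod (f x) \<le> b x * C) \<Longrightarrow> N f \<le> C"
    and b: "\<And>x. x \<in> S \<Longrightarrow> b x \<ge> 0"
    and limit: "\<And>s f. \<lbrakk>\<And>n. s n \<in> A; f \<in> extensional S; \<And>x. x \<in> S \<Longrightarrow> (\<lambda>n. s n x) \<longlonglongrightarrow> f x;
        \<And>e. e > 0 \<Longrightarrow> \<exists>M. \<forall>n\<ge>M. \<forall>x\<in>S. cmod (s n x - f x) \<le> b x * e\<rbrakk> \<Longrightarrow> f \<in> A"
  shows "complex_banach_space (fun_space S complex_line A N)"
  unfolding complex_banach_space_iff_Cauchy_converges
proof (intro conjI allI impI normed)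
  let ?Z = "fun_space S complex_line A N"
  interpret Z: complex_normed_space ?Z by (rule normed)
  fix s :: "nat \<Rightarrow> 'a \<Rightarrow> complex"
  assume *: "range s \<subseteq> carr ?Z \<and> (\<forall>e>0. \<exists>N'. \<forall>m\<ge>N'. \<forall>n\<ge>N'. vnorm ?Z (vminus ?Z (s m) (s n)) < e)"
  then have s: "s n \<in> A" for n
    by auto
  have diff: "vminus ?Z f g \<in> A" "x \<in> S \<Longrightarrow> vminus ?Z f g x = f x - g x"
    if "f \<in> A" "g \<in> A" for f g x
    using that Z.minus_closed[of f g] by (simp_all add: vminus_def)
  have cauchy: "\<exists>M. \<forall>m\<ge>M. \<forall>n\<ge>M. \<forall>x\<in>S. cmod (s m x - s n x) \<le> b x * e" if e: "e > 0" for e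
  proof -
    obtain M where M: "\<And>m n. m \<ge> M \<Longrightarrow> n \<ge> M \<Longrightarrow> N (vminus ?Z (s m) (s n)) < e"
      using * e by fastforce
    have "cmod (s m x - s n x) \<le> b x * e" if "m \<ge> M" "n \<ge> M" "x \<in> S" for m n x
    proof -
      have "cmod (s m x - s n x) \<le> b x * N (vminus ?Z (s m) (s n))"
        using eval[OF diff(1)[OF s s] that(3), of m n] diff(2)[OF s s that(3)] by simp
      also have "\<dots> \<le> b x * e"
        using M[OF that(1,2)] b[OF that(3)] by (intro mult_left_mono) auto
      finally show ?thesis .
    qed
    then show ?thesis
      by blast
  qed
  define f where "f = (\<lambda>x\<in>S. lim (\<lambda>n. s n x))"
  have lim: "(\<lambda>n. s n x) \<longlonglongrightarrow> f x" if x: "x \<in> S" for x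
  proof -
    have "Cauchy (\<lambda>n. s n x)"
    proof (rule metric_CauchyI)
      fix e :: real assume e: "e > 0"
      have pos: "b x + 1 > 0"
        using b[OF x] by simp
      have "\<exists>M. \<forall>m\<ge>M. \<forall>n\<ge>M. \<forall>y\<in>S. cmod (s m y - s n y) \<le> b y * (e / (b x + 1))"
        using e pos by (intro cauchy) simp
      moreover have "b x * (e / (b x + 1)) < e"
        using e pos by (simp add: field_simps)
      ultimately show "\<exists>M. \<forall>m\<ge>M. \<forall>n\<ge>M. dist (s m x) (s n x) < e"
        using x unfolding dist_norm by (meson le_less_trans)
    qed
    then show ?thesis
      using x by (simp add: f_def Cauchy_convergent_iff convergent_LIMSEQ_iff)
  qed
  have close: "\<exists>M. \<forall>n\<ge>M. \<forall>x\<in>S. cmod (s n x - f x) \<le> b x * e" if e: "e > 0" for e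
  proof -
    obtain M where M: "\<forall>m\<ge>M. \<forall>n\<ge>M. \<forall>x\<in>S. cmod (s m x - s n x) \<le> b x * e"
      using cauchy[OF e] by blast
    have "cmod (s n x - f x) \<le> b x * e" if "n \<ge> M" "x \<in> S" for n x
    proof (rule LIMSEQ_le_const2)
      show "(\<lambda>m. cmod (s n x - s m x)) \<longlonglongrightarrow> cmod (s n x - f x)"
        using lim[OF that(2)] by (intro tendsto_intros)
      show "\<exists>K. \<forall>m\<ge>K. cmod (s n x - s m x) \<le> b x * e"
        using M that by blast
    qed
    then show ?thesis
      by blast
  qed
  have f: "f \<in> A"
    using limit[of s f] s lim close by (simp add: f_def)
  show "\<exists>l\<in>carr ?Z. \<forall>e>0. \<exists>M. \<forall>n\<ge>M. vnorm ?Z (vminus ?Z (s n) l) < e"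
  proof (intro bexI allI impI)
    fix e :: real assume e: "e > 0"
    obtain M where M: "\<forall>n\<ge>M. \<forall>x\<in>S. cmod (s n x - f x) \<le> b x * (e / 2)"
      using close[of "e / 2"] e by auto
    have "N (vminus ?Z (s n) f) < e" if "n \<ge> M" for n
    proof -
      have "N (vminus ?Z (s n) f) \<le> e / 2"
        using M that e by (intro N_least diff s f) (auto simp: diff s f)
      then show ?thesis
        using e by simp
    qed
    then show "\<exists>M. \<forall>n\<ge>M. vnorm ?Z (vminus ?Z (s n) f) < e"
      by auto
  qed (simp add: f)
qed

section \<open>The Hahn--Banach theorem\<close>

context complex_normed_space
begin

text \<open>Functionals on real subspaces, dominated by a multiple of the norm, are represented by their graphs,
  so that extension is inclusion and Zorn's lemma applies to unions of chains. The domination makes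
  such a set of pairs single-valued by itself.\<close>

definition real_functional_graph :: "real \<Rightarrow> ('a \<times> real) set \<Rightarrow> bool" where
  "real_functional_graph C g \<longleftrightarrow> g \<subseteq> carr X \<times> UNIV \<and>
     (\<forall>x r y s. (x, r) \<in> g \<longrightarrow> (y, s) \<in> g \<longrightarrow> (vadd X x y, r + s) \<in> g) \<and>
     (\<forall>x r a. (x, r) \<in> g \<longrightarrow> (vscale X (complex_of_real a) x, a * r) \<in> g) \<and>
     (\<forall>x r. (x, r) \<in> g \<longrightarrow> r \<le> C * vnorm X x)"

text \<open>The difference of two values at the same point is a value at \<open>0\<close>, hence at most \<open>0\<close>.\<close>

lemma real_functional_graph_unique:
  assumes g: "real_functional_graph C g" and "(x, r) \<in> g" "(x, s) \<in> g"
  shows "r = s"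
proof -
  have le: "r \<le> s" if "(x, r) \<in> g" "(x, s) \<in> g" for r s
  proof -
    have x: "x \<in> carr X"
      using g that unfolding real_functional_graph_def by blast
    have "(vscale X (complex_of_real (- 1)) x, - 1 * s) \<in> g"
      using g that unfolding real_functional_graph_def by blast
    then have "(vadd X x (vscale X (complex_of_real (- 1)) x), r + - 1 * s) \<in> g"
      using g that unfolding real_functional_graph_def by blast
    then have "(vzero X, r - s) \<in> g"
      using minus_self[OF x] by (simp add: vminus_def)
    then have "r - s \<le> C * vnorm X (vzero X)"
      using g unfolding real_functional_graph_def by blast
    then show ?thesis
      by (simp add: norm_zero)
  qed
  show ?thesis
    using le assms(2,3) by (meson order_antisym)
qed

text \<open>The value \<open>c\<close> at the new vector \<open>z\<close> has to satisfy
  \<open>r - C * \<parallel>x - z\<parallel> \<le> c \<le> C * \<parallel>y + z\<parallel> - s\<close> for all \<open>(x, r)\<close> and \<open>(y, s)\<close> in the graph. By the triangle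
  inequality every lower bound is below every upper one, so the supremum of the lower ones will do;
  multiples of \<open>z\<close> reduce to \<open>z\<close> and \<open>- z\<close> by scaling.\<close>

lemma real_functional_graph_extend:
  assumes g: "real_functional_graph C g" and "g \<noteq> {}" and C: "C \<ge> 0" and z: "z \<in> carr X"
  obtains c g' where "real_functional_graph C g'" "g \<subseteq> g'" "(z, c) \<in> g'"
proof -
  have gX: "x \<in> carr X" if "(x, r) \<in> g" for x r
    using g that unfolding real_functional_graph_def by blast
  have gadd: "(vadd X x y, r + s) \<in> g" if "(x, r) \<in> g" "(y, s) \<in> g" for x r y s
    using g that unfolding real_functional_graph_def by blast
  have gscale: "(vscale X (complex_of_real a) x, a * r) \<in> g" if "(x, r) \<in> g" for x r a
    using g that unfolding real_functional_graph_def by blast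
  have gle: "r \<le> C * vnorm X x" if "(x, r) \<in> g" for x r
    using g that unfolding real_functional_graph_def by blast
  define L where "L = {r - C * vnorm X (vminus X x z) | x r. (x, r) \<in> g}"
  have key: "r - C * vnorm X (vminus X x z) \<le> C * vnorm X (vadd X y z) - s"
    if "(x, r) \<in> g" "(y, s) \<in> g" for x r y s
  proof -
    have x: "x \<in> carr X" and y: "y \<in> carr X"
      using gX that by auto
    have "vadd X (vminus X x z) (vadd X y z) = vadd X (vadd X (vminus X z z) x) y"
      using x y z by (simp add: vminus_def add_ac closed)
    also have "\<dots> = vadd X x y"
      using x y z by (simp add: minus_self add_zero)
    finally have "vnorm X (vadd X x y) \<le> vnorm X (vminus X x z) + vnorm X (vadd X y z)"
      using norm_triangle[of "vminus X x z" "vadd X y z"] x y z by (simp add: closed)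
    then have "C * vnorm X (vadd X x y) \<le> C * vnorm X (vminus X x z) + C * vnorm X (vadd X y z)"
      using C by (metis distrib_left mult_left_mono)
    then show ?thesis
      using gle[OF gadd[OF that]] by simp
  qed
  obtain x0 r0 where x0: "(x0, r0) \<in> g"
    using \<open>g \<noteq> {}\<close> by auto
  define c where "c = Sup L"
  have "bdd_above L"
    unfolding L_def using key[OF _ x0] by (intro bdd_aboveI) blast
  then have lower: "r - C * vnorm X (vminus X x z) \<le> c" if "(x, r) \<in> g" for x r
    unfolding c_def using that by (intro cSup_upper) (auto simp: L_def)
  have upper: "c \<le> C * vnorm X (vadd X y z) - s" if "(y, s) \<in> g" for y s
    unfolding c_def using x0 key[OF _ that] by (intro cSup_least) (auto simp: L_def)
  define g' where "g' = {(vadd X x (vscale X (complex_of_real t) z), r + t * c) | x r t. (x, r) \<in> g}"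
  have bound: "r + t * c \<le> C * vnorm X (vadd X x (vscale X (complex_of_real t) z))"
    if xr: "(x, r) \<in> g" for x r t
  proof -
    have x: "x \<in> carr X"
      using gX xr .
    define y where "y = vscale X (complex_of_real (1 / \<bar>t\<bar>)) x"
    have y: "(y, 1 / \<bar>t\<bar> * r) \<in> g" "y \<in> carr X"
      using gscale[OF xr, of "1 / \<bar>t\<bar>"] scale_closed[OF x] unfolding y_def by simp_all
    have scaled: "\<bar>t\<bar> * vnorm X w = vnorm X (vscale X (complex_of_real \<bar>t\<bar>) w)" if "w \<in> carr X" for w
      using that by (simp add: norm_scale)
    consider "t = 0" | "t > 0" | "t < 0"
      by linarith
    then show ?thesis
    proof cases
      case 1
      then show ?thesis
        using gle[OF xr] x z by (simp add: scale_zero_left add_zero_right)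
    next
      case 2
      have "vscale X (complex_of_real \<bar>t\<bar>) (vadd X y z) = vadd X x (vscale X (complex_of_real t) z)"
        using 2 x z by (simp add: y_def scale_add_right scale_scale scale_one closed)
      moreover have "r + t * c \<le> t * (C * vnorm X (vadd X y z))"
        using upper[OF y(1)] 2 by (simp add: field_simps)
      ultimately show ?thesis
        using scaled[of "vadd X y z"] y z 2 by (simp add: closed mult.left_commute)
    next
      case 3
      have W: "vscale X (complex_of_real \<bar>t\<bar>) (vminus X y z) = vadd X x (vscale X (complex_of_real t) z)"
        using 3 x z by (simp add: y_def vminus_def scale_add_right scale_scale scale_one closed)
      have "r + t * c \<le> \<bar>t\<bar> * (C * vnorm X (vminus X y z))"
        using lower[OF y(1)] 3 by (simp add: field_simps)
      also have "\<dots> = C * (\<bar>t\<bar> * vnorm X (vminus X y z))"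
        by (rule mult.left_commute)
      also have "\<bar>t\<bar> * vnorm X (vminus X y z) = vnorm X (vadd X x (vscale X (complex_of_real t) z))"
        using scaled[of "vminus X y z"] y z by (simp only: W closed)
      finally show ?thesis .
    qed
  qed
  have "real_functional_graph C g'"
    unfolding real_functional_graph_def
  proof (intro conjI allI impI)
    show "g' \<subseteq> carr X \<times> UNIV"
      unfolding g'_def using gX z by (auto intro!: add_closed scale_closed)
  next
    fix x r y s
    assume "(x, r) \<in> g'" "(y, s) \<in> g'"
    then obtain p a t q b u where *: "(p, a) \<in> g" "(q, b) \<in> g"
      "x = vadd X p (vscale X (complex_of_real t) z)" "r = a + t * c"
      "y = vadd X q (vscale X (complex_of_real u) z)" "s = b + u * c"
      unfolding g'_def by blast
    have "vadd X x y = vadd X (vadd X p q) (vscale X (complex_of_real (t + u)) z)"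
      using gX[OF *(1)] gX[OF *(2)] z by (simp add: * scale_add_left add_ac closed)
    moreover have "r + s = (a + b) + (t + u) * c"
      by (simp add: * algebra_simps)
    ultimately show "(vadd X x y, r + s) \<in> g'"
      unfolding g'_def using gadd[OF *(1,2)] by blast
  next
    fix x r a
    assume "(x, r) \<in> g'"
    then obtain p b t where *: "(p, b) \<in> g"
      "x = vadd X p (vscale X (complex_of_real t) z)" "r = b + t * c"
      unfolding g'_def by blast
    have "vscale X (complex_of_real a) x
        = vadd X (vscale X (complex_of_real a) p) (vscale X (complex_of_real (a * t)) z)"
      using gX[OF *(1)] z by (simp add: * scale_add_right scale_scale closed)
    moreover have "a * r = a * b + (a * t) * c"
      by (simp add: * algebra_simps)
    ultimately show "(vscale X (complex_of_real a) x, a * r) \<in> g'"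
      unfolding g'_def using gscale[OF *(1)] by blast
  next
    fix x r
    assume "(x, r) \<in> g'"
    then show "r \<le> C * vnorm X x"
      unfolding g'_def using bound by blast
  qed
  moreover have "g \<subseteq> g'"
  proof (rule subrelI)
    fix x r assume xr: "(x, r) \<in> g"
    have "(vadd X x (vscale X (complex_of_real 0) z), r + 0 * c) \<in> g'"
      unfolding g'_def using xr by blast
    then show "(x, r) \<in> g'"
      using gX[OF xr] z by (simp add: scale_zero_left add_zero_right)
  qed
  moreover have "(z, c) \<in> g'"
  proof -
    have "(vscale X (complex_of_real 0) x0, 0 * r0) \<in> g"
      by (rule gscale[OF x0])
    then have "(vadd X (vscale X (complex_of_real 0) x0) (vscale X (complex_of_real 1) z), 0 * r0 + 1 * c) \<in> g'"
      unfolding g'_def by blast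
    then show ?thesis
      using gX[OF x0] z by (simp add: scale_zero_left scale_one add_zero)
  qed
  ultimately show thesis
    by (rule that)
qed

lemma Hahn_Banach_real:
  assumes g: "real_functional_graph C g" and "g \<noteq> {}" and C: "C \<ge> 0"
  obtains u where "real_functional_graph C {(x, u x) | x. x \<in> carr X}" "\<And>x r. (x, r) \<in> g \<Longrightarrow> u x = r"
proof -
  let ?G = "{h. real_functional_graph C h \<and> g \<subseteq> h}"
  have "\<exists>M\<in>?G. \<forall>h\<in>?G. M \<subseteq> h \<longrightarrow> h = M"
  proof (rule subset_Zorn_nonempty)
    show "?G \<noteq> {}"
      using g by auto
  next
    fix \<C> assume "\<C> \<noteq> {}" and chain: "subset.chain ?G \<C>"
    have mem: "h \<in> \<C> \<Longrightarrow> real_functional_graph C h \<and> g \<subseteq> h" for h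
      using chain by (auto simp: subset_chain_def)
    have "real_functional_graph C (\<Union>\<C>)"
      unfolding real_functional_graph_def
    proof (intro conjI allI impI)
      show "\<Union>\<C> \<subseteq> carr X \<times> UNIV"
        using mem unfolding real_functional_graph_def by blast
    next
      fix x r y s
      assume "(x, r) \<in> \<Union>\<C>" "(y, s) \<in> \<Union>\<C>"
      then obtain h k where "h \<in> \<C>" "(x, r) \<in> h" "k \<in> \<C>" "(y, s) \<in> k"
        by auto
      moreover have "h \<subseteq> k \<or> k \<subseteq> h"
        using chain \<open>h \<in> \<C>\<close> \<open>k \<in> \<C>\<close> by (auto simp: subset_chain_def)
      ultimately obtain l where l: "l \<in> \<C>" "(x, r) \<in> l" "(y, s) \<in> l"
        by blast
      then have "(vadd X x y, r + s) \<in> l"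
        using mem unfolding real_functional_graph_def by blast
      then show "(vadd X x y, r + s) \<in> \<Union>\<C>"
        using l by auto
    next
      fix x r a
      assume "(x, r) \<in> \<Union>\<C>"
      then obtain h where h: "h \<in> \<C>" "(x, r) \<in> h"
        by auto
      then have "(vscale X (complex_of_real a) x, a * r) \<in> h"
        using mem unfolding real_functional_graph_def by blast
      then show "(vscale X (complex_of_real a) x, a * r) \<in> \<Union>\<C>"
        using h by auto
    next
      fix x r
      assume "(x, r) \<in> \<Union>\<C>"
      then show "r \<le> C * vnorm X x"
        using mem unfolding real_functional_graph_def by blast
    qed
    then show "\<Union>\<C> \<in> ?G"
      using mem \<open>\<C> \<noteq> {}\<close> by auto
  qed
  then obtain M where M: "real_functional_graph C M" "g \<subseteq> M"
    and max: "\<And>h. real_functional_graph C h \<Longrightarrow> M \<subseteq> h \<Longrightarrow> h = M"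
    by auto
  have total: "\<exists>r. (x, r) \<in> M" if x: "x \<in> carr X" for x
  proof -
    have "M \<noteq> {}"
      using M \<open>g \<noteq> {}\<close> by auto
    then obtain c g' where "real_functional_graph C g'" "M \<subseteq> g'" "(x, c) \<in> g'"
      using real_functional_graph_extend[OF M(1) _ C x] by metis
    then show ?thesis
      using max by blast
  qed
  define u where "u x = (THE r. (x, r) \<in> M)" for x
  have u: "u x = r" if "(x, r) \<in> M" for x r
    unfolding u_def using that real_functional_graph_unique[OF M(1)] by blast
  have "{(x, u x) | x. x \<in> carr X} = M"
  proof (intro equalityI subrelI)
    fix x r assume "(x, r) \<in> {(x, u x) | x. x \<in> carr X}"
    then have "x \<in> carr X" "r = u x"
      by auto
    then show "(x, r) \<in> M"
      using total u by blast
  next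
    fix x r assume "(x, r) \<in> M"
    moreover from this have "x \<in> carr X"
      using M(1) unfolding real_functional_graph_def by blast
    ultimately show "(x, r) \<in> {(x, u x) | x. x \<in> carr X}"
      using u by blast
  qed
  then show thesis
    using that[of u] M u by auto
qed

text \<open>The real part of the given functional is extended to a real functional \<open>u\<close>, and
  \<open>\<psi> x = u x - \<i> u (\<i> x)\<close> recovers the complex functional. The bound on \<open>u\<close> passes to \<open>\<psi>\<close> because a
  rotation of \<open>x\<close> makes \<open>\<psi> x\<close> real and nonnegative. The data are a graph rather than a subspace with
  a function on it, so that functionals on the range of an embedding are given without inverting it.\<close>

theorem Hahn_Banach:
  assumes carr: "\<And>x r. (x, r) \<in> g \<Longrightarrow> x \<in> carr X"
    and add: "\<And>x r y s. (x, r) \<in> g \<Longrightarrow> (y, s) \<in> g \<Longrightarrow> (vadd X x y, r + s) \<in> g"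
    and scale: "\<And>x r a. (x, r) \<in> g \<Longrightarrow> (vscale X a x, a * r) \<in> g"
    and bound: "\<And>x r. (x, r) \<in> g \<Longrightarrow> cmod r \<le> C * vnorm X x"
    and "g \<noteq> {}" "C \<ge> 0"
  obtains \<psi> where "\<psi> \<in> bounded_operators X complex_line"
    "\<And>x. x \<in> carr X \<Longrightarrow> cmod (\<psi> x) \<le> C * vnorm X x" "\<And>x r. (x, r) \<in> g \<Longrightarrow> \<psi> x = r"
proof -
  define h where "h = {(x, Re r) | x r. (x, r) \<in> g}"
  have "real_functional_graph C h"
    unfolding real_functional_graph_def
  proof (intro conjI allI impI)
    show "h \<subseteq> carr X \<times> UNIV"
      unfolding h_def using carr by auto
  next
    fix x r y s assume "(x, r) \<in> h" "(y, s) \<in> h"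
    then obtain p q where "(x, p) \<in> g" "r = Re p" "(y, q) \<in> g" "s = Re q"
      unfolding h_def by auto
    then show "(vadd X x y, r + s) \<in> h"
      unfolding h_def using add[of x p y q] by force
  next
    fix x r a assume "(x, r) \<in> h"
    then obtain p where "(x, p) \<in> g" "r = Re p"
      unfolding h_def by auto
    then show "(vscale X (complex_of_real a) x, a * r) \<in> h"
      unfolding h_def using scale[of x p "complex_of_real a"] by force
  next
    fix x r assume "(x, r) \<in> h"
    then show "r \<le> C * vnorm X x"
      unfolding h_def using bound complex_Re_le_cmod order_trans by blast
  qed
  moreover have "h \<noteq> {}"
    using \<open>g \<noteq> {}\<close> unfolding h_def by auto
  ultimately obtain u where u: "real_functional_graph C {(x, u x) | x. x \<in> carr X}"
    and uh: "\<And>x r. (x, r) \<in> h \<Longrightarrow> u x = r"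
    using Hahn_Banach_real \<open>C \<ge> 0\<close> by blast
  have u_add: "u (vadd X x y) = u x + u y" if "x \<in> carr X" "y \<in> carr X" for x y
    using u that unfolding real_functional_graph_def by auto
  have u_scale: "u (vscale X (complex_of_real a) x) = a * u x" if "x \<in> carr X" for a x
    using u that unfolding real_functional_graph_def by auto
  have u_le: "u x \<le> C * vnorm X x" if "x \<in> carr X" for x
    using u that unfolding real_functional_graph_def by auto
  define \<psi> where "\<psi> = (\<lambda>x\<in>carr X. Complex (u x) (- u (vscale X \<i> x)))"
  have \<psi>_add: "\<psi> (vadd X x y) = \<psi> x + \<psi> y" if "x \<in> carr X" "y \<in> carr X" for x y
    using that by (simp add: \<psi>_def closed scale_add_right u_add complex_eq_iff)
  have \<psi>_scale: "\<psi> (vscale X a x) = a * \<psi> x" if x: "x \<in> carr X" for a x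
  proof -
    have dec: "vscale X b x = vadd X (vscale X (complex_of_real (Re b)) x)
        (vscale X (complex_of_real (Im b)) (vscale X \<i> x))" for b
      using x scale_add_left[OF x, of "complex_of_real (Re b)" "\<i> * complex_of_real (Im b)"]
      by (simp add: scale_scale mult.commute complex_eq[symmetric])
    \<comment> \<open>Homogeneity for all complex scalars follows from the case of the real ones and \<open>\<i>\<close>.\<close>
    have ub: "u (vscale X b x) = Re b * u x + Im b * u (vscale X \<i> x)" for b
      by (subst dec) (simp add: u_add u_scale x closed)
    show ?thesis
      using x ub[of a] ub[of "\<i> * a"] by (simp add: \<psi>_def closed scale_scale complex_eq_iff)
  qed
  have \<psi>_le: "cmod (\<psi> x) \<le> C * vnorm X x" if x: "x \<in> carr X" for x
  proof (cases "\<psi> x = 0")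
    case True
    then show ?thesis
      using \<open>C \<ge> 0\<close> norm_nonneg[OF x] by simp
  next
    case False
    define a where "a = cnj (\<psi> x) / complex_of_real (cmod (\<psi> x))"
    have a: "cmod a = 1"
      using False by (simp add: a_def norm_divide)
    have "cnj (\<psi> x) * \<psi> x = complex_of_real (cmod (\<psi> x)) * complex_of_real (cmod (\<psi> x))"
      using complex_norm_square[of "\<psi> x"] by (simp add: power2_eq_square mult.commute)
    then have "\<psi> (vscale X a x) = complex_of_real (cmod (\<psi> x))"
      using False by (simp add: \<psi>_scale[OF x] a_def)
    then have "cmod (\<psi> x) = Re (\<psi> (vscale X a x))"
      by simp
    also have "\<dots> = u (vscale X a x)"
      using x by (simp add: \<psi>_def closed)
    also have "\<dots> \<le> C * vnorm X x"
      using u_le[of "vscale X a x"] x a by (simp add: closed norm_scale)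
    finally show ?thesis .
  qed
  show thesis
  proof (rule that)
    show "\<psi> \<in> bounded_operators X complex_line"
    proof (rule bounded_operatorsI[where C = C])
      show "\<psi> \<in> carr X \<rightarrow>\<^sub>E carr complex_line"
        by (simp add: \<psi>_def)
    qed (simp_all add: \<psi>_add \<psi>_scale \<psi>_le)
    show "cmod (\<psi> x) \<le> C * vnorm X x" if "x \<in> carr X" for x
      by (rule \<psi>_le[OF that])
    show "\<psi> x = r" if xr: "(x, r) \<in> g" for x r
    proof -
      have "(x, Re r) \<in> h" "(vscale X \<i> x, Re (\<i> * r)) \<in> h"
        unfolding h_def using xr scale[OF xr, of \<i>] by blast+
      then show ?thesis
        using uh[of x "Re r"] uh[of "vscale X \<i> x" "Re (\<i> * r)"] carr[OF xr]
        by (simp add: \<psi>_def complex_eq_iff)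
    qed
  qed
qed

corollary norming_functional:
  assumes x: "x \<in> carr X"
  obtains \<psi> where "\<psi> \<in> bounded_operators X complex_line"
    "\<And>y. y \<in> carr X \<Longrightarrow> cmod (\<psi> y) \<le> vnorm X y" "\<psi> x = vnorm X x"
proof -
  define g where "g = {(vscale X a x, a * complex_of_real (vnorm X x)) | a. True}"
  have g: "(vscale X a x, a * complex_of_real (vnorm X x)) \<in> g" for a
    unfolding g_def by blast
  obtain \<psi> where "\<psi> \<in> bounded_operators X complex_line"
    "\<And>y. y \<in> carr X \<Longrightarrow> cmod (\<psi> y) \<le> 1 * vnorm X y" "\<And>y r. (y, r) \<in> g \<Longrightarrow> \<psi> y = r"
  proof (rule Hahn_Banach[of g 1])
    show "y \<in> carr X" if "(y, r) \<in> g" for y r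
      using that x unfolding g_def by (auto simp: closed)
    show "(vadd X y z, r + s) \<in> g" if "(y, r) \<in> g" "(z, s) \<in> g" for y r z s
    proof -
      obtain a b where "y = vscale X a x" "r = a * vnorm X x" "z = vscale X b x" "s = b * vnorm X x"
        using \<open>(y, r) \<in> g\<close> \<open>(z, s) \<in> g\<close> unfolding g_def by auto
      then show ?thesis
        using g[of "a + b"] x by (simp add: scale_add_left distrib_right)
    qed
    show "(vscale X a y, a * r) \<in> g" if yr: "(y, r) \<in> g" for y r a
    proof -
      obtain b where "y = vscale X b x" "r = b * vnorm X x"
        using yr unfolding g_def by auto
      then show ?thesis
        using g[of "a * b"] x by (simp add: scale_scale mult.assoc)
    qed
    show "cmod r \<le> 1 * vnorm X y" if "(y, r) \<in> g" for y r
      using that x unfolding g_def by (auto simp: norm_scale norm_mult norm_nonneg)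
  qed (use g in auto)
  moreover have "(x, complex_of_real (vnorm X x)) \<in> g"
    using g[of 1] x by (simp add: scale_one)
  ultimately show thesis
    using that by simp
qed

end

section \<open>Dual spaces\<close>

lemma carr_dual_space [simp]: "carr (dual_space E) = bounded_operators E complex_line"
  by (simp add: dual_space_def)

lemma vnorm_dual_space [simp]: "vnorm (dual_space E) = operator_norm E complex_line"
  by (simp add: dual_space_def)

lemma vadd_dual_space [simp]: "vadd (dual_space E) \<phi> \<psi> = (\<lambda>x\<in>carr E. \<phi> x + \<psi> x)"
  by (simp add: dual_space_def)

lemma vscale_dual_space [simp]: "vscale (dual_space E) c \<phi> = (\<lambda>x\<in>carr E. c * \<phi> x)"
  by (simp add: dual_space_def)

lemma vzero_dual_space [simp]: "vzero (dual_space E) = (\<lambda>x\<in>carr E. 0)"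
  by (simp add: dual_space_def)

lemma complex_banach_space_dual:
  assumes E: "complex_normed_space E"
  shows "complex_banach_space (dual_space E)"
proof -
  interpret E: complex_normed_space E by (rule E)
  note C = complex_normed_space_complex_line
  have least: "operator_norm E complex_line \<phi> \<le> C"
    if "C \<ge> 0" "\<And>x. x \<in> carr E \<Longrightarrow> cmod (\<phi> x) \<le> vnorm E x * C" for \<phi> C
    using that by (intro operator_norm_least) (auto simp: mult.commute)
  have eval: "cmod (\<phi> x) \<le> vnorm E x * operator_norm E complex_line \<phi>"
    if "\<phi> \<in> bounded_operators E complex_line" "x \<in> carr E" for \<phi> x
    using operator_norm_bound[OF E C that] by (simp add: mult.commute)
  have normed: "complex_normed_space (dual_space E)"
    unfolding dual_space_def
  proof (rule fun_space_normedI[where b = "vnorm E"])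
    show "bounded_operators E complex_line \<subseteq> carr E \<rightarrow>\<^sub>E carr complex_line"
      by (auto simp: bounded_operators_def)
  qed (use bounded_operators_zero_map[OF E C] bounded_operators_sum[OF E C] 
       bounded_operators_multiple[OF E C] eval least operator_norm_nonneg[OF E C] in \<open>auto simp: E.norm_nonneg C\<close>)
  show ?thesis
    unfolding dual_space_def
  proof (rule fun_space_complete[where b = "vnorm E"])
    show "complex_normed_space (fun_space (carr E) complex_line (bounded_operators E complex_line)
        (operator_norm E complex_line))"
      using normed by (simp add: dual_space_def)
  next
    fix s \<phi>
    assume s: "\<And>n. s n \<in> bounded_operators E complex_line" and ext: "\<phi> \<in> extensional (carr E)"
      and lim: "\<And>x. x \<in> carr E \<Longrightarrow> (\<lambda>n. s n x) \<longlonglongrightarrow> \<phi> x"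
      and close: "\<And>e. e > 0 \<Longrightarrow> \<exists>M. \<forall>n\<ge>M. \<forall>x\<in>carr E. cmod (s n x - \<phi> x) \<le> vnorm E x * e"
    obtain M where M: "\<forall>n\<ge>M. \<forall>x\<in>carr E. cmod (s n x - \<phi> x) \<le> vnorm E x * 1"
      using close[of 1] by auto
    show "\<phi> \<in> bounded_operators E complex_line"
    proof (rule bounded_operatorsI)
      show "\<phi> \<in> carr E \<rightarrow>\<^sub>E carr complex_line"
        using ext by (simp add: PiE_def)
    next
      fix x y assume x: "x \<in> carr E" and y: "y \<in> carr E"
      have "(\<lambda>n. s n (vadd E x y)) \<longlonglongrightarrow> \<phi> x + \<phi> y"
        using tendsto_add[OF lim[OF x] lim[OF y]] x y by (simp add: bounded_operators_add[OF s])
      then show "\<phi> (vadd E x y) = vadd complex_line (\<phi> x) (\<phi> y)"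
        using lim[of "vadd E x y"] x y LIMSEQ_unique by (auto simp: E.closed)
    next
      fix c x assume x: "x \<in> carr E"
      have "(\<lambda>n. s n (vscale E c x)) \<longlonglongrightarrow> c * \<phi> x"
        using tendsto_mult_left[OF lim[OF x], of c] x by (simp add: bounded_operators_scale[OF s])
      then show "\<phi> (vscale E c x) = vscale complex_line c (\<phi> x)"
        using lim[of "vscale E c x"] x LIMSEQ_unique by (auto simp: E.closed)
    next
      fix x assume x: "x \<in> carr E"
      have "cmod (s M x - \<phi> x) \<le> vnorm E x"
        using M x by simp
      then show "vnorm complex_line (\<phi> x) \<le> (operator_norm E complex_line (s M) + 1) * vnorm E x"
        using eval[OF s x, of M] norm_triangle_ineq4[of "s M x" "s M x - \<phi> x"] by (simp add: algebra_simps)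
    qed
  qed (use eval least in \<open>auto simp: E.norm_nonneg bounded_operators_extensional\<close>)
qed

section \<open>Isometric isomorphisms and copies of Banach spaces\<close>

lemma isometric_embedding_inj_on:
  assumes "complex_normed_space E" "complex_normed_space F" and j: "isometric_embedding j E F"
  shows "inj_on j (carr E)"
proof (rule inj_onI)
  interpret E: complex_normed_space E by (rule assms)
  interpret F: complex_normed_space F by (rule assms)
  fix x y assume x: "x \<in> carr E" and y: "y \<in> carr E" and "j x = j y"
  have op: "j \<in> bounded_operators E F"
    using j by (simp add: isometric_embedding_def)
  have "j (vminus E x y) = vzero F"
    using bounded_operators_minus[OF assms(1) op x y] \<open>j x = j y\<close> F.minus_self
      bounded_operators_carr[OF op y] by simp
  then have "vnorm E (vminus E x y) = 0"
    using j x y unfolding isometric_embedding_def by (metis E.minus_closed F.norm_zero)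
  then show "x = y"
    using x y E.norm_eq_zero E.minus_eq_zero E.minus_closed by blast
qed

lemma isometric_embedding_compose:
  assumes "complex_normed_space D" "complex_normed_space E" "complex_normed_space F"
    and "isometric_embedding i D E" "isometric_embedding j E F"
  shows "isometric_embedding (compose (carr D) j i) D F"
  using assms bounded_operators_compose[OF assms(1-3), of i j] bounded_operators_carr[of i D E]
  unfolding isometric_embedding_def by (simp add: compose_def)

definition iso_inverse :: "('a \<Rightarrow> 'b) \<Rightarrow> 'a cspace \<Rightarrow> 'b cspace \<Rightarrow> 'b \<Rightarrow> 'a" where
  "iso_inverse j E F = restrict (inv_into (carr E) j) (carr F)"

context
  fixes E :: "'a cspace" and F :: "'b cspace" and j
  assumes E: "complex_normed_space E" and F: "complex_normed_space F"
    and j: "isometric_isomorphism j E F"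
begin

lemma iso_operator: "j \<in> bounded_operators E F"
  using j by (simp add: isometric_isomorphism_def isometric_embedding_def)

lemma iso_carr: "x \<in> carr E \<Longrightarrow> j x \<in> carr F"
  by (rule bounded_operators_carr[OF iso_operator])

lemma iso_norm: "x \<in> carr E \<Longrightarrow> vnorm F (j x) = vnorm E x"
  using j by (simp add: isometric_isomorphism_def isometric_embedding_def)

lemma iso_inverse_left: "x \<in> carr E \<Longrightarrow> iso_inverse j E F (j x) = x"
  using isometric_embedding_inj_on[OF E F] j iso_carr
  by (simp add: iso_inverse_def isometric_isomorphism_def)

lemma iso_inverse_right: "y \<in> carr F \<Longrightarrow> j (iso_inverse j E F y) = y"
  using j by (simp add: iso_inverse_def isometric_isomorphism_def f_inv_into_f)

lemma iso_inverse_carr: "y \<in> carr F \<Longrightarrow> iso_inverse j E F y \<in> carr E"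
  using j by (simp add: iso_inverse_def isometric_isomorphism_def inv_into_into)

lemma isometric_isomorphism_inverse: "isometric_isomorphism (iso_inverse j E F) F E"
proof -
  interpret E: complex_normed_space E by (rule E)
  interpret F: complex_normed_space F by (rule F)
  let ?i = "iso_inverse j E F"
  have norm: "vnorm E (?i y) = vnorm F y" if "y \<in> carr F" for y
    using iso_norm[of "?i y"] that by (simp add: iso_inverse_carr iso_inverse_right)
  have "?i \<in> bounded_operators F E"
  proof (rule bounded_operatorsI[where C = 1])
    show "?i \<in> carr F \<rightarrow>\<^sub>E carr E"
      using iso_inverse_carr by (auto simp: iso_inverse_def)
  next
    fix x y assume "x \<in> carr F" "y \<in> carr F"
    then show "?i (vadd F x y) = vadd E (?i x) (?i y)"
      using iso_inverse_left[of "vadd E (?i x) (?i y)"]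
      by (simp add: iso_inverse_carr iso_inverse_right E.closed bounded_operators_add[OF iso_operator])
  next
    fix c x assume "x \<in> carr F"
    then show "?i (vscale F c x) = vscale E c (?i x)"
      using iso_inverse_left[of "vscale E c (?i x)"]
      by (simp add: iso_inverse_carr iso_inverse_right E.closed bounded_operators_scale[OF iso_operator])
  qed (simp add: norm)
  moreover have "?i ` carr F = carr E"
    using iso_inverse_carr iso_inverse_left iso_carr by (force simp: image_iff)
  ultimately show ?thesis
    using norm by (simp add: isometric_isomorphism_def isometric_embedding_def)
qed

end

lemma isometric_isomorphism_compose:
  assumes "complex_normed_space D" "complex_normed_space E" "complex_normed_space F"
    and "isometric_isomorphism i D E" "isometric_isomorphism j E F"
  shows "isometric_isomorphism (compose (carr D) j i) D F"
proof -
  have "compose (carr D) j i ` carr D = j ` i ` carr D"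
    by (simp add: compose_def image_image)
  then show ?thesis
    using assms isometric_embedding_compose[OF assms(1-3)] by (simp add: isometric_isomorphism_def)
qed

lemma isometric_isomorphism_complete:
  assumes X: "complex_banach_space X" and Y: "complex_normed_space Y"
    and j: "isometric_isomorphism j X Y"
  shows "complex_banach_space Y"
  unfolding complex_banach_space_iff_Cauchy_converges
proof (intro conjI Y allI impI)
  have X': "complex_normed_space X"
    by (rule banach_is_normed[OF X])
  interpret X: complex_normed_space X by (rule X')
  interpret Y: complex_normed_space Y by (rule Y)
  let ?i = "iso_inverse j X Y"
  have i: "isometric_isomorphism ?i Y X"
    by (rule isometric_isomorphism_inverse[OF X' Y j])
  note op = iso_operator[OF X' Y j] iso_operator[OF Y X' i]
  note carr = iso_carr[OF X' Y j] iso_carr[OF Y X' i]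
  have diff: "vnorm X (vminus X (?i x) (?i y)) = vnorm Y (vminus Y x y)" if "x \<in> carr Y" "y \<in> carr Y" for x y
    using that iso_norm[OF Y X' i, of "vminus Y x y"] bounded_operators_minus[OF Y op(2)]
    by (simp add: Y.closed)
  fix s :: "nat \<Rightarrow> _"
  assume s: "range s \<subseteq> carr Y \<and> (\<forall>e>0. \<exists>N. \<forall>m\<ge>N. \<forall>n\<ge>N. vnorm Y (vminus Y (s m) (s n)) < e)"
  then have sY: "s n \<in> carr Y" for n
    by auto
  have "range (\<lambda>n. ?i (s n)) \<subseteq> carr X \<and>
      (\<forall>e>0. \<exists>N. \<forall>m\<ge>N. \<forall>n\<ge>N. vnorm X (vminus X (?i (s m)) (?i (s n))) < e)"
    using s carr(2)[OF sY] by (simp add: diff[OF sY sY] image_subset_iff)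
  then obtain l where l: "l \<in> carr X" "\<forall>e>0. \<exists>N. \<forall>n\<ge>N. vnorm X (vminus X (?i (s n)) l) < e"
    using X[unfolded complex_banach_space_iff_Cauchy_converges, THEN conjunct2, THEN spec[of _ "\<lambda>n. ?i (s n)"]]
    by blast
  have "vnorm X (vminus X (?i (s n)) l) = vnorm Y (vminus Y (s n) (j l))" for n
    using diff[OF sY carr(1)[OF l(1)]] l(1) by (simp add: iso_inverse_left[OF X' Y j])
  then show "\<exists>l\<in>carr Y. \<forall>e>0. \<exists>N. \<forall>n\<ge>N. vnorm Y (vminus Y (s n) l) < e"
    using l carr by (intro bexI[of _ "j l"]) auto
qed

text \<open>The structure of \<open>X\<close> carried along a map \<open>i\<close> that is injective on the carrier.\<close>

definition space_image :: "('a \<Rightarrow> 'b) \<Rightarrow> 'a cspace \<Rightarrow> 'b cspace" where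
  "space_image i X = (let k = inv_into (carr X) i in
    \<lparr>carr = i ` carr X, vadd = (\<lambda>x y. i (vadd X (k x) (k y))), vzero = i (vzero X),
     vscale = (\<lambda>c x. i (vscale X c (k x))), vnorm = (\<lambda>x. vnorm X (k x))\<rparr>)"

lemma space_image:
  assumes X: "complex_banach_space X" and i: "inj_on i (carr X)"
  shows "complex_banach_space (space_image i X)"
    and "isometric_isomorphism (restrict i (carr X)) X (space_image i X)"
proof -
  interpret X: complex_normed_space X by (rule banach_is_normed[OF X])
  let ?Y = "space_image i X"
  have [simp]: "inv_into (carr X) i (i x) = x" if "x \<in> carr X" for x
    using that i by simp
  have ops [simp]: "carr ?Y = i ` carr X" "vzero ?Y = i (vzero X)"
    "\<And>x y. x \<in> carr X \<Longrightarrow> y \<in> carr X \<Longrightarrow> vadd ?Y (i x) (i y) = i (vadd X x y)"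
    "\<And>c x. x \<in> carr X \<Longrightarrow> vscale ?Y c (i x) = i (vscale X c x)"
    "\<And>x. x \<in> carr X \<Longrightarrow> vnorm ?Y (i x) = vnorm X x"
    by (simp_all add: space_image_def Let_def)
  have inj: "i x = i y \<longleftrightarrow> x = y" if "x \<in> carr X" "y \<in> carr X" for x y
    using i that by (meson inj_on_eq_iff)
  have Y: "complex_normed_space ?Y"
    by unfold_locales
      (auto simp: vminus_def X.closed X.add_ac X.add_zero X.add_zero_right X.scale_add_right X.scale_add_left
        X.scale_scale X.scale_one X.norm_nonneg X.norm_eq_zero X.norm_triangle X.norm_scale inj
        X.minus_self[unfolded vminus_def])
  show iso: "isometric_isomorphism (restrict i (carr X)) X ?Y"
    unfolding isometric_isomorphism_def isometric_embedding_def
    by (auto intro!: bounded_operatorsI[where C = 1] simp: X.closed)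
  show "complex_banach_space ?Y"
    by (rule isometric_isomorphism_complete[OF X Y iso])
qed

text \<open>Exactly the spaces with a copy over the type of the ideal are those on which the ideal can be
  evaluated; the first argument only passes that type.\<close>

definition has_copy :: "'w itself \<Rightarrow> 'a cspace \<Rightarrow> bool" where
  "has_copy w X \<longleftrightarrow> complex_banach_space X \<and>
     (\<exists>(X' :: 'w cspace) \<phi>. complex_banach_space X' \<and> isometric_isomorphism \<phi> X X')"

lemma has_copyI_lepoll:
  fixes X :: "'a cspace"
  assumes X: "complex_banach_space X" and "(UNIV :: 'a set) \<lesssim> (UNIV :: 'w set)"
  shows "has_copy TYPE('w) X"
proof -
  obtain i :: "'a \<Rightarrow> 'w" where "inj i"
    using assms(2) by (auto simp: lepoll_def)
  then have "inj_on i (carr X)"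
    by (auto intro: inj_on_subset)
  then show ?thesis
    unfolding has_copy_def using X space_image[OF X] by blast
qed

lemma has_copy_banach: "has_copy w X \<Longrightarrow> complex_banach_space X"
  by (simp add: has_copy_def)

lemma has_copy_normed: "has_copy w X \<Longrightarrow> complex_normed_space X"
  by (simp add: has_copy_def banach_is_normed)

lemma has_copyE:
  fixes X :: "'a cspace"
  assumes "has_copy TYPE('w) X"
  obtains X' :: "'w cspace" and \<phi> :: "'a \<Rightarrow> 'w"
    where "complex_banach_space X'" "isometric_isomorphism \<phi> X X'"
proof -
  have "\<exists>(X' :: 'w cspace) \<phi>. complex_banach_space X' \<and> isometric_isomorphism \<phi> X X'"
    using assms by (simp add: has_copy_def)
  then show thesis
    using that by blast
qed

lemma isometric_isomorphism_refl:
  assumes "complex_normed_space X"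
  shows "isometric_isomorphism (\<lambda>x\<in>carr X. x) X X"
proof -
  interpret complex_normed_space X by (rule assms)
  show ?thesis
    unfolding isometric_isomorphism_def isometric_embedding_def
    by (auto intro!: bounded_operatorsI[where C = 1] simp: closed)
qed

lemma has_copy_iso:
  assumes X: "has_copy TYPE('w) X" and Y: "complex_banach_space Y" and j: "isometric_isomorphism j Y X"
  shows "has_copy TYPE('w) Y"
proof -
  obtain X' :: "'w cspace" and \<phi> where X': "complex_banach_space X'" and \<phi>: "isometric_isomorphism \<phi> X X'"
    using X by (rule has_copyE)
  have "isometric_isomorphism (compose (carr Y) \<phi> j) Y X'"
    using isometric_isomorphism_compose[OF banach_is_normed[OF Y] has_copy_normed[OF X] banach_is_normed[OF X'] j \<phi>] .
  then show ?thesis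
    unfolding has_copy_def using X' Y by blast
qed

text \<open>The operator that corresponds to \<open>S\<close> under the identifications \<open>\<phi>\<close> of \<open>X\<close> with \<open>X'\<close> and \<open>\<psi>\<close> of the
  target space of \<open>S\<close> with another space.\<close>

definition transported :: "('a \<Rightarrow> 'c) \<Rightarrow> 'a cspace \<Rightarrow> 'c cspace \<Rightarrow> ('b \<Rightarrow> 'd) \<Rightarrow> ('a \<Rightarrow> 'b) \<Rightarrow> 'c \<Rightarrow> 'd" where
  "transported \<phi> X X' \<psi> S = (\<lambda>x\<in>carr X'. \<psi> (S (iso_inverse \<phi> X X' x)))"

lemma transported_apply:
  assumes "complex_normed_space X" "complex_normed_space X'" "isometric_isomorphism \<phi> X X'" "x \<in> carr X"
  shows "transported \<phi> X X' \<psi> S (\<phi> x) = \<psi> (S x)"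
  using assms by (simp add: transported_def iso_carr iso_inverse_left)

lemma transported_operator:
  assumes X: "complex_normed_space X" and X': "complex_normed_space X'" and \<phi>: "isometric_isomorphism \<phi> X X'"
    and Y: "complex_normed_space Y" and Y': "complex_normed_space Y'" and \<psi>: "isometric_isomorphism \<psi> Y Y'"
    and S: "S \<in> bounded_operators X Y"
  shows "transported \<phi> X X' \<psi> S \<in> bounded_operators X' Y'"
proof -
  have "compose (carr X') \<psi> (compose (carr X') S (iso_inverse \<phi> X X')) \<in> bounded_operators X' Y'"
    using iso_operator[OF X' X isometric_isomorphism_inverse[OF X X' \<phi>]] iso_operator[OF Y Y' \<psi>] S
    by (intro bounded_operators_compose[OF X' Y Y'] bounded_operators_compose[OF X' X Y])
  then show ?thesis
    by (simp add: transported_def compose_def restrict_def cong: if_cong)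
qed

lemma transported_copy:
  assumes "complex_banach_space X" "complex_banach_space X'" "isometric_isomorphism \<phi> X X'"
    and "complex_banach_space Y" "complex_banach_space Y'" "isometric_isomorphism \<psi> Y Y'"
    and "S \<in> bounded_operators X Y"
  shows "operator_copy X Y S X' Y' (transported \<phi> X X' \<psi> S)"
  unfolding operator_copy_def
proof (intro conjI exI ballI)
  show "transported \<phi> X X' \<psi> S \<in> bounded_operators X' Y'"
    using assms by (intro transported_operator banach_is_normed)
  show "transported \<phi> X X' \<psi> S (\<phi> x) = \<psi> (S x)" if "x \<in> carr X" for x
    using assms that by (intro transported_apply banach_is_normed)
qed (fact assms)+

section \<open>Adjoint operators and metric surjections\<close>

context
  fixes E :: "'a cspace" and F :: "'b cspace" and T
  assumes E: "complex_normed_space E" and F: "complex_normed_space F"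
    and T: "T \<in> bounded_operators E F"
begin

lemma adjoint_apply:
  "\<phi> \<in> bounded_operators F complex_line \<Longrightarrow> adjoint_operator E F T \<phi> = (\<lambda>x\<in>carr E. \<phi> (T x))"
  by (simp add: adjoint_operator_def compose_def)

lemma adjoint_norm_le:
  assumes \<phi>: "\<phi> \<in> bounded_operators F complex_line"
    and "t \<ge> 0" "\<And>x. x \<in> carr E \<Longrightarrow> vnorm F (T x) \<le> t * vnorm E x"
  shows "vnorm (dual_space E) (adjoint_operator E F T \<phi>) \<le> t * vnorm (dual_space F) \<phi>"
proof -
  note C = complex_normed_space_complex_line
  have "operator_norm E complex_line (\<lambda>x\<in>carr E. \<phi> (T x)) \<le> operator_norm F complex_line \<phi> * t"
  proof (rule operator_norm_least)
    fix x assume x: "x \<in> carr E"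
    have "cmod (\<phi> (T x)) \<le> operator_norm F complex_line \<phi> * vnorm F (T x)"
      using operator_norm_bound[OF F C \<phi> bounded_operators_carr[OF T x]] by simp
    also have "\<dots> \<le> operator_norm F complex_line \<phi> * (t * vnorm E x)"
      using assms(3)[OF x] operator_norm_nonneg[OF F C \<phi>] by (rule mult_left_mono)
    finally show "vnorm complex_line ((\<lambda>x\<in>carr E. \<phi> (T x)) x) \<le> operator_norm F complex_line \<phi> * t * vnorm E x"
      using x by (simp add: mult.assoc)
  qed (simp add: operator_norm_nonneg[OF F C \<phi>] assms)
  then show ?thesis
    using \<phi> by (simp add: adjoint_apply mult.commute)
qed

lemma adjoint_operator_bounded: "adjoint_operator E F T \<in> bounded_operators (dual_space F) (dual_space E)"
proof -
  interpret E: complex_normed_space E by (rule E)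
  interpret F: complex_normed_space F by (rule F)
  interpret D: complex_normed_space "dual_space F"
    by (rule banach_is_normed[OF complex_banach_space_dual[OF F]])
  note C = complex_normed_space_complex_line
  obtain t where t: "t \<ge> 0" "\<And>x. x \<in> carr E \<Longrightarrow> vnorm F (T x) \<le> t * vnorm E x"
    using bounded_operators_bound[OF E T] by blast
  have TF: "T x \<in> carr F" if "x \<in> carr E" for x
    by (rule bounded_operators_carr[OF T that])
  show ?thesis
  proof (rule bounded_operatorsI[where C = t])
    have "adjoint_operator E F T \<phi> \<in> carr (dual_space E)" if "\<phi> \<in> carr (dual_space F)" for \<phi>
      using that bounded_operators_compose[OF E F C T] by (simp add: adjoint_operator_def)
    then show "adjoint_operator E F T \<in> carr (dual_space F) \<rightarrow>\<^sub>E carr (dual_space E)"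
      by (auto simp: adjoint_operator_def)
  next
    fix \<phi> \<psi> assume "\<phi> \<in> carr (dual_space F)" "\<psi> \<in> carr (dual_space F)"
    then show "adjoint_operator E F T (vadd (dual_space F) \<phi> \<psi>)
        = vadd (dual_space E) (adjoint_operator E F T \<phi>) (adjoint_operator E F T \<psi>)"
      using D.add_closed[of \<phi> \<psi>] TF by (auto simp: adjoint_apply intro!: restrict_ext)
  next
    fix c \<phi> assume "\<phi> \<in> carr (dual_space F)"
    then show "adjoint_operator E F T (vscale (dual_space F) c \<phi>)
        = vscale (dual_space E) c (adjoint_operator E F T \<phi>)"
      using D.scale_closed[of \<phi> c] TF by (auto simp: adjoint_apply intro!: restrict_ext)
  qed (use adjoint_norm_le t in auto)
qed

end

text \<open>Every element has a preimage of no larger norm. A quotient map need not attain the quotient norm,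
  but restriction of functionals along an isometric embedding does.\<close>

definition metric_surjection :: "('a \<Rightarrow> 'b) \<Rightarrow> 'a cspace \<Rightarrow> 'b cspace \<Rightarrow> bool" where
  "metric_surjection Q Z X \<longleftrightarrow> Q \<in> bounded_operators Z X \<and>
     (\<forall>z\<in>carr Z. vnorm X (Q z) \<le> vnorm Z z) \<and>
     (\<forall>x\<in>carr X. \<exists>z\<in>carr Z. Q z = x \<and> vnorm Z z \<le> vnorm X x)"

lemma adjoint_of_metric_surjection:
  assumes Z: "complex_normed_space Z" and X: "complex_normed_space X" and Q: "metric_surjection Q Z X"
  shows "isometric_embedding (adjoint_operator Z X Q) (dual_space X) (dual_space Z)"
  unfolding isometric_embedding_def
proof (intro conjI ballI)
  have op: "Q \<in> bounded_operators Z X"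
    using Q by (simp add: metric_surjection_def)
  note C = complex_normed_space_complex_line
  note adj = adjoint_operator_bounded[OF Z X op]
  show "adjoint_operator Z X Q \<in> bounded_operators (dual_space X) (dual_space Z)"
    by (rule adj)
  fix \<xi> assume \<xi>: "\<xi> \<in> carr (dual_space X)"
  let ?\<eta> = "adjoint_operator Z X Q \<xi>"
  have \<eta>: "?\<eta> \<in> bounded_operators Z complex_line"
    using bounded_operators_carr[OF adj \<xi>] by simp
  have "operator_norm X complex_line \<xi> \<le> operator_norm Z complex_line ?\<eta>"
  proof (rule operator_norm_least[OF operator_norm_nonneg[OF Z C \<eta>]])
    fix x assume "x \<in> carr X"
    then obtain z where z: "z \<in> carr Z" "Q z = x" "vnorm Z z \<le> vnorm X x"
      using Q unfolding metric_surjection_def by blast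
    have "cmod (\<xi> x) = cmod (?\<eta> z)"
      using z \<xi> adjoint_apply[OF Z X op] by simp
    also have "\<dots> \<le> operator_norm Z complex_line ?\<eta> * vnorm Z z"
      using operator_norm_bound[OF Z C \<eta> z(1)] by simp
    also have "\<dots> \<le> operator_norm Z complex_line ?\<eta> * vnorm X x"
      using z(3) operator_norm_nonneg[OF Z C \<eta>] by (rule mult_left_mono)
    finally show "vnorm complex_line (\<xi> x) \<le> operator_norm Z complex_line ?\<eta> * vnorm X x"
      by simp
  qed
  moreover have "vnorm (dual_space Z) ?\<eta> \<le> 1 * vnorm (dual_space X) \<xi>"
    using \<xi> Q unfolding metric_surjection_def by (intro adjoint_norm_le[OF Z X op]) auto
  ultimately show "vnorm (dual_space Z) ?\<eta> = vnorm (dual_space X) \<xi>"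
    by simp
qed

text \<open>A functional on \<open>F\<close>, read as a functional on the range of \<open>j\<close>, extends to \<open>G\<close> with the same norm.\<close>

lemma adjoint_of_isometric_embedding:
  assumes F: "complex_normed_space F" and G: "complex_normed_space G" and j: "isometric_embedding j F G"
  shows "metric_surjection (adjoint_operator F G j) (dual_space G) (dual_space F)"
  unfolding metric_surjection_def
proof (intro conjI ballI)
  interpret F: complex_normed_space F by (rule F)
  interpret G: complex_normed_space G by (rule G)
  note C = complex_normed_space_complex_line
  have op: "j \<in> bounded_operators F G" and norm: "\<And>x. x \<in> carr F \<Longrightarrow> vnorm G (j x) = vnorm F x"
    using j by (simp_all add: isometric_embedding_def)
  show "adjoint_operator F G j \<in> bounded_operators (dual_space G) (dual_space F)"
    by (rule adjoint_operator_bounded[OF F G op])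
  show "vnorm (dual_space F) (adjoint_operator F G j \<psi>) \<le> vnorm (dual_space G) \<psi>"
    if "\<psi> \<in> carr (dual_space G)" for \<psi>
    using adjoint_norm_le[OF F G op, of \<psi> 1] that norm by simp
  fix \<phi> assume "\<phi> \<in> carr (dual_space F)"
  then have \<phi>: "\<phi> \<in> bounded_operators F complex_line"
    by simp
  let ?C = "operator_norm F complex_line \<phi>"
  let ?g = "{(j x, \<phi> x) | x. x \<in> carr F}"
  note jG = bounded_operators_carr[OF op]
  obtain \<psi> where \<psi>: "\<psi> \<in> bounded_operators G complex_line"
    "\<And>y. y \<in> carr G \<Longrightarrow> cmod (\<psi> y) \<le> ?C * vnorm G y" "\<And>y r. (y, r) \<in> ?g \<Longrightarrow> \<psi> y = r"
  proof (rule G.Hahn_Banach[of ?g ?C])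
    show "y \<in> carr G" if "(y, r) \<in> ?g" for y r
      using that jG by auto
    show "(vadd G y z, r + s) \<in> ?g" if yz: "(y, r) \<in> ?g" "(z, s) \<in> ?g" for y r z s
    proof -
      obtain p q where p: "p \<in> carr F" "y = j p" "r = \<phi> p" and q: "q \<in> carr F" "z = j q" "s = \<phi> q"
        using yz by auto
      have "vadd G y z = j (vadd F p q) \<and> r + s = \<phi> (vadd F p q) \<and> vadd F p q \<in> carr F"
        using p q by (simp add: F.closed bounded_operators_add[OF op] bounded_operators_add[OF \<phi>])
      then show ?thesis
        by blast
    qed
    show "(vscale G a y, a * r) \<in> ?g" if y: "(y, r) \<in> ?g" for y r a
    proof -
      obtain p where p: "p \<in> carr F" "y = j p" "r = \<phi> p"
        using y by auto
      have "vscale G a y = j (vscale F a p) \<and> a * r = \<phi> (vscale F a p) \<and> vscale F a p \<in> carr F"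
        using p by (simp add: F.closed bounded_operators_scale[OF op] bounded_operators_scale[OF \<phi>])
      then show ?thesis
        by blast
    qed
    show "cmod r \<le> ?C * vnorm G y" if "(y, r) \<in> ?g" for y r
      using that operator_norm_bound[OF F C \<phi>] norm by auto
    show "?g \<noteq> {}"
      using F.zero_closed by auto
    show "?C \<ge> 0"
      by (rule operator_norm_nonneg[OF F C \<phi>])
  qed (rule that; assumption)
  show "\<exists>\<psi>\<in>carr (dual_space G). adjoint_operator F G j \<psi> = \<phi> \<and> vnorm (dual_space G) \<psi> \<le> vnorm (dual_space F) \<phi>"
  proof (intro bexI[of _ \<psi>] conjI)
    have "(\<lambda>x\<in>carr F. \<psi> (j x)) = \<phi>"
      using \<psi>(3) bounded_operators_extensional[OF \<phi>] by (intro extensionalityI[of _ "carr F"]) auto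
    then show "adjoint_operator F G j \<psi> = \<phi>"
      using \<psi>(1) by (simp add: adjoint_apply[OF F G op])
    show "vnorm (dual_space G) \<psi> \<le> vnorm (dual_space F) \<phi>"
      using \<psi>(2) operator_norm_nonneg[OF F C \<phi>] by (auto intro: operator_norm_least)
  qed (simp add: \<psi>)
qed

lemma metric_surjection_iso:
  assumes j: "isometric_isomorphism j E F"
  shows "metric_surjection j E F"
proof -
  have op: "j \<in> bounded_operators E F" and norm: "\<And>x. x \<in> carr E \<Longrightarrow> vnorm F (j x) = vnorm E x"
    and onto: "j ` carr E = carr F"
    using j by (simp_all add: isometric_isomorphism_def isometric_embedding_def)
  have "\<exists>z\<in>carr E. j z = x \<and> vnorm E z \<le> vnorm F x" if "x \<in> carr F" for x
    using that norm unfolding onto[symmetric] by auto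
  then show ?thesis
    unfolding metric_surjection_def using op norm by simp
qed

lemma adjoint_of_isometric_isomorphism:
  assumes E: "complex_normed_space E" and F: "complex_normed_space F" and j: "isometric_isomorphism j E F"
  shows "isometric_isomorphism (adjoint_operator E F j) (dual_space F) (dual_space E)"
proof -
  have emb: "isometric_embedding (adjoint_operator E F j) (dual_space F) (dual_space E)"
    by (rule adjoint_of_metric_surjection[OF E F metric_surjection_iso[OF j]])
  let ?A = "adjoint_operator E F j"
  have surj: "metric_surjection ?A (dual_space F) (dual_space E)"
    using j by (intro adjoint_of_isometric_embedding[OF E F]) (simp add: isometric_isomorphism_def)
  have "?A ` carr (dual_space F) = carr (dual_space E)"
  proof (intro equalityI subsetI)
    fix \<phi> assume "\<phi> \<in> ?A ` carr (dual_space F)"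
    then obtain \<psi> where "\<psi> \<in> carr (dual_space F)" "\<phi> = ?A \<psi>"
      by blast
    moreover have "?A \<in> bounded_operators (dual_space F) (dual_space E)"
      using emb by (simp add: isometric_embedding_def)
    ultimately show "\<phi> \<in> carr (dual_space E)"
      using bounded_operators_carr by metis
  next
    fix \<phi> assume "\<phi> \<in> carr (dual_space E)"
    then obtain \<psi> where "\<psi> \<in> carr (dual_space F)" "?A \<psi> = \<phi>"
      using surj unfolding metric_surjection_def by blast
    then show "\<phi> \<in> ?A ` carr (dual_space F)"
      by blast
  qed
  then show ?thesis
    using emb by (simp add: isometric_isomorphism_def)
qed

lemma metric_surjection_compose_iso:
  assumes Z': "complex_normed_space Z'" and Z: "complex_normed_space Z"
    and X: "complex_normed_space X" and X': "complex_normed_space X'"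
    and Q: "metric_surjection Q Z X"
    and \<zeta>: "isometric_isomorphism \<zeta> Z Z'" and \<phi>: "isometric_isomorphism \<phi> X X'"
  shows "metric_surjection (transported \<zeta> Z Z' \<phi> Q) Z' X'"
proof -
  have op: "Q \<in> bounded_operators Z X"
    using Q by (simp add: metric_surjection_def)
  note QX = bounded_operators_carr[OF op]
  note z = isometric_isomorphism_inverse[OF Z Z' \<zeta>]
  show ?thesis
    unfolding metric_surjection_def
  proof (intro conjI ballI)
    show "transported \<zeta> Z Z' \<phi> Q \<in> bounded_operators Z' X'"
      by (rule transported_operator[OF Z Z' \<zeta> X X' \<phi> op])
    show "vnorm X' (transported \<zeta> Z Z' \<phi> Q w) \<le> vnorm Z' w" if "w \<in> carr Z'" for w
      using that Q iso_carr[OF Z' Z z that] iso_norm[OF Z' Z z that]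
      by (auto simp: transported_def iso_norm[OF X X' \<phi>] QX metric_surjection_def)
    fix x assume x: "x \<in> carr X'"
    obtain w where w: "w \<in> carr Z" "Q w = iso_inverse \<phi> X X' x" "vnorm Z w \<le> vnorm X (iso_inverse \<phi> X X' x)"
      using Q iso_inverse_carr[OF X X' \<phi> x] unfolding metric_surjection_def by blast
    show "\<exists>w\<in>carr Z'. transported \<zeta> Z Z' \<phi> Q w = x \<and> vnorm Z' w \<le> vnorm X' x"
      using w x iso_carr[OF Z Z' \<zeta> w(1)] iso_norm[OF Z Z' \<zeta> w(1)] transported_apply[OF Z Z' \<zeta> w(1), of \<phi> Q]
        iso_inverse_right[OF X X' \<phi> x] iso_norm[OF X' X isometric_isomorphism_inverse[OF X X' \<phi>] x]
      by (intro bexI[of _ "\<zeta> w"]) auto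
  qed
qed

section \<open>Operator ideals on spaces with copies\<close>

text \<open>Each axiom of an operator ideal on the spaces over \<open>'w\<close> yields the same property of
  \<open>ideal_on I\<close> on all spaces that have a copy over \<open>'w\<close>.\<close>

locale pietsch_ideal =
  fixes I :: "'w operator_class" and \<alpha> :: "'w operator_class_norm"
  assumes ideal: "normed_operator_ideal I \<alpha>"
begin

lemma ideal_bounded:
  assumes "complex_banach_space E" "complex_banach_space F" "T \<in> I E F"
  shows "T \<in> bounded_operators E F"
  using ideal assms unfolding normed_operator_ideal_def by blast

lemma ideal_normed:
  assumes "complex_banach_space E" "complex_banach_space F"
  shows "complex_normed_space (fun_space (carr E) F (I E F) (\<alpha> E F))"
  using ideal assms unfolding normed_operator_ideal_def by blast

lemma ideal_norm_nonneg:
  assumes "complex_banach_space E" "complex_banach_space F" "T \<in> I E F"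
  shows "0 \<le> \<alpha> E F T"
  using complex_normed_space.norm_nonneg[OF ideal_normed[OF assms(1,2)], of T] assms(3) by simp

lemma ideal_compose:
  assumes D: "complex_banach_space D" and E: "complex_banach_space E"
    and F: "complex_banach_space F" and G: "complex_banach_space G"
    and R: "R \<in> bounded_operators D E" and T: "T \<in> I E F" and S: "S \<in> bounded_operators F G"
    and r: "r \<ge> 0" "\<And>x. x \<in> carr D \<Longrightarrow> vnorm E (R x) \<le> r * vnorm D x"
    and s: "s \<ge> 0" "\<And>x. x \<in> carr F \<Longrightarrow> vnorm G (S x) \<le> s * vnorm F x"
  shows "(\<lambda>x\<in>carr D. S (T (R x))) \<in> I D G"
    and "\<alpha> D G (\<lambda>x\<in>carr D. S (T (R x))) \<le> s * \<alpha> E F T * r"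
proof -
  have eq: "compose (carr D) S (compose (carr D) T R) = (\<lambda>x\<in>carr D. S (T (R x)))"
    by (auto simp: compose_def intro!: restrict_ext)
  have *: "compose (carr D) S (compose (carr D) T R) \<in> I D G \<and>
      \<alpha> D G (compose (carr D) S (compose (carr D) T R))
         \<le> operator_norm F G S * \<alpha> E F T * operator_norm D E R"
    using ideal D E F G R T S unfolding normed_operator_ideal_def by blast
  then show "(\<lambda>x\<in>carr D. S (T (R x))) \<in> I D G"
    by (simp add: eq)
  have "operator_norm F G S * \<alpha> E F T * operator_norm D E R \<le> s * \<alpha> E F T * r"
    using r s operator_norm_least[of r D E R] operator_norm_least[of s F G S]
      operator_norm_nonneg[OF D[THEN banach_is_normed] E[THEN banach_is_normed] R]
      operator_norm_nonneg[OF F[THEN banach_is_normed] G[THEN banach_is_normed] S]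
      ideal_norm_nonneg[OF E F T]
    by (intro mult_mono) auto
  then show "\<alpha> D G (\<lambda>x\<in>carr D. S (T (R x))) \<le> s * \<alpha> E F T * r"
    using * by (simp add: eq)
qed

text \<open>Two copies of an operator differ by isometric isomorphisms on both sides, which have norm at most \<open>1\<close>.\<close>

lemma ideal_copy_le:
  assumes X: "complex_normed_space X" and Y: "complex_normed_space Y"
    and S: "S \<in> bounded_operators X Y"
    and c1: "operator_copy X Y S X1 Y1 S1" and c2: "operator_copy X Y S X2 Y2 S2"
    and "S1 \<in> I X1 Y1"
  shows "S2 \<in> I X2 Y2" and "\<alpha> X2 Y2 S2 \<le> \<alpha> X1 Y1 S1"
proof -
  obtain \<phi>1 \<psi>1 where 1: "isometric_isomorphism \<phi>1 X X1" "isometric_isomorphism \<psi>1 Y Y1"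
      "\<And>x. x \<in> carr X \<Longrightarrow> S1 (\<phi>1 x) = \<psi>1 (S x)"
    and B1: "complex_banach_space X1" "complex_banach_space Y1"
    using c1 unfolding operator_copy_def by blast
  obtain \<phi>2 \<psi>2 where 2: "isometric_isomorphism \<phi>2 X X2" "isometric_isomorphism \<psi>2 Y Y2"
      "\<And>x. x \<in> carr X \<Longrightarrow> S2 (\<phi>2 x) = \<psi>2 (S x)"
    and B2: "complex_banach_space X2" "complex_banach_space Y2" and S2: "S2 \<in> bounded_operators X2 Y2"
    using c2 unfolding operator_copy_def by blast
  note n = B1[THEN banach_is_normed] B2[THEN banach_is_normed]
  let ?k = "iso_inverse \<phi>2 X X2" and ?l = "iso_inverse \<psi>1 Y Y1"
  let ?R = "compose (carr X2) \<phi>1 ?k" and ?L = "compose (carr Y1) \<psi>2 ?l"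
  have k: "isometric_isomorphism ?k X2 X" and l: "isometric_isomorphism ?l Y1 Y"
    using isometric_isomorphism_inverse 1 2 X Y n by blast+
  have R: "isometric_isomorphism ?R X2 X1" and L: "isometric_isomorphism ?L Y1 Y2"
    using isometric_isomorphism_compose[OF n(3) X n(1) k 1(1)]
      isometric_isomorphism_compose[OF n(2) Y n(4) l 2(2)] .
  have eq: "(\<lambda>x\<in>carr X2. ?L (S1 (?R x))) = S2"
  proof (rule extensionalityI[of _ "carr X2"])
    fix x assume x: "x \<in> carr X2"
    have kx: "?k x \<in> carr X"
      by (rule iso_inverse_carr[OF X n(3) 2(1) x])
    have Skx: "S (?k x) \<in> carr Y"
      by (rule bounded_operators_carr[OF S kx])
    have "?L (S1 (?R x)) = \<psi>2 (S (?k x))"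
      using x kx Skx 1(3)[OF kx] iso_carr[OF Y n(2) 1(2) Skx] iso_inverse_left[OF Y n(2) 1(2) Skx]
      by (simp add: compose_def)
    also have "\<dots> = S2 x"
      using 2(3)[OF kx] iso_inverse_right[OF X n(3) 2(1) x] by simp
    finally show "(\<lambda>x\<in>carr X2. ?L (S1 (?R x))) x = S2 x"
      using x by simp
  qed (use bounded_operators_extensional[OF S2] in auto)
  note comp = ideal_compose[OF B2(1) B1(1) B1(2) B2(2) iso_operator[OF n(3) n(1) R] \<open>S1 \<in> I X1 Y1\<close>
      iso_operator[OF n(2) n(4) L], of 1 1]
  show "S2 \<in> I X2 Y2"
    using comp(1) iso_norm[OF n(3) n(1) R] iso_norm[OF n(2) n(4) L] unfolding eq by simp
  show "\<alpha> X2 Y2 S2 \<le> \<alpha> X1 Y1 S1"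
    using comp(2) iso_norm[OF n(3) n(1) R] iso_norm[OF n(2) n(4) L] unfolding eq by simp
qed

lemma ideal_on_copy:
  assumes X: "complex_normed_space X" and Y: "complex_normed_space Y"
    and S: "S \<in> bounded_operators X Y" and c: "operator_copy X Y S X' Y' S'"
  shows "S \<in> ideal_on I X Y \<longleftrightarrow> S' \<in> I X' Y'"
    and "S' \<in> I X' Y' \<Longrightarrow> ideal_norm_on \<alpha> X Y S = \<alpha> X' Y' S'"
proof -
  show "S \<in> ideal_on I X Y \<longleftrightarrow> S' \<in> I X' Y'"
    unfolding ideal_on_def using S c ideal_copy_le(1)[OF X Y S _ c] by blast
  assume S': "S' \<in> I X' Y'"
  show "ideal_norm_on \<alpha> X Y S = \<alpha> X' Y' S'"
    unfolding ideal_norm_on_def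
  proof (rule some_equality)
    show "\<exists>X1 Y1 S1. operator_copy X Y S X1 Y1 S1 \<and> \<alpha> X' Y' S' = \<alpha> X1 Y1 S1"
      using c by blast
    fix r assume "\<exists>X1 Y1 S1. operator_copy X Y S X1 Y1 S1 \<and> r = \<alpha> X1 Y1 S1"
    then obtain X1 Y1 S1 where 1: "operator_copy X Y S X1 Y1 S1" "r = \<alpha> X1 Y1 S1"
      by blast
    have "S1 \<in> I X1 Y1"
      by (rule ideal_copy_le(1)[OF X Y S c 1(1) S'])
    then show "r = \<alpha> X' Y' S'"
      using ideal_copy_le(2)[OF X Y S c 1(1) S'] ideal_copy_le(2)[OF X Y S 1(1) c] 1(2) by simp
  qed
qed

lemma ideal_on_bounded: "S \<in> ideal_on I X Y \<Longrightarrow> S \<in> bounded_operators X Y"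
  by (simp add: ideal_on_def)

lemma ideal_on_transported:
  assumes "complex_banach_space X" "complex_banach_space X'" "isometric_isomorphism \<phi> X X'"
    and "complex_banach_space Y" "complex_banach_space Y'" "isometric_isomorphism \<psi> Y Y'"
    and S: "S \<in> bounded_operators X Y"
  shows "S \<in> ideal_on I X Y \<longleftrightarrow> transported \<phi> X X' \<psi> S \<in> I X' Y'"
    and "S \<in> ideal_on I X Y \<Longrightarrow> ideal_norm_on \<alpha> X Y S = \<alpha> X' Y' (transported \<phi> X X' \<psi> S)"
  using ideal_on_copy[OF assms(1,4)[THEN banach_is_normed] S transported_copy[OF assms]] by auto

lemma ideal_on_normed:
  assumes X: "has_copy TYPE('w) X" and Y: "has_copy TYPE('w) Y"
  shows "complex_normed_space (fun_space (carr X) Y (ideal_on I X Y) (ideal_norm_on \<alpha> X Y))"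
proof -
  obtain X' :: "'w cspace" and \<phi> where X': "complex_banach_space X'" and \<phi>: "isometric_isomorphism \<phi> X X'"
    using X by (rule has_copyE)
  obtain Y' :: "'w cspace" and \<psi> where Y': "complex_banach_space Y'" and \<psi>: "isometric_isomorphism \<psi> Y Y'"
    using Y by (rule has_copyE)
  note tr = ideal_on_transported[OF has_copy_banach[OF X] X' \<phi> has_copy_banach[OF Y] Y' \<psi>]
  have nX: "complex_normed_space X" and nX': "complex_normed_space X'"
    and nY: "complex_normed_space Y" and nY': "complex_normed_space Y'"
    using X Y X' Y' by (simp_all add: has_copy_normed banach_is_normed)
  interpret X: complex_normed_space X by (rule nX)
  interpret Y: complex_normed_space Y by (rule nY)
  interpret Y': complex_normed_space Y' by (rule nY')
  let ?Z = "fun_space (carr X') Y' (I X' Y') (\<alpha> X' Y')"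
  interpret Z: complex_normed_space ?Z
    by (rule ideal_normed[OF X' Y'])
  let ?A = "ideal_on I X Y"
  let ?\<Theta> = "transported \<phi> X X' \<psi>"
  note \<psi>op = iso_operator[OF nY nY' \<psi>]
  note k = iso_inverse_carr[OF nX nX' \<phi>]
  have val: "S x \<in> carr Y" if "S \<in> ?A" "x \<in> carr X" for S x
    by (rule bounded_operators_carr[OF ideal_on_bounded[OF that(1)] that(2)])
  have \<Theta>: "?\<Theta> S \<in> carr ?Z" if "S \<in> ?A" for S
    using tr(1)[OF ideal_on_bounded[OF that]] that by simp
  have \<Theta>_add: "?\<Theta> (\<lambda>x\<in>carr X. vadd Y (S x) (T x)) = vadd ?Z (?\<Theta> S) (?\<Theta> T)"
    if "S \<in> ?A" "T \<in> ?A" for S T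
    using that k val by (auto simp: transported_def bounded_operators_add[OF \<psi>op] intro!: restrict_ext)
  have \<Theta>_scale: "?\<Theta> (\<lambda>x\<in>carr X. vscale Y c (S x)) = vscale ?Z c (?\<Theta> S)" if "S \<in> ?A" for S c
    using that k val by (auto simp: transported_def bounded_operators_scale[OF \<psi>op] intro!: restrict_ext)
  have \<Theta>_zero: "?\<Theta> (\<lambda>x\<in>carr X. vzero Y) = vzero ?Z"
    using k by (auto simp: transported_def bounded_operators_zero[OF nY nY' \<psi>op] intro!: restrict_ext)
  show ?thesis
  proof (rule fun_space_normed_pullback[OF nY Z.complex_normed_space_axioms, where \<Theta> = ?\<Theta>])
    show "?A \<subseteq> carr X \<rightarrow>\<^sub>E carr Y"
      by (auto dest!: ideal_on_bounded simp: bounded_operators_def)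
    show "(\<lambda>x\<in>carr X. vzero Y) \<in> ?A"
      using tr(1)[OF bounded_operators_zero_map[OF nX nY]] \<Theta>_zero Z.zero_closed by simp
    show "(\<lambda>x\<in>carr X. vadd Y (S x) (T x)) \<in> ?A" if "S \<in> ?A" "T \<in> ?A" for S T
      using tr(1)[OF bounded_operators_sum[OF nX nY that[THEN ideal_on_bounded]]] \<Theta>_add[OF that]
        Z.add_closed[OF that[THEN \<Theta>]] by simp
    show "(\<lambda>x\<in>carr X. vscale Y c (S x)) \<in> ?A" if "S \<in> ?A" for c S
      using tr(1)[OF bounded_operators_multiple[OF nX nY ideal_on_bounded[OF that]]] \<Theta>_scale[OF that]
        Z.scale_closed[OF \<Theta>[OF that]] by simp
    show "S = (\<lambda>x\<in>carr X. vzero Y)" if S: "S \<in> ?A" "?\<Theta> S = vzero ?Z" for S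
    proof (rule extensionalityI[of _ "carr X"])
      fix x assume x: "x \<in> carr X"
      have "\<psi> (S x) = ?\<Theta> S (\<phi> x)"
        using transported_apply[OF nX nX' \<phi> x, of \<psi> S] by simp
      also have "\<dots> = vzero Y'"
        using S(2) iso_carr[OF nX nX' \<phi> x] by simp
      finally have "vnorm Y (S x) = 0"
        using iso_norm[OF nY nY' \<psi> val[OF S(1) x]] Y'.norm_zero by simp
      then show "S x = (\<lambda>x\<in>carr X. vzero Y) x"
        using x val[OF S(1) x] Y.norm_eq_zero by simp
    qed (use bounded_operators_extensional[OF ideal_on_bounded[OF S(1)]] in auto)
    show "ideal_norm_on \<alpha> X Y S = vnorm ?Z (?\<Theta> S)" if "S \<in> ?A" for S
      using tr(2)[OF ideal_on_bounded[OF that] that] by simp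
  qed (fact \<Theta> \<Theta>_add \<Theta>_scale)+
qed

lemma ideal_on_compose:
  assumes D: "has_copy TYPE('w) D" and E: "has_copy TYPE('w) E"
    and F: "has_copy TYPE('w) F" and G: "has_copy TYPE('w) G"
    and R: "R \<in> bounded_operators D E" and T: "T \<in> ideal_on I E F" and S: "S \<in> bounded_operators F G"
    and r: "r \<ge> 0" "\<And>x. x \<in> carr D \<Longrightarrow> vnorm E (R x) \<le> r * vnorm D x"
    and s: "s \<ge> 0" "\<And>x. x \<in> carr F \<Longrightarrow> vnorm G (S x) \<le> s * vnorm F x"
  shows "(\<lambda>x\<in>carr D. S (T (R x))) \<in> ideal_on I D G"
    and "ideal_norm_on \<alpha> D G (\<lambda>x\<in>carr D. S (T (R x))) \<le> s * ideal_norm_on \<alpha> E F T * r"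
proof -
  obtain D' :: "'w cspace" and d where D': "complex_banach_space D'" and d: "isometric_isomorphism d D D'"
    using D by (rule has_copyE)
  obtain E' :: "'w cspace" and e where E': "complex_banach_space E'" and e: "isometric_isomorphism e E E'"
    using E by (rule has_copyE)
  obtain F' :: "'w cspace" and f where F': "complex_banach_space F'" and f: "isometric_isomorphism f F F'"
    using F by (rule has_copyE)
  obtain G' :: "'w cspace" and g where G': "complex_banach_space G'" and g: "isometric_isomorphism g G G'"
    using G by (rule has_copyE)
  note b = D[THEN has_copy_banach] E[THEN has_copy_banach] F[THEN has_copy_banach] G[THEN has_copy_banach]
  note n = b[THEN banach_is_normed]
  note n' = D'[THEN banach_is_normed] E'[THEN banach_is_normed] F'[THEN banach_is_normed] G'[THEN banach_is_normed]
  have Top: "T \<in> bounded_operators E F"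
    by (rule ideal_on_bounded[OF T])
  let ?P = "\<lambda>x\<in>carr D. S (T (R x))"
  have P: "?P \<in> bounded_operators D G"
    using bounded_operators_compose[OF n(1) n(2) n(4) R bounded_operators_compose[OF n(2) n(3) n(4) Top S]]
      bounded_operators_carr[OF R]
    by (simp add: compose_def cong: restrict_cong)
  let ?R = "transported d D D' e R" and ?T = "transported e E E' f T" and ?S = "transported f F F' g S"
  have T': "?T \<in> I E' F'" and norm_T: "ideal_norm_on \<alpha> E F T = \<alpha> E' F' ?T"
    using ideal_on_transported[OF b(2) E' e b(3) F' f Top] T by auto
  have eq: "(\<lambda>x\<in>carr D'. ?S (?T (?R x))) = transported d D D' g ?P"
  proof (rule extensionalityI[of _ "carr D'"])
    fix x assume x: "x \<in> carr D'"
    let ?y = "iso_inverse d D D' x"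
    have y: "?y \<in> carr D" "d ?y = x"
      using iso_inverse_carr[OF n(1) n'(1) d x] iso_inverse_right[OF n(1) n'(1) d x] .
    have "?R x = e (R ?y)"
      using x by (simp add: transported_def)
    moreover have Ry: "R ?y \<in> carr E"
      by (rule bounded_operators_carr[OF R y(1)])
    ultimately show "(\<lambda>x\<in>carr D'. ?S (?T (?R x))) x = transported d D D' g ?P x"
      using x y transported_apply[OF n(2) n'(2) e Ry, of f T]
        transported_apply[OF n(3) n'(3) f bounded_operators_carr[OF Top Ry], of g S]
        transported_apply[OF n(1) n'(1) d y(1), of g ?P] by simp
  qed (simp_all add: transported_def)
  have R': "?R \<in> bounded_operators D' E'" and S': "?S \<in> bounded_operators F' G'"
    by (rule transported_operator[OF n(1) n'(1) d n(2) n'(2) e R]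
        transported_operator[OF n(3) n'(3) f n(4) n'(4) g S])+
  have r': "vnorm E' (?R x) \<le> r * vnorm D' x" if x: "x \<in> carr D'" for x
  proof -
    note y = iso_inverse_carr[OF n(1) n'(1) d x]
    show ?thesis
      using r(2)[OF y] x iso_norm[OF n(2) n'(2) e bounded_operators_carr[OF R y]]
        iso_norm[OF n'(1) n(1) isometric_isomorphism_inverse[OF n(1) n'(1) d] x]
      by (simp add: transported_def)
  qed
  have s': "vnorm G' (?S x) \<le> s * vnorm F' x" if x: "x \<in> carr F'" for x
  proof -
    note y = iso_inverse_carr[OF n(3) n'(3) f x]
    show ?thesis
      using s(2)[OF y] x iso_norm[OF n(4) n'(4) g bounded_operators_carr[OF S y]]
        iso_norm[OF n'(3) n(3) isometric_isomorphism_inverse[OF n(3) n'(3) f] x]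
      by (simp add: transported_def)
  qed
  note comp = ideal_compose[OF D' E' F' G' R' T' S' r(1) r' s(1) s', unfolded eq]
  note tr = ideal_on_transported[OF b(1) D' d b(4) G' g P]
  show "?P \<in> ideal_on I D G"
    using tr comp by simp
  then show "ideal_norm_on \<alpha> D G ?P \<le> s * ideal_norm_on \<alpha> E F T * r"
    using tr comp norm_T by simp
qed

lemma ideal_on_scalar_identity:
  assumes C: "has_copy TYPE('w) complex_line"
  shows "(\<lambda>x. x) \<in> ideal_on I complex_line complex_line"
    and "ideal_norm_on \<alpha> complex_line complex_line (\<lambda>x. x) = 1"
proof -
  obtain K :: "'w cspace" and \<phi> where K: "complex_banach_space K" and \<phi>: "isometric_isomorphism \<phi> complex_line K"
    using C by (rule has_copyE)
  note n = complex_normed_space_complex_line banach_is_normed[OF K]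
  have "isometric_isomorphism (iso_inverse \<phi> complex_line K) K complex_line"
    by (rule isometric_isomorphism_inverse[OF n \<phi>])
  then have id: "(\<lambda>x\<in>carr K. x) \<in> I K K" "\<alpha> K K (\<lambda>x\<in>carr K. x) = 1"
    using ideal K unfolding normed_operator_ideal_def by blast+
  have eq: "transported \<phi> complex_line K \<phi> (\<lambda>x. x) = (\<lambda>x\<in>carr K. x)"
    by (auto simp: transported_def iso_inverse_right[OF n \<phi>] intro!: restrict_ext)
  have op: "(\<lambda>x. x) \<in> bounded_operators complex_line complex_line"
    by (rule bounded_operatorsI[where C = 1]) auto
  note tr = ideal_on_transported[OF complex_banach_space_complex_line K \<phi>
      complex_banach_space_complex_line K \<phi> op, unfolded eq]
  show "(\<lambda>x. x) \<in> ideal_on I complex_line complex_line"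
    using tr id by simp
  then show "ideal_norm_on \<alpha> complex_line complex_line (\<lambda>x. x) = 1"
    using tr id by simp
qed

lemma ideal_on_injective:
  assumes injective: "injective_operator_ideal I \<alpha>"
    and E: "has_copy TYPE('w) E" and F: "has_copy TYPE('w) F" and G: "has_copy TYPE('w) G"
    and j: "isometric_embedding j F G" and T: "T \<in> bounded_operators E F"
    and jT: "compose (carr E) j T \<in> ideal_on I E G"
  shows "T \<in> ideal_on I E F"
    and "ideal_norm_on \<alpha> E F T = ideal_norm_on \<alpha> E G (compose (carr E) j T)"
proof -
  obtain E' :: "'w cspace" and e where E': "complex_banach_space E'" and e: "isometric_isomorphism e E E'"
    using E by (rule has_copyE)
  obtain F' :: "'w cspace" and f where F': "complex_banach_space F'" and f: "isometric_isomorphism f F F'"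
    using F by (rule has_copyE)
  obtain G' :: "'w cspace" and g where G': "complex_banach_space G'" and g: "isometric_isomorphism g G G'"
    using G by (rule has_copyE)
  note b = E[THEN has_copy_banach] F[THEN has_copy_banach] G[THEN has_copy_banach]
  note n = b[THEN banach_is_normed]
  note n' = E'[THEN banach_is_normed] F'[THEN banach_is_normed] G'[THEN banach_is_normed]
  let ?T = "transported e E E' f T" and ?j = "transported f F F' g j"
  have jop: "j \<in> bounded_operators F G" and jnorm: "\<And>x. x \<in> carr F \<Longrightarrow> vnorm G (j x) = vnorm F x"
    using j by (simp_all add: isometric_embedding_def)
  have T': "?T \<in> bounded_operators E' F'"
    by (rule transported_operator[OF n(1) n'(1) e n(2) n'(2) f T])
  have j': "isometric_embedding ?j F' G'"
    unfolding isometric_embedding_def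
  proof (intro conjI ballI)
    show "?j \<in> bounded_operators F' G'"
      by (rule transported_operator[OF n(2) n'(2) f n(3) n'(3) g jop])
    fix x assume x: "x \<in> carr F'"
    note y = iso_inverse_carr[OF n(2) n'(2) f x]
    show "vnorm G' (?j x) = vnorm F' x"
      using x iso_norm[OF n(3) n'(3) g bounded_operators_carr[OF jop y]] jnorm[OF y]
        iso_norm[OF n'(2) n(2) isometric_isomorphism_inverse[OF n(2) n'(2) f] x]
      by (simp add: transported_def)
  qed
  have eq: "compose (carr E') ?j ?T = transported e E E' g (compose (carr E) j T)"
  proof (rule extensionalityI[of _ "carr E'"])
    fix x assume x: "x \<in> carr E'"
    let ?y = "iso_inverse e E E' x"
    have y: "?y \<in> carr E"
      by (rule iso_inverse_carr[OF n(1) n'(1) e x])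
    show "compose (carr E') ?j ?T x = transported e E E' g (compose (carr E) j T) x"
      using x y transported_apply[OF n(2) n'(2) f bounded_operators_carr[OF T y], of g j]
      by (simp add: compose_def) (simp add: transported_def)
  qed (simp_all add: transported_def compose_def)
  have jTop: "compose (carr E) j T \<in> bounded_operators E G"
    by (rule ideal_on_bounded[OF jT])
  note tr = ideal_on_transported[OF b(1) E' e b(3) G' g jTop, folded eq]
  have inj: "?T \<in> I E' F' \<and> \<alpha> E' F' ?T = \<alpha> E' G' (compose (carr E') ?j ?T)"
    using injective E' F' G' j' T' tr(1) jT unfolding injective_operator_ideal_def by blast
  note tr' = ideal_on_transported[OF b(1) E' e b(2) F' f T]
  show "T \<in> ideal_on I E F"
    using tr'(1) inj by simp
  then show "ideal_norm_on \<alpha> E F T = ideal_norm_on \<alpha> E G (compose (carr E) j T)"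
    using tr'(2) inj tr(2) jT by simp
qed

text \<open>Complete symmetry speaks of spaces over \<open>'w\<close> whose duals have copies. The copies of a space
  inherit this property from the dual of the space itself.\<close>

lemma has_dual_copy_of_copy:
  assumes X: "complex_normed_space X" and X': "complex_banach_space (X' :: 'w cspace)"
    and \<phi>: "isometric_isomorphism \<phi> X X'" and D: "has_copy TYPE('w) (dual_space X)"
  shows "has_copy TYPE('w) (dual_space X')" "has_dual_copy X'"
proof -
  show "has_copy TYPE('w) (dual_space X')"
    using has_copy_iso[OF D complex_banach_space_dual
        adjoint_of_isometric_isomorphism[OF X banach_is_normed[OF X'] \<phi>]] banach_is_normed[OF X'] by blast
  then show "has_dual_copy X'"
    by (simp add: has_copy_def has_dual_copy_def)
qed

text \<open>In copies, \<open>(S \<circ> Q)\<^sup>* = Q\<^sup>* \<circ> S\<^sup>*\<close> belongs to the ideal by complete symmetry. The adjoint \<open>Q\<^sup>*\<close> of a metric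
  surjection is an isometric embedding, so injectivity gives \<open>S\<^sup>*\<close>, and complete symmetry gives \<open>S\<close>.\<close>

theorem ideal_on_surjective:
  assumes injective: "injective_operator_ideal I \<alpha>" and symmetric: "completely_symmetric I \<alpha>"
    and Z: "has_copy TYPE('w) Z" "has_copy TYPE('w) (dual_space Z)"
    and X: "has_copy TYPE('w) X" "has_copy TYPE('w) (dual_space X)"
    and Y: "has_copy TYPE('w) Y" "has_copy TYPE('w) (dual_space Y)"
    and Q: "metric_surjection Q Z X" and S: "S \<in> bounded_operators X Y"
    and SQ: "compose (carr Z) S Q \<in> ideal_on I Z Y"
  shows "S \<in> ideal_on I X Y"
    and "ideal_norm_on \<alpha> X Y S = ideal_norm_on \<alpha> Z Y (compose (carr Z) S Q)"
proof -
  obtain Z' :: "'w cspace" and \<zeta> where Z': "complex_banach_space Z'" and \<zeta>: "isometric_isomorphism \<zeta> Z Z'"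
    using Z(1) by (rule has_copyE)
  obtain X' :: "'w cspace" and \<phi> where X': "complex_banach_space X'" and \<phi>: "isometric_isomorphism \<phi> X X'"
    using X(1) by (rule has_copyE)
  obtain Y' :: "'w cspace" and \<psi> where Y': "complex_banach_space Y'" and \<psi>: "isometric_isomorphism \<psi> Y Y'"
    using Y(1) by (rule has_copyE)
  note b = Z(1)[THEN has_copy_banach] X(1)[THEN has_copy_banach] Y(1)[THEN has_copy_banach]
  note n = b[THEN banach_is_normed]
  note n' = Z'[THEN banach_is_normed] X'[THEN banach_is_normed] Y'[THEN banach_is_normed]
  let ?Q = "transported \<zeta> Z Z' \<phi> Q" and ?S = "transported \<phi> X X' \<psi> S"
  let ?P = "transported \<zeta> Z Z' \<psi> (compose (carr Z) S Q)"
  have Q': "metric_surjection ?Q Z' X'"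
    by (rule metric_surjection_compose_iso[OF n'(1) n(1) n(2) n'(2) Q \<zeta> \<phi>])
  have Qop: "Q \<in> bounded_operators Z X" and Qop': "?Q \<in> bounded_operators Z' X'"
    using Q Q' by (simp_all add: metric_surjection_def)
  have S': "?S \<in> bounded_operators X' Y'"
    by (rule transported_operator[OF n(2) n'(2) \<phi> n(3) n'(3) \<psi> S])
  have P: "?P \<in> I Z' Y'" and norm_P: "ideal_norm_on \<alpha> Z Y (compose (carr Z) S Q) = \<alpha> Z' Y' ?P"
    using ideal_on_transported[OF b(1) Z' \<zeta> b(3) Y' \<psi> ideal_on_bounded[OF SQ]] SQ by auto
  have P_eq: "?P = compose (carr Z') ?S ?Q"
  proof (rule extensionalityI[of _ "carr Z'"])
    fix x assume x: "x \<in> carr Z'"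
    let ?y = "iso_inverse \<zeta> Z Z' x"
    have y: "?y \<in> carr Z"
      by (rule iso_inverse_carr[OF n(1) n'(1) \<zeta> x])
    show "?P x = compose (carr Z') ?S ?Q x"
      using x y transported_apply[OF n(2) n'(2) \<phi> bounded_operators_carr[OF Qop y], of \<psi> S]
      by (simp add: compose_def) (simp add: transported_def)
  qed (simp_all add: transported_def compose_def)
  note dualZ = has_dual_copy_of_copy[OF n(1) Z' \<zeta> Z(2)]
  note dualX = has_dual_copy_of_copy[OF n(2) X' \<phi> X(2)]
  note dualY = has_dual_copy_of_copy[OF n(3) Y' \<psi> Y(2)]
  let ?aS = "adjoint_operator X' Y' ?S" and ?aQ = "adjoint_operator Z' X' ?Q" and ?aP = "adjoint_operator Z' Y' ?P"
  have aS: "?aS \<in> bounded_operators (dual_space Y') (dual_space X')"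
    by (rule adjoint_operator_bounded[OF n'(2) n'(3) S'])
  have aP: "?aP \<in> ideal_on I (dual_space Y') (dual_space Z')"
    and norm_aP: "\<alpha> Z' Y' ?P = ideal_norm_on \<alpha> (dual_space Y') (dual_space Z') ?aP"
    using symmetric Z' Y' dualZ(2) dualY(2) P
    unfolding completely_symmetric_def dual_ideal_def dual_ideal_norm_def by blast+
  have aP_eq: "?aP = compose (carr (dual_space Y')) ?aQ ?aS"
  proof (rule extensionalityI[of _ "carr (dual_space Y')"])
    fix \<eta> assume "\<eta> \<in> carr (dual_space Y')"
    then have \<eta>: "\<eta> \<in> bounded_operators Y' complex_line"
      by simp
    have aS\<eta>: "?aS \<eta> \<in> bounded_operators X' complex_line"
      using bounded_operators_carr[OF aS] \<eta> by simp
    have "?aP \<eta> = (\<lambda>x\<in>carr Z'. \<eta> (?S (?Q x)))"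
      using adjoint_apply[OF n'(1) n'(3) ideal_bounded[OF Z' Y' P] \<eta>]
      by (simp only: P_eq) (intro restrict_ext, simp only: compose_eq)
    also have "\<dots> = ?aQ (?aS \<eta>)"
      using adjoint_apply[OF n'(1) n'(2) Qop' aS\<eta>] adjoint_apply[OF n'(2) n'(3) S' \<eta>]
        bounded_operators_carr[OF Qop'] by (simp cong: restrict_cong)
    finally show "?aP \<eta> = compose (carr (dual_space Y')) ?aQ ?aS \<eta>"
      using \<eta> by (simp add: compose_def)
  qed (simp_all add: adjoint_operator_def compose_def)
  note inj = ideal_on_injective[OF injective dualY(1) dualX(1) dualZ(1)
      adjoint_of_metric_surjection[OF n'(1) n'(2) Q'] aS, folded aP_eq, OF aP]
  have "?S \<in> dual_ideal I X' Y'"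
    using S' inj(1) by (simp add: dual_ideal_def)
  moreover have "I X' Y' = dual_ideal I X' Y'"
    and norm: "\<forall>T\<in>I X' Y'. \<alpha> X' Y' T = dual_ideal_norm \<alpha> X' Y' T"
    using symmetric X' Y' dualX(2) dualY(2) unfolding completely_symmetric_def by blast+
  ultimately have S'I: "?S \<in> I X' Y'"
    by simp
  have "\<alpha> X' Y' ?S = \<alpha> Z' Y' ?P"
    using norm S'I inj(2) norm_aP by (simp add: dual_ideal_norm_def)
  moreover note tr = ideal_on_transported[OF b(2) X' \<phi> b(3) Y' \<psi> S]
  ultimately show "ideal_norm_on \<alpha> X Y S = ideal_norm_on \<alpha> Z Y (compose (carr Z) S Q)"
    using S'I norm_P by simp
  show "S \<in> ideal_on I X Y"
    using tr S'I by simp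
qed

end

section \<open>Holomorphic maps\<close>

text \<open>Complex differentiability at a point with its derivative named, since the rules for sums,
  compositions and limits produce the derivative explicitly.\<close>

definition frechet_at ::
    "'a cspace \<Rightarrow> 'a set \<Rightarrow> 'b cspace \<Rightarrow> ('a \<Rightarrow> 'b) \<Rightarrow> 'a \<Rightarrow> ('a \<Rightarrow> 'b) \<Rightarrow> bool" where
  "frechet_at E U F f a D \<longleftrightarrow> D \<in> bounded_operators E F \<and>
     (\<forall>\<epsilon>>0. \<exists>\<delta>>0. \<forall>x\<in>U. vnorm E (vminus E x a) < \<delta> \<longrightarrow>
       vnorm F (vminus F (vminus F (f x) (f a)) (D (vminus E x a))) \<le> \<epsilon> * vnorm E (vminus E x a))"

lemma holomorphic_maps_iff:
  "f \<in> holomorphic_maps E U F \<longleftrightarrow> f \<in> U \<rightarrow>\<^sub>E carr F \<and> (\<forall>a\<in>U. \<exists>D. frechet_at E U F f a D)"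
  unfolding holomorphic_maps_def frechet_at_def by blast

lemma frechet_at_operator: "frechet_at E U F f a D \<Longrightarrow> D \<in> bounded_operators E F"
  by (simp add: frechet_at_def)

lemma frechet_atD:
  assumes "frechet_at E U F f a D" "\<epsilon> > 0"
  obtains \<delta> where "\<delta> > 0" "\<And>x. x \<in> U \<Longrightarrow> vnorm E (vminus E x a) < \<delta> \<Longrightarrow>
       vnorm F (vminus F (vminus F (f x) (f a)) (D (vminus E x a))) \<le> \<epsilon> * vnorm E (vminus E x a)"
  using assms unfolding frechet_at_def by blast

lemma holomorphic_maps_carr: "f \<in> holomorphic_maps E U F \<Longrightarrow> x \<in> U \<Longrightarrow> f x \<in> carr F"
  by (auto simp: holomorphic_maps_iff)

lemma holomorphic_maps_extensional: "f \<in> holomorphic_maps E U F \<Longrightarrow> f \<in> extensional U"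
  by (auto simp: holomorphic_maps_iff PiE_def)

lemma holomorphic_maps_zero:
  assumes "complex_normed_space E" "complex_normed_space F" and U: "U \<subseteq> carr E"
  shows "(\<lambda>x\<in>U. vzero F) \<in> holomorphic_maps E U F"
proof -
  interpret E: complex_normed_space E by (rule assms)
  interpret F: complex_normed_space F by (rule assms)
  have "frechet_at E U F (\<lambda>x\<in>U. vzero F) a (\<lambda>x\<in>carr E. vzero F)" if a: "a \<in> U" for a
    unfolding frechet_at_def
  proof (intro conjI allI impI)
    fix \<epsilon> :: real assume "\<epsilon> > 0"
    then show "\<exists>\<delta>>0. \<forall>x\<in>U. vnorm E (vminus E x a) < \<delta> \<longrightarrow>
       vnorm F (vminus F (vminus F ((\<lambda>x\<in>U. vzero F) x) ((\<lambda>x\<in>U. vzero F) a))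
         ((\<lambda>x\<in>carr E. vzero F) (vminus E x a))) \<le> \<epsilon> * vnorm E (vminus E x a)"
      using a U by (intro exI[of _ 1]) (auto simp: F.minus_self F.closed F.norm_zero E.closed E.norm_nonneg subset_iff)
  qed (rule bounded_operators_zero_map[OF assms(1,2)])
  then show ?thesis
    unfolding holomorphic_maps_iff by (auto simp: F.closed)
qed

lemma holomorphic_maps_add:
  assumes "complex_normed_space E" "complex_normed_space F" and U: "U \<subseteq> carr E"
    and f: "f \<in> holomorphic_maps E U F" and g: "g \<in> holomorphic_maps E U F"
  shows "(\<lambda>x\<in>U. vadd F (f x) (g x)) \<in> holomorphic_maps E U F"
proof -
  interpret E: complex_normed_space E by (rule assms)
  interpret F: complex_normed_space F by (rule assms)
  note fF = holomorphic_maps_carr[OF f] and gF = holomorphic_maps_carr[OF g]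
  let ?h = "\<lambda>x\<in>U. vadd F (f x) (g x)"
  have "\<exists>D. frechet_at E U F ?h a D" if a: "a \<in> U" for a
  proof -
    obtain D1 D2 where D1: "frechet_at E U F f a D1" and D2: "frechet_at E U F g a D2"
      using f g a unfolding holomorphic_maps_iff by blast
    note op1 = frechet_at_operator[OF D1] and op2 = frechet_at_operator[OF D2]
    let ?D = "\<lambda>x\<in>carr E. vadd F (D1 x) (D2 x)"
    have "frechet_at E U F ?h a ?D"
      unfolding frechet_at_def
    proof (intro conjI allI impI)
      show "?D \<in> bounded_operators E F"
        by (rule bounded_operators_sum[OF assms(1,2) op1 op2])
      fix \<epsilon> :: real assume "\<epsilon> > 0"
      then have "\<epsilon> / 2 > 0"
        by simp
      obtain \<delta>1 where \<delta>1: "\<delta>1 > 0" "\<And>x. x \<in> U \<Longrightarrow> vnorm E (vminus E x a) < \<delta>1 \<Longrightarrow>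
        vnorm F (vminus F (vminus F (f x) (f a)) (D1 (vminus E x a))) \<le> \<epsilon> / 2 * vnorm E (vminus E x a)"
        using frechet_atD[OF D1 \<open>\<epsilon> / 2 > 0\<close>] by blast
      obtain \<delta>2 where \<delta>2: "\<delta>2 > 0" "\<And>x. x \<in> U \<Longrightarrow> vnorm E (vminus E x a) < \<delta>2 \<Longrightarrow>
        vnorm F (vminus F (vminus F (g x) (g a)) (D2 (vminus E x a))) \<le> \<epsilon> / 2 * vnorm E (vminus E x a)"
        using frechet_atD[OF D2 \<open>\<epsilon> / 2 > 0\<close>] by blast
      show "\<exists>\<delta>>0. \<forall>x\<in>U. vnorm E (vminus E x a) < \<delta> \<longrightarrow>
        vnorm F (vminus F (vminus F (?h x) (?h a)) (?D (vminus E x a))) \<le> \<epsilon> * vnorm E (vminus E x a)"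
      proof (intro exI[of _ "min \<delta>1 \<delta>2"] conjI ballI impI)
        fix x assume x: "x \<in> U" and "vnorm E (vminus E x a) < min \<delta>1 \<delta>2"
        then have le: "vnorm F (vminus F (vminus F (f x) (f a)) (D1 (vminus E x a))) \<le> \<epsilon> / 2 * vnorm E (vminus E x a)"
          "vnorm F (vminus F (vminus F (g x) (g a)) (D2 (vminus E x a))) \<le> \<epsilon> / 2 * vnorm E (vminus E x a)"
          using \<delta>1(2)[OF x] \<delta>2(2)[OF x] by auto
        have xa: "vminus E x a \<in> carr E"
          using x a U by (auto intro: E.closed)
        note D1x = bounded_operators_carr[OF op1 xa] and D2x = bounded_operators_carr[OF op2 xa]
        let ?p = "vminus F (vminus F (f x) (f a)) (D1 (vminus E x a))"
        let ?q = "vminus F (vminus F (g x) (g a)) (D2 (vminus E x a))"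
        have "vminus F (vminus F (?h x) (?h a)) (?D (vminus E x a)) = vadd F ?p ?q"
          using x a xa D1x D2x by (simp add: F.add_minus_add fF gF F.closed)
        moreover have "vnorm F (vadd F ?p ?q) \<le> vnorm F ?p + vnorm F ?q"
          using x a D1x D2x by (intro F.norm_triangle F.closed fF gF)
        ultimately show "vnorm F (vminus F (vminus F (?h x) (?h a)) (?D (vminus E x a))) \<le> \<epsilon> * vnorm E (vminus E x a)"
          using le by simp
      qed (use \<delta>1 \<delta>2 in auto)
    qed
    then show ?thesis
      by blast
  qed
  then show ?thesis
    unfolding holomorphic_maps_iff using fF gF by (auto simp: F.closed)
qed

lemma holomorphic_maps_operator:
  assumes "complex_normed_space E" "complex_normed_space F" and T: "T \<in> bounded_operators E F"
  shows "T \<in> holomorphic_maps E (carr E) F"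
proof -
  interpret E: complex_normed_space E by (rule assms)
  interpret F: complex_normed_space F by (rule assms)
  note TF = bounded_operators_carr[OF T]
  have "frechet_at E (carr E) F T a T" if a: "a \<in> carr E" for a
    unfolding frechet_at_def
  proof (intro conjI allI impI T)
    fix \<epsilon> :: real assume "\<epsilon> > 0"
    then show "\<exists>\<delta>>0. \<forall>x\<in>carr E. vnorm E (vminus E x a) < \<delta> \<longrightarrow>
       vnorm F (vminus F (vminus F (T x) (T a)) (T (vminus E x a))) \<le> \<epsilon> * vnorm E (vminus E x a)"
      using a by (intro exI[of _ 1])
        (simp add: bounded_operators_minus[OF assms(1) T] F.minus_self F.closed TF F.norm_zero E.closed E.norm_nonneg)
  qed
  moreover have "T \<in> carr E \<rightarrow>\<^sub>E carr F"
    using T by (simp add: bounded_operators_def)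
  ultimately show ?thesis
    unfolding holomorphic_maps_iff by blast
qed

lemma holomorphic_maps_compose:
  assumes "complex_normed_space D" "complex_normed_space E" "complex_normed_space F"
    and V: "V \<subseteq> carr D" and U: "U \<subseteq> carr E"
    and h: "h \<in> holomorphic_maps D V E" and hV: "h ` V \<subseteq> U" and f: "f \<in> holomorphic_maps E U F"
  shows "(\<lambda>x\<in>V. f (h x)) \<in> holomorphic_maps D V F"
proof -
  interpret D: complex_normed_space D by (rule assms)
  interpret E: complex_normed_space E by (rule assms)
  interpret F: complex_normed_space F by (rule assms)
  have hU: "h x \<in> U" if "x \<in> V" for x
    using hV that by auto
  note hE = holomorphic_maps_carr[OF h] and fF = holomorphic_maps_carr[OF f]
  let ?g = "\<lambda>x\<in>V. f (h x)"
  have "\<exists>L. frechet_at D V F ?g a L" if a: "a \<in> V" for a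
  proof -
    obtain H where H: "frechet_at D V E h a H"
      using h a unfolding holomorphic_maps_iff by blast
    obtain L where L: "frechet_at E U F f (h a) L"
      using f hU[OF a] unfolding holomorphic_maps_iff by blast
    note opH = frechet_at_operator[OF H] and opL = frechet_at_operator[OF L]
    obtain c where c: "c \<ge> 0" "\<And>x. x \<in> carr D \<Longrightarrow> vnorm E (H x) \<le> c * vnorm D x"
      using bounded_operators_bound[OF assms(1) opH] by blast
    obtain l where l: "l \<ge> 0" "\<And>x. x \<in> carr E \<Longrightarrow> vnorm F (L x) \<le> l * vnorm E x"
      using bounded_operators_bound[OF assms(2) opL] by blast
    let ?D = "compose (carr D) L H"
    have "frechet_at D V F ?g a ?D"
      unfolding frechet_at_def
    proof (intro conjI allI impI)
      show "?D \<in> bounded_operators D F"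
        by (rule bounded_operators_compose[OF assms(1-3) opH opL])
      fix \<epsilon> :: real assume \<epsilon>: "\<epsilon> > 0"
      \<comment> \<open>The remainder of \<open>f \<circ> h\<close> is the remainder of \<open>f\<close> from \<open>h a\<close> to \<open>h x\<close>, controlled by \<open>\<epsilon>1\<close>, plus the derivative
        of \<open>f\<close> applied to the remainder of \<open>h\<close>, controlled by \<open>\<epsilon>2\<close>. The bound \<open>\<epsilon>2 \<le> 1\<close> makes \<open>h\<close> Lipschitz at
        \<open>a\<close> with constant \<open>c + 1\<close>.\<close>
      define \<epsilon>1 where "\<epsilon>1 = \<epsilon> / (2 * (c + 1))"
      define \<epsilon>2 where "\<epsilon>2 = min 1 (\<epsilon> / (2 * (l + 1)))"
      have pos: "\<epsilon>1 > 0" "\<epsilon>2 > 0" "\<epsilon>2 \<le> 1"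
        using \<epsilon> c l by (simp_all add: \<epsilon>1_def \<epsilon>2_def)
      have \<epsilon>1: "\<epsilon>1 * (c + 1) = \<epsilon> / 2"
        using c(1) by (simp add: \<epsilon>1_def field_simps)
      have "l * \<epsilon>2 \<le> (l + 1) * (\<epsilon> / (2 * (l + 1)))"
        using l pos by (intro mult_mono) (auto simp: \<epsilon>2_def)
      also have "\<dots> = \<epsilon> / 2"
        using l(1) by (simp add: field_simps)
      finally have \<epsilon>2: "l * \<epsilon>2 \<le> \<epsilon> / 2" .
      obtain \<delta>1 where \<delta>1: "\<delta>1 > 0" "\<And>y. y \<in> U \<Longrightarrow> vnorm E (vminus E y (h a)) < \<delta>1 \<Longrightarrow>
        vnorm F (vminus F (vminus F (f y) (f (h a))) (L (vminus E y (h a)))) \<le> \<epsilon>1 * vnorm E (vminus E y (h a))"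
        using frechet_atD[OF L pos(1)] by blast
      obtain \<delta>2 where \<delta>2: "\<delta>2 > 0" "\<And>x. x \<in> V \<Longrightarrow> vnorm D (vminus D x a) < \<delta>2 \<Longrightarrow>
        vnorm E (vminus E (vminus E (h x) (h a)) (H (vminus D x a))) \<le> \<epsilon>2 * vnorm D (vminus D x a)"
        using frechet_atD[OF H pos(2)] by blast
      show "\<exists>\<delta>>0. \<forall>x\<in>V. vnorm D (vminus D x a) < \<delta> \<longrightarrow>
        vnorm F (vminus F (vminus F (?g x) (?g a)) (?D (vminus D x a))) \<le> \<epsilon> * vnorm D (vminus D x a)"
      proof (intro exI[of _ "min \<delta>2 (\<delta>1 / (c + 1))"] conjI ballI impI)
        show "0 < min \<delta>2 (\<delta>1 / (c + 1))"
          using \<delta>1 \<delta>2 c by simp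
        fix x assume x: "x \<in> V" and near: "vnorm D (vminus D x a) < min \<delta>2 (\<delta>1 / (c + 1))"
        let ?n = "vnorm D (vminus D x a)"
        let ?w = "vminus E (h x) (h a)"
        have xa: "vminus D x a \<in> carr D"
          using x a V by (auto intro: D.closed)
        have nn: "?n \<ge> 0"
          by (rule D.norm_nonneg[OF xa])
        have w: "?w \<in> carr E"
          using x a hE by (intro E.closed)
        note Hx = bounded_operators_carr[OF opH xa]
        let ?q = "vminus E ?w (H (vminus D x a))"
        have q: "?q \<in> carr E" "vnorm E ?q \<le> \<epsilon>2 * ?n"
          using near \<delta>2(2)[OF x] w Hx by (auto intro: E.closed)
        have "vnorm E ?w \<le> vnorm E ?q + vnorm E (H (vminus D x a))"
          by (rule E.norm_le_minus_add[OF w Hx])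
        also have "\<dots> \<le> 1 * ?n + c * ?n"
          using q(2) c(2)[OF xa] mult_right_mono[OF pos(3) nn] by linarith
        finally have wn: "vnorm E ?w \<le> (c + 1) * ?n"
          by (simp add: distrib_right)
        have "(c + 1) * ?n < \<delta>1"
          using near c by (simp add: pos_less_divide_eq mult.commute)
        then have small: "vnorm E ?w < \<delta>1"
          using wn by simp
        let ?p = "vminus F (vminus F (f (h x)) (f (h a))) (L ?w)"
        have fx: "f (h x) \<in> carr F" "f (h a) \<in> carr F"
          using x a hU fF by auto
        have "vnorm F ?p \<le> \<epsilon>1 * vnorm E ?w"
          using \<delta>1(2)[OF hU[OF x] small] .
        also have "\<dots> \<le> \<epsilon>1 * ((c + 1) * ?n)"
          using wn pos by (intro mult_left_mono) auto
        also have "\<dots> = \<epsilon> / 2 * ?n"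
          by (simp only: mult.assoc[symmetric] \<epsilon>1)
        finally have p: "vnorm F ?p \<le> \<epsilon> / 2 * ?n" .
        have "vnorm F (L ?q) \<le> l * (\<epsilon>2 * ?n)"
          using l(2)[OF q(1)] mult_left_mono[OF q(2) l(1)] by simp
        also have "\<dots> \<le> \<epsilon> / 2 * ?n"
          using mult_right_mono[OF \<epsilon>2 nn] by (simp add: mult.assoc)
        finally have Lq: "vnorm F (L ?q) \<le> \<epsilon> / 2 * ?n" .
        note Lw = bounded_operators_carr[OF opL w] and LH = bounded_operators_carr[OF opL Hx]
        have "vminus F (vminus F (?g x) (?g a)) (?D (vminus D x a)) = vadd F ?p (L ?q)"
          using x a xa F.minus_add_minus[OF F.minus_closed[OF fx] Lw LH]
            bounded_operators_minus[OF assms(2) opL w Hx] by (simp add: compose_def)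
        moreover have "vnorm F (vadd F ?p (L ?q)) \<le> vnorm F ?p + vnorm F (L ?q)"
          using fx Lw bounded_operators_carr[OF opL q(1)] by (intro F.norm_triangle F.closed)
        ultimately show "vnorm F (vminus F (vminus F (?g x) (?g a)) (?D (vminus D x a))) \<le> \<epsilon> * ?n"
          using p Lq by simp
      qed
    qed
    then show ?thesis
      by blast
  qed
  then show ?thesis
    unfolding holomorphic_maps_iff using fF hU by auto
qed

lemma holomorphic_maps_compose_operator:
  assumes "complex_normed_space E" "complex_normed_space F" "complex_normed_space G" and U: "U \<subseteq> carr E"
    and f: "f \<in> holomorphic_maps E U F" and T: "T \<in> bounded_operators F G"
  shows "(\<lambda>x\<in>U. T (f x)) \<in> holomorphic_maps E U G"
  using holomorphic_maps_compose[OF assms(1-4) order_refl f _ holomorphic_maps_operator[OF assms(2,3) T]]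
    holomorphic_maps_carr[OF f] by blast

lemma holomorphic_maps_scale:
  assumes "complex_normed_space E" "complex_normed_space F" and U: "U \<subseteq> carr E"
    and f: "f \<in> holomorphic_maps E U F"
  shows "(\<lambda>x\<in>U. vscale F c (f x)) \<in> holomorphic_maps E U F"
proof -
  have "(\<lambda>y\<in>carr F. vscale F c ((\<lambda>y\<in>carr F. y) y)) \<in> bounded_operators F F"
    by (intro bounded_operators_multiple assms iso_operator isometric_isomorphism_refl)
  from holomorphic_maps_compose_operator[OF assms(1,2,2) U f this] show ?thesis
    using holomorphic_maps_carr[OF f] by (simp cong: restrict_cong)
qed

section \<open>Cauchy estimates and limits of holomorphic functions\<close>

text \<open>The Taylor coefficients are at most \<open>B / r ^ n\<close> by the Cauchy estimates, and the tail from \<open>n = 2\<close> on is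
  dominated by a geometric series of ratio at most \<open>1 / 2\<close>.\<close>

lemma holomorphic_remainder_bound:
  assumes hol: "\<phi> holomorphic_on ball 0 R" and r: "r < R" "r \<ge> 2"
    and B: "\<And>z. z \<in> ball 0 R \<Longrightarrow> cmod (\<phi> z) \<le> B"
  shows "cmod (\<phi> 1 - \<phi> 0 - deriv \<phi> 0) \<le> 2 * B / r\<^sup>2"
proof -
  let ?c = "\<lambda>n. (deriv ^^ n) \<phi> 0 / fact n"
  have "(\<lambda>n. ?c n * (1 - 0) ^ n) sums \<phi> 1"
    using r by (intro holomorphic_power_series[OF hol]) auto
  then have "?c sums \<phi> 1"
    by simp
  then have tail: "(\<lambda>n. ?c (n + 2)) sums (\<phi> 1 - (\<phi> 0 + deriv \<phi> 0))"
    using sums_split_initial_segment[of ?c "\<phi> 1" 2] by (simp add: numeral_2_eq_2)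
  have coeff: "cmod (?c n) \<le> B / r ^ n" for n
  proof -
    have "cmod ((deriv ^^ n) \<phi> 0) \<le> fact n * B / r ^ n"
    proof (rule Cauchy_inequality)
      show "\<phi> holomorphic_on ball 0 r"
        using r by (intro holomorphic_on_subset[OF hol]) auto
      show "continuous_on (cball 0 r) \<phi>"
        using r by (intro continuous_on_subset[OF holomorphic_on_imp_continuous_on[OF hol]]) auto
    qed (use r B in auto)
    then show ?thesis
      by (simp add: norm_divide field_simps)
  qed
  have "(\<lambda>n. (1 / r) ^ n) sums (1 / (1 - 1 / r))"
    using r by (intro geometric_sums) auto
  then have geo: "(\<lambda>n. B / r\<^sup>2 * (1 / r) ^ n) sums (B / r\<^sup>2 * (1 / (1 - 1 / r)))"
    by (rule sums_mult)
  have le: "cmod (?c (n + 2)) \<le> B / r\<^sup>2 * (1 / r) ^ n" for n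
    using coeff[of "n + 2"] by (simp add: power_add power_divide field_simps power2_eq_square)
  have "B \<ge> 0"
    using order_trans[OF norm_ge_zero B[of 0]] r by simp
  have "cmod (\<phi> 1 - (\<phi> 0 + deriv \<phi> 0)) \<le> B / r\<^sup>2 * (1 / (1 - 1 / r))"
    using norm_sums_le[OF tail geo le] .
  also have "\<dots> \<le> B / r\<^sup>2 * 2"
    using r \<open>B \<ge> 0\<close> by (intro mult_left_mono) (auto simp: field_simps)
  finally show ?thesis
    by (simp add: diff_diff_eq mult.commute)
qed

text \<open>Restriction to complex lines reduces estimates on normed spaces to functions of one variable.\<close>

lemma derivative_along_line:
  assumes E: "complex_normed_space E" and a: "a \<in> carr E" and y: "y \<in> carr E"
    and ball: "\<And>x. x \<in> carr E \<Longrightarrow> vnorm E (vminus E x a) < R \<Longrightarrow> x \<in> U"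
    and z: "cmod z * vnorm E y < R"
    and D: "frechet_at E U complex_line f (vadd E a (vscale E z y)) D"
  shows "((\<lambda>z. f (vadd E a (vscale E z y))) has_field_derivative D y) (at z)"
proof -
  interpret E: complex_normed_space E by (rule E)
  let ?p = "\<lambda>z. vadd E a (vscale E z y)"
  let ?Y = "vnorm E y"
  have p: "?p w \<in> carr E" for w
    using a y by (simp add: E.closed)
  have diff: "vminus E (?p w) (?p w') = vscale E (w - w') y" for w w'
  proof -
    have "vminus E (?p w) (?p w') = vadd E (vminus E a a) (vminus E (vscale E w y) (vscale E w' y))"
      using a y by (simp add: E.add_minus_add E.closed)
    also have "\<dots> = vadd E (vscale E w y) (vscale E (- w') y)"
      using a y by (simp add: E.minus_self E.add_zero E.closed) (simp add: vminus_def E.scale_scale y)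
    also have "\<dots> = vscale E (w - w') y"
      using E.scale_add_left[OF y, of w "- w'"] by simp
    finally show ?thesis .
  qed
  have "vminus E (?p w) a = vscale E w y" for w
    using E.add_minus_cancel(2)[OF a] y by (simp add: E.closed)
  then have pU: "?p w \<in> U" if "cmod w * ?Y < R" for w
    using ball[OF p[of w]] that y by (simp add: E.norm_scale)
  have Y: "?Y \<ge> 0"
    by (rule E.norm_nonneg[OF y])
  have op: "D \<in> bounded_operators E complex_line"
    by (rule frechet_at_operator[OF D])
  show ?thesis
    unfolding has_field_derivative_iff LIM_eq
  proof (intro allI impI)
    fix e :: real assume e: "e > 0"
    define \<epsilon> where "\<epsilon> = e / (2 * (?Y + 1))"
    have \<epsilon>: "\<epsilon> > 0"
      using e Y by (simp add: \<epsilon>_def)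
    have "\<epsilon> * ?Y \<le> \<epsilon> * (?Y + 1)"
      using \<epsilon> by (intro mult_left_mono) auto
    also have "\<dots> = e / 2"
      using Y by (simp add: \<epsilon>_def field_simps)
    finally have \<epsilon>Y: "\<epsilon> * ?Y < e"
      using e by simp
    obtain \<delta> where \<delta>: "\<delta> > 0" "\<And>x. x \<in> U \<Longrightarrow> vnorm E (vminus E x (?p z)) < \<delta> \<Longrightarrow>
       cmod (f x - f (?p z) - D (vminus E x (?p z))) \<le> \<epsilon> * vnorm E (vminus E x (?p z))"
      using frechet_atD[OF D \<epsilon>] by (metis complex_line_simps(5,6))
    define s where "s = min (\<delta> / (?Y + 1)) ((R - cmod z * ?Y) / (?Y + 1))"
    have "s > 0"
      using \<delta> z Y by (simp add: s_def)
    moreover have "cmod ((f (?p w) - f (?p z)) / (w - z) - D y) < e" if w: "w \<noteq> z" "cmod (w - z) < s" for w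
    proof -
      have "cmod (w - z) * ?Y \<le> cmod (w - z) * (?Y + 1)"
        by (intro mult_left_mono) auto
      also have "\<dots> < s * (?Y + 1)"
        using w Y by (intro mult_strict_right_mono) auto
      finally have less: "cmod (w - z) * ?Y < s * (?Y + 1)" .
      have "?Y + 1 > 0" "s \<le> \<delta> / (?Y + 1)" "s \<le> (R - cmod z * ?Y) / (?Y + 1)"
        using Y by (simp_all add: s_def)
      then have "s * (?Y + 1) \<le> \<delta>" "s * (?Y + 1) \<le> R - cmod z * ?Y"
        by (simp_all only: pos_le_divide_eq)
      then have small: "cmod (w - z) * ?Y < \<delta>" "cmod (w - z) * ?Y < R - cmod z * ?Y"
        using less by auto
      have "cmod w * ?Y \<le> (cmod (w - z) + cmod z) * ?Y"
        using norm_triangle_sub[of w z] Y by (intro mult_right_mono) auto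
      then have "?p w \<in> U"
        using small by (intro pU) (simp add: distrib_right)
      then have "cmod (f (?p w) - f (?p z) - D (vscale E (w - z) y)) \<le> \<epsilon> * (cmod (w - z) * ?Y)"
        using \<delta>(2)[of "?p w"] small y by (simp add: diff E.norm_scale)
      then have "cmod (f (?p w) - f (?p z) - (w - z) * D y) \<le> cmod (w - z) * (\<epsilon> * ?Y)"
        using y by (simp add: bounded_operators_scale[OF op] mult.left_commute)
      moreover have "(f (?p w) - f (?p z)) / (w - z) - D y = (f (?p w) - f (?p z) - (w - z) * D y) / (w - z)"
        using w by (simp add: field_simps)
      ultimately have "cmod ((f (?p w) - f (?p z)) / (w - z) - D y) \<le> \<epsilon> * ?Y"
        using w by (simp add: norm_divide pos_divide_le_eq mult.commute)
      then show ?thesis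
        using \<epsilon>Y by simp
    qed
    ultimately show "\<exists>s>0. \<forall>x. x \<noteq> z \<and> norm (x - z) < s \<longrightarrow>
        norm ((f (?p x) - f (?p z)) / (x - z) - D y) < e"
      by blast
  qed
qed

lemma holomorphic_along_line:
  assumes E: "complex_normed_space E" and a: "a \<in> carr E" and y: "y \<in> carr E"
    and R: "R > 0" and Y: "vnorm E y > 0"
    and ball: "\<And>x. x \<in> carr E \<Longrightarrow> vnorm E (vminus E x a) < R \<Longrightarrow> x \<in> U"
    and f: "f \<in> holomorphic_maps E U complex_line"
  shows "(\<lambda>z. f (vadd E a (vscale E z y))) holomorphic_on ball 0 (R / vnorm E y)"
    and "frechet_at E U complex_line f a D \<Longrightarrow> ((\<lambda>z. f (vadd E a (vscale E z y))) has_field_derivative D y) (at 0)"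
    and "z \<in> ball 0 (R / vnorm E y) \<Longrightarrow> vadd E a (vscale E z y) \<in> carr E \<and>
      vnorm E (vminus E (vadd E a (vscale E z y)) a) < R"
proof -
  interpret E: complex_normed_space E by (rule E)
  let ?p = "\<lambda>z. vadd E a (vscale E z y)"
  let ?\<phi> = "\<lambda>z. f (?p z)"
  have line: "(?\<phi> has_field_derivative L y) (at z)"
    if "cmod z * vnorm E y < R" "frechet_at E U complex_line f (?p z) L" for z L
    by (rule derivative_along_line[OF E a y _ that]) (rule ball)
  have p: "cmod z * vnorm E y < R" "?p z \<in> carr E" "vnorm E (vminus E (?p z) a) < R"
    if "z \<in> ball 0 (R / vnorm E y)" for z
    using that Y a y E.add_minus_cancel(2)[OF a] by (simp_all add: E.closed E.norm_scale field_simps)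
  then show "z \<in> ball 0 (R / vnorm E y) \<Longrightarrow> ?p z \<in> carr E \<and> vnorm E (vminus E (?p z) a) < R"
    by blast
  have "\<exists>d. (?\<phi> has_field_derivative d) (at z)" if z: "z \<in> ball 0 (R / vnorm E y)" for z
  proof -
    obtain L where "frechet_at E U complex_line f (?p z) L"
      using f ball[OF p(2,3)[OF z]] unfolding holomorphic_maps_iff by blast
    then show ?thesis
      using line[OF p(1)[OF z]] by blast
  qed
  then show "?\<phi> holomorphic_on ball 0 (R / vnorm E y)"
    unfolding holomorphic_on_def field_differentiable_def using has_field_derivative_at_within by blast
  have "?p 0 = a"
    using a y by (simp add: E.scale_zero_left E.add_zero_right)
  then show "(?\<phi> has_field_derivative D y) (at 0)" if "frechet_at E U complex_line f a D"
    using that R by (intro line) auto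
qed

text \<open>The Cauchy estimate for \<open>z \<mapsto> (f - g) (a + z y)\<close> on the circle of radius \<open>R / (2 * \<parallel>y\<parallel>)\<close>, half the
  radius on which the line stays in the ball.\<close>

lemma frechet_derivative_difference:
  assumes E: "complex_normed_space E" and a: "a \<in> carr E" and y: "y \<in> carr E" and R: "R > 0"
    and ball: "\<And>x. x \<in> carr E \<Longrightarrow> vnorm E (vminus E x a) < R \<Longrightarrow> x \<in> U"
    and f: "f \<in> holomorphic_maps E U complex_line" and g: "g \<in> holomorphic_maps E U complex_line"
    and D: "frechet_at E U complex_line f a D" and D': "frechet_at E U complex_line g a D'"
    and B: "\<And>x. x \<in> carr E \<Longrightarrow> vnorm E (vminus E x a) < R \<Longrightarrow> cmod (f x - g x) \<le> B"
  shows "cmod (D y - D' y) \<le> 2 * B / R * vnorm E y"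
proof (cases "vnorm E y = 0")
  case True
  interpret E: complex_normed_space E by (rule E)
  have "y = vzero E"
    using True y by (simp add: E.norm_eq_zero)
  then show ?thesis
    using True bounded_operators_zero[OF E complex_normed_space_complex_line frechet_at_operator[OF D]]
      bounded_operators_zero[OF E complex_normed_space_complex_line frechet_at_operator[OF D']] by simp
next
  case False
  then have Y: "vnorm E y > 0"
    using complex_normed_space.norm_nonneg[OF E y] by simp
  let ?p = "\<lambda>z. vadd E a (vscale E z y)"
  let ?\<psi> = "\<lambda>z. f (?p z) - g (?p z)"
  note line = holomorphic_along_line[OF E a y R Y ball]
  have hol: "?\<psi> holomorphic_on ball 0 (R / vnorm E y)"
    by (intro holomorphic_on_diff line f g)
  have "(?\<psi> has_field_derivative (D y - D' y)) (at 0)"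
    by (intro DERIV_diff line f g D D')
  then have d: "deriv ?\<psi> 0 = D y - D' y"
    by (rule DERIV_imp_deriv)
  let ?r = "R / (2 * vnorm E y)"
  have r: "?r > 0" "?r < R / vnorm E y"
    using R Y by (simp_all add: field_simps)
  have "cmod ((deriv ^^ 1) ?\<psi> 0) \<le> fact 1 * B / ?r ^ 1"
  proof (rule Cauchy_inequality[OF _ _ r(1)])
    show "?\<psi> holomorphic_on ball 0 ?r"
      using r by (intro holomorphic_on_subset[OF hol]) auto
    show "continuous_on (cball 0 ?r) ?\<psi>"
      using r by (intro continuous_on_subset[OF holomorphic_on_imp_continuous_on[OF hol]]) auto
    show "cmod (?\<psi> z) \<le> B" if "cmod (0 - z) = ?r" for z
      using line(3)[of f z] f that r by (intro B) auto
  qed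
  then show ?thesis
    using Y R by (simp add: d field_simps)
qed

text \<open>The remainder is quadratic with a constant that depends on \<open>f\<close> only through its bound \<open>B\<close>, so the
  estimate survives pointwise limits of uniformly bounded sequences. For \<open>\<parallel>y\<parallel> \<le> R / 4\<close> the circle of
  radius \<open>R / (2 * \<parallel>y\<parallel>)\<close> has radius at least \<open>2\<close>, as the one-variable bound at \<open>z = 1\<close> requires.\<close>

lemma frechet_remainder:
  assumes E: "complex_normed_space E" and a: "a \<in> carr E" and y: "y \<in> carr E" and R: "R > 0"
    and ball: "\<And>x. x \<in> carr E \<Longrightarrow> vnorm E (vminus E x a) < R \<Longrightarrow> x \<in> U"
    and f: "f \<in> holomorphic_maps E U complex_line"
    and D: "frechet_at E U complex_line f a D"
    and B: "\<And>x. x \<in> carr E \<Longrightarrow> vnorm E (vminus E x a) < R \<Longrightarrow> cmod (f x) \<le> B"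
    and small: "vnorm E y \<le> R / 4"
  shows "cmod (f (vadd E a y) - f a - D y) \<le> 8 * B / R\<^sup>2 * (vnorm E y)\<^sup>2"
proof -
  interpret E: complex_normed_space E by (rule E)
  show ?thesis
  proof (cases "vnorm E y = 0")
    case True
    then have "y = vzero E"
      using y by (simp add: E.norm_eq_zero)
    then show ?thesis
      using bounded_operators_zero[OF E complex_normed_space_complex_line frechet_at_operator[OF D]] a
      by (simp add: E.add_zero_right E.norm_zero)
  next
    case False
    then have Y: "vnorm E y > 0"
      using E.norm_nonneg[OF y] by simp
    let ?\<phi> = "\<lambda>z. f (vadd E a (vscale E z y))"
    note line = holomorphic_along_line[OF E a y R Y ball f]
    have "cmod (?\<phi> 1 - ?\<phi> 0 - deriv ?\<phi> 0) \<le> 2 * B / (R / (2 * vnorm E y))\<^sup>2"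
    proof (rule holomorphic_remainder_bound[OF line(1)])
      show "R / (2 * vnorm E y) < R / vnorm E y" "2 \<le> R / (2 * vnorm E y)"
        using R Y small by (simp_all add: field_simps)
      show "cmod (?\<phi> z) \<le> B" if "z \<in> ball 0 (R / vnorm E y)" for z
        using line(3)[OF _ _ that] by (intro B) auto
    qed auto
    moreover have "deriv ?\<phi> 0 = D y"
      by (intro DERIV_imp_deriv line(2) D)
    ultimately show ?thesis
      using Y R a y
      by (simp add: E.scale_zero_left E.scale_one E.add_zero_right power_divide power_mult_distrib field_simps)
  qed
qed

text \<open>The derivatives at a point form a Cauchy sequence of functionals by
  \<open>frechet_derivative_difference\<close>. Their limit is the derivative of the limit function, because the
  quadratic bound of \<open>frechet_remainder\<close> holds for all members of the sequence with one constant.\<close>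

theorem holomorphic_locally_uniform_limit:
  fixes E :: "'a cspace" and s :: "nat \<Rightarrow> 'a \<Rightarrow> complex"
  assumes E: "complex_normed_space E" and U: "U \<subseteq> carr E"
    and s: "\<And>n. s n \<in> holomorphic_maps E U complex_line"
    and f: "f \<in> extensional U"
    and approx: "\<And>a. a \<in> U \<Longrightarrow> \<exists>R>0. (\<forall>x\<in>carr E. vnorm E (vminus E x a) < R \<longrightarrow> x \<in> U) \<and>
       (\<exists>B. \<forall>x\<in>U. vnorm E (vminus E x a) < R \<longrightarrow> cmod (f x) \<le> B) \<and>
       (\<forall>e>0. \<exists>M. \<forall>n\<ge>M. \<forall>x\<in>U. vnorm E (vminus E x a) < R \<longrightarrow> cmod (s n x - f x) \<le> e)"
  shows "f \<in> holomorphic_maps E U complex_line"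
proof -
  interpret E: complex_normed_space E by (rule E)
  have "\<exists>D. frechet_at E U complex_line f a D" if aU: "a \<in> U" for a
  proof -
    have a: "a \<in> carr E"
      using aU U by auto
    obtain R B where R: "R > 0" and ball': "\<forall>x\<in>carr E. vnorm E (vminus E x a) < R \<longrightarrow> x \<in> U"
      and B': "\<forall>x\<in>U. vnorm E (vminus E x a) < R \<longrightarrow> cmod (f x) \<le> B"
      and unif': "\<forall>e>0. \<exists>M. \<forall>n\<ge>M. \<forall>x\<in>U. vnorm E (vminus E x a) < R \<longrightarrow> cmod (s n x - f x) \<le> e"
      using approx[OF aU] by (elim exE conjE) (rule that; assumption)
    have B: "cmod (f x) \<le> B" if "x \<in> U" "vnorm E (vminus E x a) < R" for x
      using B' that by simp
    have ball: "x \<in> U" if "x \<in> carr E" "vnorm E (vminus E x a) < R" for x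
      using ball' that by simp
    have unif: "\<exists>M. \<forall>n\<ge>M. \<forall>x\<in>U. vnorm E (vminus E x a) < R \<longrightarrow> cmod (s n x - f x) \<le> e" if "e > 0" for e
      using unif' that by simp
    have "\<forall>n. \<exists>D. frechet_at E U complex_line (s n) a D"
      using s aU unfolding holomorphic_maps_iff by blast
    then obtain D :: "nat \<Rightarrow> 'a \<Rightarrow> complex" where D: "\<And>n. frechet_at E U complex_line (s n) a (D n)"
      by metis
    note op = frechet_at_operator[OF D]
    have Dcauchy: "\<exists>M. \<forall>m\<ge>M. \<forall>n\<ge>M. \<forall>y\<in>carr E. cmod (D m y - D n y) \<le> e * vnorm E y" if e: "e > 0" for e
    proof -
      have "e * R / 4 > 0"
        using e R by simp
      then obtain M where M: "\<And>n x. n \<ge> M \<Longrightarrow> x \<in> U \<Longrightarrow> vnorm E (vminus E x a) < R \<Longrightarrow>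
          cmod (s n x - f x) \<le> e * R / 4"
        using unif by blast
      have "cmod (D m y - D n y) \<le> e * vnorm E y" if mn: "m \<ge> M" "n \<ge> M" and y: "y \<in> carr E" for m n y
      proof -
        have "cmod (D m y - D n y) \<le> 2 * (e * R / 2) / R * vnorm E y"
        proof (rule frechet_derivative_difference[OF E a y R ball s s D D])
          fix x assume x: "x \<in> carr E" "vnorm E (vminus E x a) < R"
          then have "cmod (s m x - f x) \<le> e * R / 4" "cmod (s n x - f x) \<le> e * R / 4"
            using M mn ball by blast+
          then show "cmod (s m x - s n x) \<le> e * R / 2"
            using norm_triangle_ineq4[of "s m x - f x" "s n x - f x"] by simp
        qed
        then show ?thesis
          using R by simp
      qed
      then show ?thesis
        by blast
    qed
    interpret dual: complex_normed_space "dual_space E"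
      by (rule banach_is_normed[OF complex_banach_space_dual[OF E]])
    have minus: "vminus (dual_space E) \<phi> \<psi> y = \<phi> y - \<psi> y" if "y \<in> carr E" for \<phi> \<psi> y
      using that by (simp add: vminus_def)
    have "range D \<subseteq> carr (dual_space E) \<and>
      (\<forall>e>0. \<exists>N. \<forall>m\<ge>N. \<forall>n\<ge>N. vnorm (dual_space E) (vminus (dual_space E) (D m) (D n)) < e)"
    proof (intro conjI allI impI)
      show "range D \<subseteq> carr (dual_space E)"
        using op by auto
      fix e :: real assume e: "e > 0"
      obtain M where M: "\<forall>m\<ge>M. \<forall>n\<ge>M. \<forall>y\<in>carr E. cmod (D m y - D n y) \<le> e / 2 * vnorm E y"
        using Dcauchy[of "e / 2"] e by auto
      have "vnorm (dual_space E) (vminus (dual_space E) (D m) (D n)) < e" if mn: "m \<ge> M" "n \<ge> M" for m n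
      proof -
        have "vnorm (dual_space E) (vminus (dual_space E) (D m) (D n)) \<le> e / 2"
          unfolding vnorm_dual_space using M mn e by (intro operator_norm_least) (auto simp: minus)
        then show ?thesis
          using e by simp
      qed
      then show "\<exists>N. \<forall>m\<ge>N. \<forall>n\<ge>N. vnorm (dual_space E) (vminus (dual_space E) (D m) (D n)) < e"
        by blast
    qed
    then obtain L where "L \<in> carr (dual_space E)"
      and Lconv: "\<forall>e>0. \<exists>N. \<forall>n\<ge>N. vnorm (dual_space E) (vminus (dual_space E) (D n) L) < e"
      using complex_banach_space_dual[OF E, unfolded complex_banach_space_iff_Cauchy_converges,
          THEN conjunct2, THEN spec[of _ D]] by blast
    then have Lop: "L \<in> bounded_operators E complex_line"
      by simp
    have lim: "(\<lambda>n. D n y) \<longlonglongrightarrow> L y" if y: "y \<in> carr E" for y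
    proof -
      have "(\<lambda>n. vnorm (dual_space E) (vminus (dual_space E) (D n) L)) \<longlonglongrightarrow> 0"
        using Lconv dual.norm_nonneg[OF dual.minus_closed] op Lop by (simp add: LIMSEQ_iff del: vnorm_dual_space)
      then have "(\<lambda>n. vnorm (dual_space E) (vminus (dual_space E) (D n) L) * vnorm E y) \<longlonglongrightarrow> 0"
        by (rule tendsto_mult_left_zero)
      moreover have "cmod (D n y - L y) \<le> vnorm (dual_space E) (vminus (dual_space E) (D n) L) * vnorm E y" for n
        using operator_norm_bound[OF E complex_normed_space_complex_line _ y, of "vminus (dual_space E) (D n) L"]
          dual.minus_closed[of "D n" L] op[of n] Lop y by (simp add: minus)
      ultimately have "(\<lambda>n. D n y - L y) \<longlonglongrightarrow> 0"
        by (rule_tac Lim_null_comparison) auto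
      then show ?thesis
        by (simp add: LIM_zero_iff)
    qed
    obtain M1 where M1: "\<And>n x. n \<ge> M1 \<Longrightarrow> x \<in> U \<Longrightarrow> vnorm E (vminus E x a) < R \<Longrightarrow> cmod (s n x - f x) \<le> 1"
      using unif[of 1] by auto
    have sB: "cmod (s n x) \<le> B + 1" if "n \<ge> M1" "x \<in> U" "vnorm E (vminus E x a) < R" for n x
      using M1[OF that] B[OF that(2,3)] norm_triangle_sub[of "s n x" "f x"] by simp
    have conv: "(\<lambda>n. s n x) \<longlonglongrightarrow> f x" if x: "x \<in> U" "vnorm E (vminus E x a) < R" for x
    proof (rule metric_LIMSEQ_I)
      fix e :: real assume "e > 0"
      then obtain M where "\<forall>n\<ge>M. \<forall>x\<in>U. vnorm E (vminus E x a) < R \<longrightarrow> cmod (s n x - f x) \<le> e / 2"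
        using unif[of "e / 2"] by auto
      then have "\<forall>n\<ge>M. cmod (s n x - f x) \<le> e / 2"
        using x by blast
      then show "\<exists>M. \<forall>n\<ge>M. dist (s n x) (f x) < e"
        using \<open>e > 0\<close> unfolding dist_norm by (intro exI[of _ M]) force
    qed
    define K where "K = 8 * (B + 1) / R\<^sup>2"
    have remainder: "cmod (f (vadd E a y) - f a - L y) \<le> K * (vnorm E y)\<^sup>2"
      if y: "y \<in> carr E" and small: "vnorm E y \<le> R / 4" for y
    proof (rule LIMSEQ_le_const2)
      have n: "vnorm E (vminus E (vadd E a y) a) < R" "vnorm E (vminus E a a) < R"
        using small R E.norm_nonneg[OF y] by (simp_all add: E.add_minus_cancel(2)[OF a y] E.minus_self a E.norm_zero)
      have "vadd E a y \<in> U"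
        using n a y by (intro ball E.closed)
      then show "(\<lambda>n. cmod (s n (vadd E a y) - s n a - D n y)) \<longlonglongrightarrow> cmod (f (vadd E a y) - f a - L y)"
        using n aU by (intro tendsto_intros conv lim y)
      have "cmod (s n (vadd E a y) - s n a - D n y) \<le> K * (vnorm E y)\<^sup>2" if "n \<ge> M1" for n
        unfolding K_def using sB[OF that] ball small by (intro frechet_remainder[OF E a y R ball s D]) auto
      then show "\<exists>N. \<forall>n\<ge>N. cmod (s n (vadd E a y) - s n a - D n y) \<le> K * (vnorm E y)\<^sup>2"
        by blast
    qed
    have "B \<ge> 0"
      using B[OF aU] R by (simp add: E.minus_self a E.norm_zero order_trans[OF norm_ge_zero])
    then have K: "K \<ge> 0"
      by (simp add: K_def)
    have "frechet_at E U complex_line f a L"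
      unfolding frechet_at_def
    proof (intro conjI Lop allI impI)
      fix e :: real assume e: "e > 0"
      show "\<exists>d>0. \<forall>x\<in>U. vnorm E (vminus E x a) < d \<longrightarrow>
         vnorm complex_line (vminus complex_line (vminus complex_line (f x) (f a)) (L (vminus E x a)))
           \<le> e * vnorm E (vminus E x a)"
      proof (intro exI[of _ "min (R / 4) (e / (K + 1))"] conjI ballI impI)
        show "0 < min (R / 4) (e / (K + 1))"
          using R e K by simp
        fix x assume x: "x \<in> U" and near: "vnorm E (vminus E x a) < min (R / 4) (e / (K + 1))"
        let ?y = "vminus E x a"
        have xE: "x \<in> carr E"
          using x U by auto
        have y: "?y \<in> carr E" "vadd E a ?y = x"
          using xE a by (simp_all add: E.closed E.add_minus_cancel(1))
        have nn: "vnorm E ?y \<ge> 0"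
          by (rule E.norm_nonneg[OF y(1)])
        have "(K + 1) * vnorm E ?y \<le> e"
          using near K by (simp add: field_simps)
        then have "K * vnorm E ?y \<le> e"
          using nn by (simp add: distrib_right)
        then have "K * (vnorm E ?y)\<^sup>2 \<le> e * vnorm E ?y"
          using nn mult_right_mono[of "K * vnorm E ?y" e "vnorm E ?y"] by (simp add: power2_eq_square mult.assoc)
        moreover have "cmod (f x - f a - L ?y) \<le> K * (vnorm E ?y)\<^sup>2"
          using remainder[OF y(1)] near y(2) by simp
        ultimately show "vnorm complex_line (vminus complex_line (vminus complex_line (f x) (f a)) (L (vminus E x a)))
           \<le> e * vnorm E (vminus E x a)"
          by simp
      qed
    qed
    then show ?thesis
      by blast
  qed
  then show ?thesis
    unfolding holomorphic_maps_iff using f by (simp add: PiE_def)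
qed

section \<open>Weighted spaces\<close>

lemma weighted_open_setD:
  assumes "weighted_open_set E U v"
  shows "complex_banach_space E" "complex_normed_space E" "U \<subseteq> carr E"
    and "\<And>x. x \<in> U \<Longrightarrow> v x > 0" "\<And>x. x \<in> U \<Longrightarrow> v x \<ge> 0"
proof -
  show E: "complex_banach_space E"
    using assms by (simp add: weighted_open_set_def)
  then show E': "complex_normed_space E"
    by (rule banach_is_normed)
  interpret E: complex_normed_space E by (rule E')
  show "U \<subseteq> carr E"
    using assms openin_subset[of E.metric.mtopology U] by (simp add: weighted_open_set_def)
  show *: "v x > 0" if "x \<in> U" for x
    using assms that by (auto simp: weighted_open_set_def)
  show "v x \<ge> 0" if "x \<in> U" for x
    using *[OF that] by simp
qed

text \<open>A lower bound for the weight near \<open>a\<close> turns convergence in the weighted norm into locally uniform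
  convergence.\<close>

lemma weighted_open_set_ball:
  assumes w: "weighted_open_set E U v" and a: "a \<in> U"
  obtains R where "R > 0" "\<And>x. x \<in> carr E \<Longrightarrow> vnorm E (vminus E x a) < R \<Longrightarrow> x \<in> U \<and> v a / 2 < v x"
proof -
  note d = weighted_open_setD[OF w]
  interpret E: complex_normed_space E by (rule d)
  have U: "openin E.metric.mtopology U" and v: "continuous_map (subtopology E.metric.mtopology U) euclideanreal v"
    using w by (simp_all add: weighted_open_set_def)
  have "openin (subtopology E.metric.mtopology U)
      {x \<in> topspace (subtopology E.metric.mtopology U). v x \<in> {v a / 2<..}}"
    by (rule openin_continuous_map_preimage[OF v]) simp
  then have "openin E.metric.mtopology {x \<in> topspace (subtopology E.metric.mtopology U). v x \<in> {v a / 2<..}}"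
    using U openin_trans_full by blast
  moreover have "{x \<in> topspace (subtopology E.metric.mtopology U). v x \<in> {v a / 2<..}} = {x \<in> U. v a / 2 < v x}"
    using d(3) by auto
  ultimately have "openin E.metric.mtopology {x \<in> U. v a / 2 < v x}"
    by simp
  moreover have "a \<in> {x \<in> U. v a / 2 < v x}"
    using a d(4)[OF a] by simp
  ultimately obtain R where R: "R > 0" "E.metric.mball a R \<subseteq> {x \<in> U. v a / 2 < v x}"
    unfolding E.metric.openin_mtopology by blast
  show thesis
  proof (rule that[OF R(1)])
    fix x assume x: "x \<in> carr E" "vnorm E (vminus E x a) < R"
    then have "x \<in> E.metric.mball a R"
      using a d(3) by (auto simp: E.metric.in_mball vdist_def E.norm_minus_commute)
    then show "x \<in> U \<and> v a / 2 < v x"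
      using R(2) by auto
  qed
qed

lemma weighted_open_set_restrict:
  assumes w: "weighted_open_set E U v" and V: "openin (norm_topology E) V" "V \<subseteq> U"
  shows "weighted_open_set E V (restrict v V)"
proof -
  have "continuous_map (subtopology (norm_topology E) V) euclideanreal v"
    using w V(2) continuous_map_from_subtopology_mono unfolding weighted_open_set_def by blast
  moreover have "topspace (subtopology (norm_topology E) V) \<subseteq> V"
    by auto
  ultimately have "continuous_map (subtopology (norm_topology E) V) euclideanreal (restrict v V)"
    by (rule_tac continuous_map_eq) auto
  then show ?thesis
    using w V by (auto simp: weighted_open_set_def)
qed

lemma weighted_norm_upper:
  assumes "f \<in> weighted_holomorphic E U v F" "x \<in> U"
  shows "v x * vnorm F (f x) \<le> weighted_norm U v F f"
  using assms unfolding weighted_norm_def weighted_holomorphic_def by (intro sup_nonneg_upper) auto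

lemma weighted_norm_nonneg:
  assumes "f \<in> weighted_holomorphic E U v F"
  shows "0 \<le> weighted_norm U v F f"
  using assms unfolding weighted_norm_def weighted_holomorphic_def by (intro sup_nonneg_nonneg) auto

lemma weighted_norm_least:
  assumes "C \<ge> 0" "\<And>x. x \<in> U \<Longrightarrow> v x * vnorm F (f x) \<le> C"
  shows "weighted_norm U v F f \<le> C"
  using assms unfolding weighted_norm_def by (intro sup_nonneg_least) auto

lemma weighted_holomorphicI:
  assumes "f \<in> holomorphic_maps E U F" "\<And>x. x \<in> U \<Longrightarrow> v x * vnorm F (f x) \<le> C"
  shows "f \<in> weighted_holomorphic E U v F"
  using assms bdd_aboveI2[of U "\<lambda>x. v x * vnorm F (f x)" C] unfolding weighted_holomorphic_def by simp

lemma weighted_holomorphicD: "f \<in> weighted_holomorphic E U v F \<Longrightarrow> f \<in> holomorphic_maps E U F"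
  by (simp add: weighted_holomorphic_def)

lemma weighted_holomorphic_carr: "f \<in> weighted_holomorphic E U v F \<Longrightarrow> x \<in> U \<Longrightarrow> f x \<in> carr F"
  by (rule holomorphic_maps_carr[OF weighted_holomorphicD])

lemma weighted_holomorphic_extensional: "f \<in> weighted_holomorphic E U v F \<Longrightarrow> f \<in> extensional U"
  by (rule holomorphic_maps_extensional[OF weighted_holomorphicD])

context
  fixes E :: "'a cspace" and U v and F :: "'b cspace"
  assumes w: "weighted_open_set E U v" and F: "complex_normed_space F"
begin

interpretation F: complex_normed_space F by (rule F)

lemma weighted_holomorphic_zero: "(\<lambda>x\<in>U. vzero F) \<in> weighted_holomorphic E U v F"
  using weighted_open_setD[OF w] F.norm_zero
  by (intro weighted_holomorphicI[where C = 0] holomorphic_maps_zero F) auto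

lemma weighted_holomorphic_add:
  assumes f: "f \<in> weighted_holomorphic E U v F" and g: "g \<in> weighted_holomorphic E U v F"
  shows "(\<lambda>x\<in>U. vadd F (f x) (g x)) \<in> weighted_holomorphic E U v F"
proof (rule weighted_holomorphicI)
  show "(\<lambda>x\<in>U. vadd F (f x) (g x)) \<in> holomorphic_maps E U F"
    using f g weighted_open_setD[OF w] by (intro holomorphic_maps_add F) (auto dest: weighted_holomorphicD)
  fix x assume x: "x \<in> U"
  have "vnorm F (vadd F (f x) (g x)) \<le> vnorm F (f x) + vnorm F (g x)"
    using f g x by (intro F.norm_triangle weighted_holomorphic_carr)
  then have "v x * vnorm F (vadd F (f x) (g x)) \<le> v x * vnorm F (f x) + v x * vnorm F (g x)"
    unfolding distrib_left[symmetric] using weighted_open_setD(5)[OF w x] by (rule mult_left_mono)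
  then show "v x * vnorm F ((\<lambda>x\<in>U. vadd F (f x) (g x)) x) \<le> weighted_norm U v F f + weighted_norm U v F g"
    using weighted_norm_upper[OF f x] weighted_norm_upper[OF g x] x by simp
qed

lemma weighted_holomorphic_scale:
  assumes f: "f \<in> weighted_holomorphic E U v F"
  shows "(\<lambda>x\<in>U. vscale F c (f x)) \<in> weighted_holomorphic E U v F"
proof (rule weighted_holomorphicI)
  show "(\<lambda>x\<in>U. vscale F c (f x)) \<in> holomorphic_maps E U F"
    using f weighted_open_setD[OF w] by (intro holomorphic_maps_scale F) (auto dest: weighted_holomorphicD)
  fix x assume x: "x \<in> U"
  show "v x * vnorm F ((\<lambda>x\<in>U. vscale F c (f x)) x) \<le> cmod c * weighted_norm U v F f"
    using mult_left_mono[OF weighted_norm_upper[OF f x], of "cmod c"] x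
    by (simp add: F.norm_scale weighted_holomorphic_carr[OF f x] mult.left_commute)
qed

lemma weighted_holomorphic_subset: "weighted_holomorphic E U v F \<subseteq> U \<rightarrow>\<^sub>E carr F"
  by (auto simp: weighted_holomorphic_def holomorphic_maps_iff)

lemma weighted_holomorphic_operator:
  assumes G: "complex_normed_space G" and f: "f \<in> weighted_holomorphic E U v F"
    and T: "T \<in> bounded_operators F G" and t: "t \<ge> 0" "\<And>y. y \<in> carr F \<Longrightarrow> vnorm G (T y) \<le> t * vnorm F y"
  shows "(\<lambda>x\<in>U. T (f x)) \<in> weighted_holomorphic E U v G"
    and "weighted_norm U v G (\<lambda>x\<in>U. T (f x)) \<le> t * weighted_norm U v F f"
proof -
  have le: "v x * vnorm G ((\<lambda>x\<in>U. T (f x)) x) \<le> t * weighted_norm U v F f" if x: "x \<in> U" for x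
  proof -
    have "v x * vnorm G (T (f x)) \<le> v x * (t * vnorm F (f x))"
      using t(2)[OF weighted_holomorphic_carr[OF f x]] weighted_open_setD(5)[OF w x] by (rule mult_left_mono)
    also have "\<dots> = t * (v x * vnorm F (f x))"
      by (rule mult.left_commute)
    also have "\<dots> \<le> t * weighted_norm U v F f"
      using weighted_norm_upper[OF f x] t(1) by (rule mult_left_mono)
    finally show ?thesis
      using x by simp
  qed
  show "(\<lambda>x\<in>U. T (f x)) \<in> weighted_holomorphic E U v G"
    using le by (intro weighted_holomorphicI holomorphic_maps_compose_operator[OF weighted_open_setD(2)[OF w] F G
        weighted_open_setD(3)[OF w] weighted_holomorphicD[OF f] T])
  show "weighted_norm U v G (\<lambda>x\<in>U. T (f x)) \<le> t * weighted_norm U v F f"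
    using le t(1) weighted_norm_nonneg[OF f] by (intro weighted_norm_least) auto
qed

end

lemma weighted_holomorphic_space_simps [simp]:
  "carr (weighted_holomorphic_space E U v F) = weighted_holomorphic E U v F"
  "vadd (weighted_holomorphic_space E U v F) f g = (\<lambda>x\<in>U. vadd F (f x) (g x))"
  "vzero (weighted_holomorphic_space E U v F) = (\<lambda>x\<in>U. vzero F)"
  "vscale (weighted_holomorphic_space E U v F) c f = (\<lambda>x\<in>U. vscale F c (f x))"
  "vnorm (weighted_holomorphic_space E U v F) = weighted_norm U v F"
  by (simp_all add: weighted_holomorphic_space_def)

theorem complex_banach_space_weighted_holomorphic:
  fixes E :: "'a cspace"
  assumes w: "weighted_open_set E U v"
  shows "complex_banach_space (weighted_holomorphic_space E U v complex_line)"
proof -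
  note d = weighted_open_setD[OF w]
  interpret E: complex_normed_space E by (rule d)
  note C = complex_normed_space_complex_line
  let ?A = "weighted_holomorphic E U v complex_line" and ?N = "weighted_norm U v complex_line"
  have eval: "cmod (f x) \<le> 1 / v x * ?N f" if "f \<in> ?A" "x \<in> U" for f x
    using weighted_norm_upper[OF that] d(4)[OF that(2)] by (simp add: field_simps)
  have least: "?N f \<le> c" if "c \<ge> 0" "\<And>x. x \<in> U \<Longrightarrow> cmod (f x) \<le> 1 / v x * c" for f c
    using that d(4) by (intro weighted_norm_least) (auto simp: field_simps)
  have normed: "complex_normed_space (fun_space U complex_line ?A ?N)"
    using weighted_holomorphic_subset[OF w C] weighted_holomorphic_zero[OF w C] weighted_holomorphic_add[OF w C]
      weighted_holomorphic_scale[OF w C] eval least weighted_norm_nonneg d(5)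
    by (intro fun_space_normedI[where b = "\<lambda>x. 1 / v x"] C) auto
  show ?thesis
    unfolding weighted_holomorphic_space_def
  proof (rule fun_space_complete[OF normed, where b = "\<lambda>x. 1 / v x"])
    fix s :: "nat \<Rightarrow> 'a \<Rightarrow> complex" and f
    assume s: "\<And>n. s n \<in> ?A" and f: "f \<in> extensional U"
      and close: "\<And>e. e > 0 \<Longrightarrow> \<exists>M. \<forall>n\<ge>M. \<forall>x\<in>U. cmod (s n x - f x) \<le> 1 / v x * e"
    obtain M where M: "\<forall>n\<ge>M. \<forall>x\<in>U. cmod (s n x - f x) \<le> 1 / v x * 1"
      using close[of 1] by auto
    have bound: "v x * cmod (f x) \<le> ?N (s M) + 1" if x: "x \<in> U" for x
    proof -
      have "cmod (f x) \<le> cmod (s M x) + 1 / v x"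
        using M x norm_triangle_sub[of "f x" "s M x"] by (fastforce simp: norm_minus_commute)
      then have "v x * cmod (f x) \<le> v x * (cmod (s M x) + 1 / v x)"
        using d(5)[OF x] by (rule mult_left_mono)
      also have "\<dots> = v x * cmod (s M x) + 1"
        using d(4)[OF x] by (simp add: distrib_left)
      finally show ?thesis
        using weighted_norm_upper[OF s x, of M] by simp
    qed
    show "f \<in> ?A"
    proof (rule weighted_holomorphicI)
      show "f \<in> holomorphic_maps E U complex_line"
      proof (rule holomorphic_locally_uniform_limit[OF d(2,3) weighted_holomorphicD[OF s] f])
        fix a assume a: "a \<in> U"
        obtain R where R: "R > 0" and ball: "\<And>x. x \<in> carr E \<Longrightarrow> vnorm E (vminus E x a) < R \<Longrightarrow> x \<in> U \<and> v a / 2 < v x"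
          using weighted_open_set_ball[OF w a] by blast
        have va: "v a > 0"
          by (rule d(4)[OF a])
        have inv: "1 / v x \<le> 2 / v a" if "x \<in> U" "vnorm E (vminus E x a) < R" for x
          using ball[of x] that d(3,4) va by (auto simp: field_simps)
        show "\<exists>R>0. (\<forall>x\<in>carr E. vnorm E (vminus E x a) < R \<longrightarrow> x \<in> U) \<and>
           (\<exists>B. \<forall>x\<in>U. vnorm E (vminus E x a) < R \<longrightarrow> cmod (f x) \<le> B) \<and>
           (\<forall>e>0. \<exists>M. \<forall>n\<ge>M. \<forall>x\<in>U. vnorm E (vminus E x a) < R \<longrightarrow> cmod (s n x - f x) \<le> e)"
        proof (rule exI[of _ R], intro conjI R allI impI)
          show "\<forall>x\<in>carr E. vnorm E (vminus E x a) < R \<longrightarrow> x \<in> U"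
            using ball by blast
          have "cmod (f x) \<le> 2 / v a * (?N (s M) + 1)" if x: "x \<in> U" "vnorm E (vminus E x a) < R" for x
          proof -
            have "cmod (f x) \<le> 1 / v x * (?N (s M) + 1)"
              using bound[OF x(1)] d(4)[OF x(1)] by (simp add: field_simps)
            also have "\<dots> \<le> 2 / v a * (?N (s M) + 1)"
              using inv[OF x] weighted_norm_nonneg[OF s, of M] by (intro mult_right_mono) auto
            finally show ?thesis .
          qed
          then show "\<exists>B. \<forall>x\<in>U. vnorm E (vminus E x a) < R \<longrightarrow> cmod (f x) \<le> B"
            by blast
          fix e :: real assume e: "e > 0"
          then obtain M where M: "\<forall>n\<ge>M. \<forall>x\<in>U. cmod (s n x - f x) \<le> 1 / v x * (e * v a / 2)"
            using close[of "e * v a / 2"] va by auto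
          have "cmod (s n x - f x) \<le> e" if x: "n \<ge> M" "x \<in> U" "vnorm E (vminus E x a) < R" for n x
          proof -
            have "cmod (s n x - f x) \<le> 1 / v x * (e * v a / 2)"
              using M x by blast
            also have "\<dots> \<le> 2 / v a * (e * v a / 2)"
              using inv[OF x(2,3)] e va by (intro mult_right_mono) auto
            also have "\<dots> = e"
              using va by simp
            finally show ?thesis .
          qed
          then show "\<exists>M. \<forall>n\<ge>M. \<forall>x\<in>U. vnorm E (vminus E x a) < R \<longrightarrow> cmod (s n x - f x) \<le> e"
            by blast
        qed
      qed
      show "v x * vnorm complex_line (f x) \<le> ?N (s M) + 1" if "x \<in> U" for x
        using bound[OF that] by simp
    qed
  qed (use weighted_holomorphic_extensional eval least d(5) in auto)
qed

text \<open>The bound holds because \<open>v x \<le> c * v (h x)\<close> on \<open>V\<close>, where \<open>c\<close> is the composition constant.\<close>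

lemma composition_operator:
  assumes w: "weighted_open_set E U v" and V: "openin (norm_topology E) V" "V \<subseteq> U"
    and h: "h \<in> holomorphic_maps E V E" "h ` V \<subseteq> U" and c: "bdd_above ((\<lambda>x. v x / v (h x)) ` V)"
    and F: "complex_normed_space F" and g: "g \<in> weighted_holomorphic E U v F"
  shows "(\<lambda>x\<in>V. g (h x)) \<in> weighted_holomorphic E V (restrict v V) F"
    and "weighted_norm V (restrict v V) F (\<lambda>x\<in>V. g (h x)) \<le> composition_constant V v h * weighted_norm U v F g"
proof -
  note d = weighted_open_setD[OF w]
  interpret F: complex_normed_space F by (rule F)
  have c0: "composition_constant V v h \<ge> 0"
    unfolding composition_constant_def by (rule sup_nonneg_nonneg[OF c])
  have le: "restrict v V x * vnorm F ((\<lambda>x\<in>V. g (h x)) x) \<le> composition_constant V v h * weighted_norm U v F g"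
    if x: "x \<in> V" for x
  proof -
    have hx: "h x \<in> U"
      using h(2) x by auto
    have "v x / v (h x) \<le> composition_constant V v h"
      unfolding composition_constant_def using x by (intro sup_nonneg_upper[OF c]) auto
    then have "v x \<le> composition_constant V v h * v (h x)"
      using d(4)[OF hx] by (simp add: field_simps)
    then have "v x * vnorm F (g (h x)) \<le> composition_constant V v h * v (h x) * vnorm F (g (h x))"
      by (rule mult_right_mono) (intro F.norm_nonneg weighted_holomorphic_carr[OF g hx])
    also have "\<dots> = composition_constant V v h * (v (h x) * vnorm F (g (h x)))"
      by (rule mult.assoc)
    also have "\<dots> \<le> composition_constant V v h * weighted_norm U v F g"
      using weighted_norm_upper[OF g hx] c0 by (rule mult_left_mono)
    finally show ?thesis
      using x by simp
  qed
  have "V \<subseteq> carr E"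
    using V d(3) by auto
  then show "(\<lambda>x\<in>V. g (h x)) \<in> weighted_holomorphic E V (restrict v V) F"
    using le by (intro weighted_holomorphicI
        holomorphic_maps_compose[OF d(2,2) F _ d(3) h weighted_holomorphicD[OF g]])
  show "weighted_norm V (restrict v V) F (\<lambda>x\<in>V. g (h x)) \<le> composition_constant V v h * weighted_norm U v F g"
    using le c0 weighted_norm_nonneg[OF g] by (intro weighted_norm_least) auto
qed

section \<open>The transpose\<close>

lemma transpose_apply:
  "\<phi> \<in> bounded_operators F complex_line \<Longrightarrow> transpose_map U F f \<phi> = (\<lambda>x\<in>U. \<phi> (f x))"
  by (simp add: transpose_map_def compose_def)

lemma transpose_bounded:
  assumes w: "weighted_open_set E U v" and F: "complex_normed_space F"
    and f: "f \<in> weighted_holomorphic E U v F"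
  shows "transpose_map U F f \<in> bounded_operators (dual_space F) (weighted_holomorphic_space E U v complex_line)"
proof -
  note C = complex_normed_space_complex_line
  interpret D: complex_normed_space "dual_space F"
    by (rule banach_is_normed[OF complex_banach_space_dual[OF F]])
  note fF = weighted_holomorphic_carr[OF f]
  note op = weighted_holomorphic_operator[OF w F C f]
  show ?thesis
  proof (rule bounded_operatorsI[where C = "weighted_norm U v F f"])
    fix \<phi> \<psi> assume "\<phi> \<in> carr (dual_space F)" "\<psi> \<in> carr (dual_space F)"
    then show "transpose_map U F f (vadd (dual_space F) \<phi> \<psi>) =
        vadd (weighted_holomorphic_space E U v complex_line) (transpose_map U F f \<phi>) (transpose_map U F f \<psi>)"
      using D.add_closed[of \<phi> \<psi>] fF by (auto simp: transpose_apply intro!: restrict_ext)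
  next
    fix c \<phi> assume "\<phi> \<in> carr (dual_space F)"
    then show "transpose_map U F f (vscale (dual_space F) c \<phi>) =
        vscale (weighted_holomorphic_space E U v complex_line) c (transpose_map U F f \<phi>)"
      using D.scale_closed[of \<phi> c] fF by (auto simp: transpose_apply intro!: restrict_ext)
  next
    have "transpose_map U F f \<phi> \<in> weighted_holomorphic E U v complex_line"
      if "\<phi> \<in> bounded_operators F complex_line" for \<phi>
      using op(1)[OF that operator_norm_nonneg[OF F C that] operator_norm_bound[OF F C that]] that
      by (simp add: transpose_apply)
    then show "transpose_map U F f \<in> carr (dual_space F) \<rightarrow>\<^sub>E carr (weighted_holomorphic_space E U v complex_line)"
      by (auto simp: transpose_map_def)
  next
    fix \<phi> assume "\<phi> \<in> carr (dual_space F)"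
    then have \<phi>: "\<phi> \<in> bounded_operators F complex_line"
      by simp
    show "vnorm (weighted_holomorphic_space E U v complex_line) (transpose_map U F f \<phi>)
        \<le> weighted_norm U v F f * vnorm (dual_space F) \<phi>"
      using op(2)[OF \<phi> operator_norm_nonneg[OF F C \<phi>] operator_norm_bound[OF F C \<phi>]] \<phi>
      by (simp add: transpose_apply mult.commute)
  qed
qed

lemma scalar_multiples_operator:
  assumes Z: "complex_normed_space Z" and z: "z \<in> carr Z"
  shows "(\<lambda>c. vscale Z c z) \<in> bounded_operators complex_line Z"
proof -
  interpret Z: complex_normed_space Z by (rule Z)
  show ?thesis
    using z by (intro bounded_operatorsI[where C = "vnorm Z z"])
      (auto simp: Z.closed Z.scale_add_left Z.scale_scale Z.norm_scale mult.commute)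
qed

section \<open>The weighted dual ideal\<close>

lemma lepoll_functions: "(UNIV :: 'a set) \<lesssim> (UNIV :: ('a \<Rightarrow> complex) set)"
proof -
  have "inj (\<lambda>(x :: 'a) y. if y = x then 1 else 0 :: complex)"
    by (rule injI) (metis zero_neq_one)
  then show ?thesis
    by (auto simp: lepoll_def)
qed

lemma lepoll_constants: "(UNIV :: complex set) \<lesssim> (UNIV :: ('a \<Rightarrow> complex) set)"
proof -
  have "inj (\<lambda>c (x :: 'a). c :: complex)"
    by (rule injI) metis
  then show ?thesis
    by (auto simp: lepoll_def)
qed

text \<open>The holomorphic maps live on spaces over \<open>'s\<close>. The size assumption leaves room over \<open>'w\<close> for the duals of
  these spaces, for the spaces of weighted holomorphic functions, and for the duals of both.\<close>

locale large_pietsch_ideal = pietsch_ideal I \<alpha>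
  for I :: "'w operator_class" and \<alpha> and type_s :: "'s itself" +
  assumes large: "(UNIV :: (('s \<Rightarrow> complex) \<Rightarrow> complex) set) \<lesssim> (UNIV :: 'w set)"
begin

lemma has_copy_functions:
  fixes X :: "('s \<Rightarrow> complex) cspace"
  assumes X: "complex_banach_space X"
  shows "has_copy TYPE('w) X" "has_copy TYPE('w) (dual_space X)"
proof -
  have "(UNIV :: ('s \<Rightarrow> complex) set) \<lesssim> (UNIV :: 'w set)"
    using lepoll_functions large by (rule lepoll_trans)
  then show "has_copy TYPE('w) X"
    by (rule has_copyI_lepoll[OF X])
  show "has_copy TYPE('w) (dual_space X)"
    by (rule has_copyI_lepoll[OF complex_banach_space_dual[OF banach_is_normed[OF X]] large])
qed

lemma has_copy_complex_line: "has_copy TYPE('w) complex_line"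
proof (rule has_copyI_lepoll[OF complex_banach_space_complex_line])
  show "(UNIV :: complex set) \<lesssim> (UNIV :: 'w set)"
    using lepoll_constants large by (rule lepoll_trans)
qed

context
  fixes E :: "'s cspace" and U v and F :: "'s cspace"
  assumes w: "weighted_open_set E U v" and F: "complex_banach_space F"
begin

abbreviation (input) "wh_space \<equiv> weighted_holomorphic_space E U v complex_line"

lemma normed_target: "complex_normed_space F"
  by (rule banach_is_normed[OF F])

lemma dual_banach: "complex_banach_space (dual_space F)"
  by (rule complex_banach_space_dual[OF normed_target])

lemma copies: "has_copy TYPE('w) (dual_space F)" "has_copy TYPE('w) wh_space"
  by (intro has_copy_functions dual_banach complex_banach_space_weighted_holomorphic w)+

lemma weighted_dual_idealD:
  assumes "f \<in> weighted_dual_ideal I E U v F"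
  shows "f \<in> weighted_holomorphic E U v F" "transpose_map U F f \<in> ideal_on I (dual_space F) wh_space"
  using assms by (simp_all add: weighted_dual_ideal_def)

text \<open>Let \<open>x \<in> U\<close> and let \<open>\<phi>\<close> be a functional of norm at most \<open>1\<close> with \<open>\<phi> (f x) = \<parallel>f x\<parallel>\<close>. The map \<open>c \<mapsto> c \<phi>\<close>,
  followed by the transpose of \<open>f\<close> and the evaluation \<open>g \<mapsto> v x * g x\<close>, is multiplication by
  \<open>v x * \<parallel>f x\<parallel>\<close> on the scalars. The outer maps have norm at most \<open>1\<close>, and the scalar identity has
  ideal norm \<open>1\<close>.\<close>

lemma weighted_norm_le_dual_norm:
  assumes f: "f \<in> weighted_dual_ideal I E U v F"
  shows "weighted_norm U v F f \<le> weighted_dual_ideal_norm \<alpha> E U v F f"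
proof -
  interpret F: complex_normed_space F by (rule normed_target)
  note C = complex_normed_space_complex_line
  note H = banach_is_normed[OF complex_banach_space_weighted_holomorphic[OF w]]
  note D = banach_is_normed[OF dual_banach]
  interpret D: complex_normed_space "dual_space F" by (rule D)
  note fw = weighted_dual_idealD(1)[OF f] and ft = weighted_dual_idealD(2)[OF f]
  let ?N = "weighted_dual_ideal_norm \<alpha> E U v F f"
  interpret L: complex_normed_space "fun_space (carr complex_line) complex_line
      (ideal_on I complex_line complex_line) (ideal_norm_on \<alpha> complex_line complex_line)"
    by (rule ideal_on_normed[OF has_copy_complex_line has_copy_complex_line])
  interpret M: complex_normed_space "fun_space (carr (dual_space F)) wh_space
      (ideal_on I (dual_space F) wh_space) (ideal_norm_on \<alpha> (dual_space F) wh_space)"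
    by (rule ideal_on_normed[OF copies])
  have "v x * vnorm F (f x) \<le> ?N" if x: "x \<in> U" for x
  proof -
    note fx = weighted_holomorphic_carr[OF fw x]
    obtain \<phi> where \<phi>: "\<phi> \<in> bounded_operators F complex_line"
      "\<And>y. y \<in> carr F \<Longrightarrow> cmod (\<phi> y) \<le> vnorm F y" "\<phi> (f x) = vnorm F (f x)"
      using F.norming_functional[OF fx] by blast
    have \<phi>1: "vnorm (dual_space F) \<phi> \<le> 1"
      using \<phi>(2) by (auto intro: operator_norm_least)
    let ?R = "\<lambda>c. vscale (dual_space F) c \<phi>"
    have R: "?R \<in> bounded_operators complex_line (dual_space F)"
      using \<phi>(1) by (intro scalar_multiples_operator D) simp
    have R1: "vnorm (dual_space F) (?R c) \<le> 1 * vnorm complex_line c" for c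
      using \<phi>1 \<phi>(1) D.norm_scale[of \<phi> c] by (simp add: mult_left_le del: vscale_dual_space vnorm_dual_space)
    let ?S = "\<lambda>g\<in>carr wh_space. complex_of_real (v x) * g x"
    have S1: "vnorm complex_line (?S g) \<le> 1 * vnorm wh_space g" if "g \<in> carr wh_space" for g
      using weighted_norm_upper[of g E U v complex_line x] that x weighted_open_setD(5)[OF w x]
      by (simp add: norm_mult)
    have S: "?S \<in> bounded_operators wh_space complex_line"
    proof (rule bounded_operatorsI[OF _ _ _ S1])
      interpret H: complex_normed_space wh_space by (rule H)
      show "?S (vadd wh_space g h) = vadd complex_line (?S g) (?S h)"
        if "g \<in> carr wh_space" "h \<in> carr wh_space" for g h
        using H.add_closed[OF that] that x by (simp add: distrib_left)
      show "?S (vscale wh_space c g) = vscale complex_line c (?S g)" if "g \<in> carr wh_space" for c g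
        using H.scale_closed[OF that, of c] that x by (simp add: mult.left_commute)
    qed auto
    let ?k = "complex_of_real (v x * vnorm F (f x))"
    have eq: "(\<lambda>c\<in>carr complex_line. ?S (transpose_map U F f (?R c))) = (\<lambda>c\<in>carr complex_line. ?k * c)"
    proof (rule restrict_ext)
      fix c :: complex
      have Rc: "?R c \<in> bounded_operators F complex_line"
        using bounded_operators_carr[OF R, of c] by simp
      have "transpose_map U F f (?R c) \<in> carr wh_space"
        using bounded_operators_carr[OF transpose_bounded[OF w normed_target fw]] Rc by simp
      then show "?S (transpose_map U F f (?R c)) = ?k * c"
        using transpose_apply[OF Rc, of U f] x fx \<phi>(3) by simp
    qed
    have "ideal_norm_on \<alpha> complex_line complex_line (\<lambda>c\<in>carr complex_line. ?k * c) \<le> 1 * ?N * 1"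
      using ideal_on_compose(2)[OF has_copy_complex_line copies has_copy_complex_line R ft S zero_le_one R1 zero_le_one S1]
      unfolding eq weighted_dual_ideal_norm_def by simp
    moreover have "ideal_norm_on \<alpha> complex_line complex_line (\<lambda>c\<in>carr complex_line. ?k * c) = cmod ?k"
      using L.norm_scale[of "\<lambda>x. x" ?k] ideal_on_scalar_identity[OF has_copy_complex_line] by simp
    moreover have "v x * vnorm F (f x) \<le> cmod ?k"
      by (simp only: norm_of_real abs_ge_self)
    ultimately show ?thesis
      by linarith
  qed
  moreover have "?N \<ge> 0"
    using M.norm_nonneg[of "transpose_map U F f"] ft by (simp add: weighted_dual_ideal_norm_def)
  ultimately show ?thesis
    by (intro weighted_norm_least)
qed

text \<open>Transposition is linear, and it is injective since the functionals on \<open>F\<close> separate points.\<close>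

lemma weighted_dual_ideal_normed:
  "complex_normed_space (fun_space U F (weighted_dual_ideal I E U v F) (weighted_dual_ideal_norm \<alpha> E U v F))"
proof -
  interpret F: complex_normed_space F by (rule normed_target)
  let ?A = "weighted_dual_ideal I E U v F"
  let ?Z = "fun_space (carr (dual_space F)) wh_space
      (ideal_on I (dual_space F) wh_space) (ideal_norm_on \<alpha> (dual_space F) wh_space)"
  let ?\<Theta> = "transpose_map U F"
  interpret Z: complex_normed_space ?Z
    by (rule ideal_on_normed[OF copies])
  note wh = weighted_dual_idealD(1)
  have carr: "f x \<in> carr F" if "f \<in> ?A" "x \<in> U" for f x
    by (rule weighted_holomorphic_carr[OF wh[OF that(1)] that(2)])
  have \<Theta>: "?\<Theta> f \<in> carr ?Z" if "f \<in> ?A" for f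
    using weighted_dual_idealD(2)[OF that] by simp
  have \<Theta>_add: "?\<Theta> (\<lambda>x\<in>U. vadd F (f x) (g x)) = vadd ?Z (?\<Theta> f) (?\<Theta> g)" if "f \<in> ?A" "g \<in> ?A" for f g
    using that carr by (auto simp: transpose_map_def compose_def bounded_operators_add intro!: restrict_ext)
  have \<Theta>_scale: "?\<Theta> (\<lambda>x\<in>U. vscale F c (f x)) = vscale ?Z c (?\<Theta> f)" if "f \<in> ?A" for c f
    using that carr by (auto simp: transpose_map_def compose_def bounded_operators_scale intro!: restrict_ext)
  have \<Theta>_zero: "?\<Theta> (\<lambda>x\<in>U. vzero F) = vzero ?Z"
    using bounded_operators_zero[OF normed_target complex_normed_space_complex_line]
    by (auto simp: transpose_map_def compose_def intro!: restrict_ext)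
  show ?thesis
  proof (rule fun_space_normed_pullback[OF normed_target Z.complex_normed_space_axioms, where \<Theta> = ?\<Theta>])
    show "?A \<subseteq> U \<rightarrow>\<^sub>E carr F"
      using wh weighted_holomorphic_subset[OF w normed_target] by blast
    show "(\<lambda>x\<in>U. vzero F) \<in> ?A"
      using weighted_holomorphic_zero[OF w normed_target] Z.zero_closed
      unfolding weighted_dual_ideal_def by (simp add: \<Theta>_zero)
    show "(\<lambda>x\<in>U. vadd F (f x) (g x)) \<in> ?A" if "f \<in> ?A" "g \<in> ?A" for f g
      using weighted_holomorphic_add[OF w normed_target that[THEN wh]] Z.add_closed[OF that[THEN \<Theta>]] \<Theta>_add[OF that]
      unfolding weighted_dual_ideal_def by simp
    show "(\<lambda>x\<in>U. vscale F c (f x)) \<in> ?A" if "f \<in> ?A" for c f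
      using weighted_holomorphic_scale[OF w normed_target wh[OF that]] Z.scale_closed[OF \<Theta>[OF that]] \<Theta>_scale[OF that]
      unfolding weighted_dual_ideal_def by simp
    show "f = (\<lambda>x\<in>U. vzero F)" if f: "f \<in> ?A" "?\<Theta> f = vzero ?Z" for f
    proof (rule extensionalityI[of _ U])
      fix x assume x: "x \<in> U"
      obtain \<phi> where \<phi>: "\<phi> \<in> bounded_operators F complex_line" "\<phi> (f x) = vnorm F (f x)"
        using F.norming_functional[OF carr[OF f(1) x]] by blast
      have "?\<Theta> f \<phi> x = 0"
        using f(2) \<phi>(1) x by simp
      then have "vnorm F (f x) = 0"
        using \<phi> x by (simp add: transpose_apply)
      then show "f x = (\<lambda>x\<in>U. vzero F) x"
        using x carr[OF f(1) x] F.norm_eq_zero by simp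
    qed (use weighted_holomorphic_extensional[OF wh[OF f(1)]] in auto)
  qed (fact \<Theta> \<Theta>_add \<Theta>_scale | simp add: weighted_dual_ideal_norm_def)+
qed

text \<open>The transpose sends \<open>\<phi>\<close> to \<open>\<phi> y\<close> times \<open>h\<close>, so it factors through the scalar identity; this bounds its
  ideal norm from above. The bound from below is the domination of the weighted norm.\<close>

lemma weighted_dual_ideal_elementary:
  assumes h: "h \<in> weighted_holomorphic E U v complex_line" and y: "y \<in> carr F"
  shows "(\<lambda>x\<in>U. vscale F (h x) y) \<in> weighted_dual_ideal I E U v F"
    and "weighted_dual_ideal_norm \<alpha> E U v F (\<lambda>x\<in>U. vscale F (h x) y) = weighted_norm U v complex_line h * vnorm F y"
proof -
  interpret F: complex_normed_space F by (rule normed_target)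
  note C = complex_normed_space_complex_line
  note H = banach_is_normed[OF complex_banach_space_weighted_holomorphic[OF w]]
  interpret H: complex_normed_space wh_space by (rule H)
  note D = banach_is_normed[OF dual_banach]
  interpret D: complex_normed_space "dual_space F" by (rule D)
  let ?g = "\<lambda>x\<in>U. vscale F (h x) y"
  let ?n = "weighted_norm U v complex_line h"
  have n: "?n \<ge> 0"
    by (rule weighted_norm_nonneg[OF h])
  have g: "?g \<in> weighted_holomorphic E U v F"
    using weighted_holomorphic_operator(1)[OF w C normed_target h scalar_multiples_operator[OF normed_target y],
        of "vnorm F y"] y by (simp add: F.norm_scale F.norm_nonneg mult.commute)
  let ?R = "\<lambda>\<phi>\<in>carr (dual_space F). \<phi> y"
  have R1: "vnorm complex_line (?R \<phi>) \<le> vnorm F y * vnorm (dual_space F) \<phi>" if "\<phi> \<in> carr (dual_space F)" for \<phi>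
    using operator_norm_bound[OF normed_target C, of \<phi> y] that y by (simp add: mult.commute)
  have R: "?R \<in> bounded_operators (dual_space F) complex_line"
    by (rule bounded_operatorsI[OF _ _ _ R1])
      (use D.add_closed D.scale_closed y in \<open>auto simp del: vadd_dual_space vscale_dual_space\<close>, simp_all add: y)
  let ?S = "\<lambda>c. vscale wh_space c h"
  have S: "?S \<in> bounded_operators complex_line wh_space"
    using h by (intro scalar_multiples_operator H) simp
  have S1: "vnorm wh_space (?S c) \<le> ?n * vnorm complex_line c" for c
    using H.norm_scale[of h c] h by (simp add: mult.commute)
  have eq: "(\<lambda>\<phi>\<in>carr (dual_space F). ?S ((\<lambda>x. x) (?R \<phi>))) = transpose_map U F ?g"
    using y by (auto simp: transpose_map_def compose_def bounded_operators_scale mult.commute intro!: restrict_ext)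
  note id = ideal_on_scalar_identity[OF has_copy_complex_line]
  note comp = ideal_on_compose[OF copies(1) has_copy_complex_line has_copy_complex_line copies(2) R id(1) S
      F.norm_nonneg[OF y] R1 n S1, unfolded eq id(2)]
  show gA: "?g \<in> weighted_dual_ideal I E U v F"
    using comp(1) g by (simp add: weighted_dual_ideal_def)
  have "?n * vnorm F y \<le> weighted_norm U v F ?g"
  proof (cases "vnorm F y = 0")
    case True
    then show ?thesis
      using weighted_norm_nonneg[OF g] by simp
  next
    case False
    then have pos: "vnorm F y > 0"
      using F.norm_nonneg[OF y] by simp
    have "?n \<le> weighted_norm U v F ?g / vnorm F y"
    proof (rule weighted_norm_least)
      show "v x * vnorm complex_line (h x) \<le> weighted_norm U v F ?g / vnorm F y" if "x \<in> U" for x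
        using weighted_norm_upper[OF g that] that y pos by (simp add: F.norm_scale field_simps)
    qed (use weighted_norm_nonneg[OF g] pos in simp)
    then show ?thesis
      using pos by (simp add: field_simps)
  qed
  then show "weighted_dual_ideal_norm \<alpha> E U v F ?g = ?n * vnorm F y"
    using comp(2) weighted_norm_le_dual_norm[OF gA] by (simp add: weighted_dual_ideal_norm_def)
qed

end

text \<open>The transpose of \<open>T \<circ> f \<circ> h\<close> is the transpose of \<open>f\<close> between the adjoint of \<open>T\<close> and composition with \<open>h\<close>.\<close>

lemma weighted_dual_ideal_compose:
  fixes E :: "'s cspace"
  assumes w: "weighted_open_set E U v" and F: "complex_banach_space (F :: 's cspace)"
    and G: "complex_banach_space (G :: 's cspace)"
    and V: "openin (norm_topology E) V" "V \<subseteq> U"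
    and h: "h \<in> holomorphic_maps E V E" "h ` V \<subseteq> U" and c: "bdd_above ((\<lambda>x. v x / v (h x)) ` V)"
    and f: "f \<in> weighted_dual_ideal I E U v F" and T: "T \<in> bounded_operators F G"
  shows "(\<lambda>x\<in>V. T (f (h x))) \<in> weighted_dual_ideal I E V (restrict v V) G"
    and "weighted_dual_ideal_norm \<alpha> E V (restrict v V) G (\<lambda>x\<in>V. T (f (h x)))
      \<le> operator_norm F G T * weighted_dual_ideal_norm \<alpha> E U v F f * composition_constant V v h"
proof -
  note C = complex_normed_space_complex_line
  note nF = banach_is_normed[OF F] and nG = banach_is_normed[OF G]
  have w': "weighted_open_set E V (restrict v V)"
    by (rule weighted_open_set_restrict[OF w V])
  let ?H = "weighted_holomorphic_space E U v complex_line"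
  let ?K = "weighted_holomorphic_space E V (restrict v V) complex_line"
  note co = composition_operator[OF w V h c]
  note fw = weighted_dual_idealD(1)[OF w F f] and ft = weighted_dual_idealD(2)[OF w F f]
  have hU: "h x \<in> U" if "x \<in> V" for x
    using h(2) that by auto
  have c0: "composition_constant V v h \<ge> 0"
    unfolding composition_constant_def by (rule sup_nonneg_nonneg[OF c])
  let ?S = "\<lambda>g\<in>carr ?H. \<lambda>x\<in>V. g (h x)"
  have S1: "vnorm ?K (?S g) \<le> composition_constant V v h * vnorm ?H g" if "g \<in> carr ?H" for g
    using co(2)[OF C] that by simp
  have S: "?S \<in> bounded_operators ?H ?K"
  proof (rule bounded_operatorsI[OF _ _ _ S1])
    interpret H: complex_normed_space ?H
      by (rule banach_is_normed[OF complex_banach_space_weighted_holomorphic[OF w]])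
    show "?S \<in> carr ?H \<rightarrow>\<^sub>E carr ?K"
      using co(1)[OF C] by auto
    show "?S (vadd ?H g k) = vadd ?K (?S g) (?S k)" if "g \<in> carr ?H" "k \<in> carr ?H" for g k
      using H.add_closed[OF that] that hU by (auto intro!: restrict_ext)
    show "?S (vscale ?H b g) = vscale ?K b (?S g)" if "g \<in> carr ?H" for b g
      using H.scale_closed[OF that, of b] that hU by (auto intro!: restrict_ext)
  qed
  let ?R = "adjoint_operator F G T"
  let ?g = "\<lambda>x\<in>V. T (f (h x))"
  note R = adjoint_operator_bounded[OF nF nG T]
  note t = operator_norm_nonneg[OF nF nG T] operator_norm_bound[OF nF nG T]
  have R1: "vnorm (dual_space F) (?R \<phi>) \<le> operator_norm F G T * vnorm (dual_space G) \<phi>"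
    if "\<phi> \<in> carr (dual_space G)" for \<phi>
    using that by (intro adjoint_norm_le[OF nF nG T] t) simp_all
  have eq: "(\<lambda>\<phi>\<in>carr (dual_space G). ?S (transpose_map U F f (?R \<phi>))) = transpose_map V G ?g"
  proof (rule extensionalityI[of _ "carr (dual_space G)"])
    fix \<phi> assume "\<phi> \<in> carr (dual_space G)"
    then have \<phi>: "\<phi> \<in> bounded_operators G complex_line"
      by simp
    have R\<phi>: "?R \<phi> \<in> bounded_operators F complex_line"
      using bounded_operators_carr[OF R] \<phi> by simp
    have "transpose_map U F f (?R \<phi>) \<in> carr ?H"
      using bounded_operators_carr[OF transpose_bounded[OF w nF fw]] R\<phi> by simp
    then show "(\<lambda>\<phi>\<in>carr (dual_space G). ?S (transpose_map U F f (?R \<phi>))) \<phi> = transpose_map V G ?g \<phi>"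
      using \<phi> transpose_apply[OF R\<phi>, of U f] transpose_apply[OF \<phi>, of V ?g] adjoint_apply[OF nF nG T \<phi>]
        hU weighted_holomorphic_carr[OF fw] by (auto intro!: restrict_ext)
  qed (simp_all add: transpose_map_def)
  note comp = ideal_on_compose[OF copies(1)[OF w G] copies(1)[OF w F] copies(2)[OF w F] copies(2)[OF w' G]
      R ft S t(1) R1 c0 S1, unfolded eq]
  have "(\<lambda>x\<in>U. T (f x)) \<in> weighted_holomorphic E U v G"
    by (rule weighted_holomorphic_operator(1)[OF w nF nG fw T t])
  from co(1)[OF nG this] have "?g \<in> weighted_holomorphic E V (restrict v V) G"
    using hU by (simp cong: restrict_cong)
  then show "?g \<in> weighted_dual_ideal I E V (restrict v V) G"
    using comp(1) by (simp add: weighted_dual_ideal_def)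
  show "weighted_dual_ideal_norm \<alpha> E V (restrict v V) G ?g
      \<le> operator_norm F G T * weighted_dual_ideal_norm \<alpha> E U v F f * composition_constant V v h"
    using comp(2) by (simp add: weighted_dual_ideal_norm_def mult.assoc mult.left_commute mult.commute)
qed

text \<open>The transpose of \<open>j \<circ> f\<close> is the transpose of \<open>f\<close> after the adjoint of \<open>j\<close>, a metric surjection.\<close>

lemma weighted_dual_ideal_injective:
  fixes E :: "'s cspace" and F G :: "'s cspace"
  assumes injective: "injective_operator_ideal I \<alpha>" and symmetric: "completely_symmetric I \<alpha>"
    and w: "weighted_open_set E U v" and F: "complex_banach_space F" and G: "complex_banach_space G"
    and f: "f \<in> weighted_holomorphic E U v F" and j: "isometric_embedding j F G"
    and jf: "compose U j f \<in> weighted_dual_ideal I E U v G"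
  shows "f \<in> weighted_dual_ideal I E U v F"
    and "weighted_dual_ideal_norm \<alpha> E U v F f = weighted_dual_ideal_norm \<alpha> E U v G (compose U j f)"
proof -
  let ?H = "weighted_holomorphic_space E U v complex_line"
  note nF = banach_is_normed[OF F] and nG = banach_is_normed[OF G]
  have jop: "j \<in> bounded_operators F G"
    using j by (simp add: isometric_embedding_def)
  let ?Q = "adjoint_operator F G j"
  note Q = adjoint_of_isometric_embedding[OF nF nG j]
  note dF = complex_banach_space_dual[OF nF] and dG = complex_banach_space_dual[OF nG]
  have eq: "compose (carr (dual_space G)) (transpose_map U F f) ?Q = transpose_map U G (compose U j f)"
  proof (rule extensionalityI[of _ "carr (dual_space G)"])
    fix \<psi> assume "\<psi> \<in> carr (dual_space G)"
    then have \<psi>: "\<psi> \<in> bounded_operators G complex_line"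
      by simp
    have Q\<psi>: "?Q \<psi> \<in> bounded_operators F complex_line"
      using bounded_operators_carr[OF adjoint_operator_bounded[OF nF nG jop]] \<psi> by simp
    show "compose (carr (dual_space G)) (transpose_map U F f) ?Q \<psi> = transpose_map U G (compose U j f) \<psi>"
      using \<psi> transpose_apply[OF Q\<psi>, of U f] transpose_apply[OF \<psi>, of U "compose U j f"]
        adjoint_apply[OF nF nG jop \<psi>] weighted_holomorphic_carr[OF f]
      by (auto simp: compose_def intro!: restrict_ext)
  qed (simp_all add: transpose_map_def compose_def)
  note H = complex_banach_space_weighted_holomorphic[OF w]
  note surj = ideal_on_surjective[OF injective symmetric has_copy_functions[OF dG] has_copy_functions[OF dF]
      has_copy_functions[OF H] Q transpose_bounded[OF w nF f], unfolded eq, OF weighted_dual_idealD(2)[OF w G jf]]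
  show "f \<in> weighted_dual_ideal I E U v F"
    using surj(1) f by (simp add: weighted_dual_ideal_def)
  show "weighted_dual_ideal_norm \<alpha> E U v F f = weighted_dual_ideal_norm \<alpha> E U v G (compose U j f)"
    using surj(2) by (simp add: weighted_dual_ideal_norm_def)
qed

end

theorem corollary1p18:
  fixes I :: "'w operator_class"
    and \<alpha> :: "'w operator_class_norm"
  assumes large: "(UNIV :: (('s \<Rightarrow> complex) \<Rightarrow> complex) set) \<lesssim> (UNIV :: 'w set)"
    and ideal: "normed_operator_ideal I \<alpha>"
    and injective: "injective_operator_ideal I \<alpha>"
    and symmetric: "completely_symmetric I \<alpha>"
  shows "injective_weighted_holomorphic_ideal
           (weighted_dual_ideal I :: 's holomorphic_class) (weighted_dual_ideal_norm \<alpha>)"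
proof -
  interpret large_pietsch_ideal I \<alpha> "TYPE('s)"
    using large ideal by unfold_locales
  have "normed_weighted_holomorphic_ideal (weighted_dual_ideal I :: 's holomorphic_class)
      (weighted_dual_ideal_norm \<alpha>)"
    unfolding normed_weighted_holomorphic_ideal_def
    using weighted_dual_ideal_normed weighted_norm_le_dual_norm weighted_dual_ideal_elementary
      weighted_dual_ideal_compose weighted_dual_idealD(1)
    by (intro conjI allI impI ballI subsetI; (elim conjE)?) auto
  then show ?thesis
    unfolding injective_weighted_holomorphic_ideal_def
    using weighted_dual_ideal_injective[OF injective symmetric] by auto
qed

end
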